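(* Let $0<q\le p<\infty$, let $(\mathcal{X},\rho,\mu)$ be a space of homogeneous type satisfying the weak reverse doubling (WRD) condition, let $Y(\mathcal{X})$ be a ball quasi-Banach function space, and let $Y(\Omega)$ be the restriction of $Y(\mathcal{X})$ to $\Omega$, where $\Omega\subseteq\mathcal{X}$ is a measurable set satisfying the weak measure density (WMD) condition. Assume that $Y^{\frac1p}(\mathcal{X})$ is a ball Banach function space and the Hardy--Littlewood maximal operator $\mathcal{M}$ is bounded on $[Y^{\frac1p}(\mathcal{X})]'$. Then there exist two positive constants $C$ and $\widetilde{C}$ such that the following statements hold. (i) Let $\beta\in(0,\infty)$. For any $f\in C^\beta_{\mathrm b}(\Omega)\cap\bigcup_{s\in(0,1)}\dot{W}^{s,q}_Y(\Omega)$, $$C\|f\|_{Y(\Omega)}\le\liminf_{s\to0^+}s^{\frac1q}\left\|\left\{\int_{\Omega}\frac{|f(\cdot)-f(y)|^q}{U(\cdot,y)[\rho(\cdot,y)]^{sq}}\,d\mu(y)\right\}^{\frac1q}\right\|_{Y(\Omega)}\le\limsup_{s\to0^+}s^{\frac1q}\left\|\left\{\int_{\Omega}\frac{|f(\cdot)-f(y)|^q}{U(\cdot,y)[\rho(\cdot,y)]^{sq}}\,d\mu(y)\right\}^{\frac1q}\right\|_{Y(\Omega)}\le\widetilde{C}\|f\|_{Y(\Omega)}.$$ (ii) If $Y(\mathcal{X})$ is further assumed to have an absolutely continuous quasi-norm, then, for any $f\in[Y(\Omega)/\mathbb{R}]\cap\bigcup_{s\in(0,1)}\dot{W}^{s,q}_Y(\Omega)$,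 $$C\|f\|_{Y(\Omega)/\mathbb{R}}\le\liminf_{s\to0^+}s^{\frac1q}\left\|\left\{\int_{\Omega}\frac{|f(\cdot)-f(y)|^q}{U(\cdot,y)[\rho(\cdot,y)]^{sq}}\,d\mu(y)\right\}^{\frac1q}\right\|_{Y(\Omega)}\le\limsup_{s\to0^+}s^{\frac1q}\left\|\left\{\int_{\Omega}\frac{|f(\cdot)-f(y)|^q}{U(\cdot,y)[\rho(\cdot,y)]^{sq}}\,d\mu(y)\right\}^{\frac1q}\right\|_{Y(\Omega)}\le\widetilde{C}\|f\|_{Y(\Omega)/\mathbb{R}}.$$
   Context: A quasi-metric on a nonempty set $\mathcal{X}$ is $\rho:\mathcal{X}\times\mathcal{X}\to[0,\infty)$ with $\rho(x,y)=0$ iff $x=y$, $\rho(x,y)=\rho(y,x)$, and $\rho(x,z)\le K_0[\rho(x,y)+\rho(y,z)]$ for some constant $K_0\in[1,\infty)$. Balls: $B(x,r):=\{y:\rho(x,y)<r\}$. $(\mathcal{X},\rho,\mu)$ is a space of homogeneous type if $\rho$ is a quasi-metric, $\mu$ is a nonnegative measure on a $\sigma$-algebra containing all balls, and there is $L_{(\mu)}\in[1,\infty)$ with $0<\mu(B(x,2r))\le L_{(\mu)}\mu(B(x,r))<\infty$ for all $x\in\mathcal{X}$, $r\in(0,\infty)$. WRD condition: there exist $x_0\in\mathcal{X}$ and $\lambda,C_{(\mu)}\in(1,\infty)$ with $\liminf_{r\to\infty}\frac{\mu(B(x_0,\lambda r))}{\mu(B(x_0,r))}\ge C_{(\mu)}$.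 A measurable set $\Omega\subseteq\mathcal{X}$ satisfies the WMD condition if there exist $x_0\in\mathcal{X}$ and $C_0\in(0,1]$ with $\liminf_{r\to\infty}\frac{\mu(B(x_0,r)\cap\Omega)}{\mu(B(x_0,r))}\ge C_0$. Put $U(x,y):=\min\{\mu(B(x,\rho(x,y))),\mu(B(y,\rho(x,y)))\}$. The integrand $|f(x)-f(y)|^q/(U(x,y)[\rho(x,y)]^{sq})$ is read as $0$ at $y=x$. $\mathscr{M}(\mathcal{X})$, $\mathscr{M}(\Omega)$ are the sets of $\mu$-measurable functions on $\mathcal{X}$, $\Omega$. A ball quasi-Banach function space $Y(\mathcal{X})$ is a quasi-Banach space of functions in $\mathscr{M}(\mathcal{X})$ whose quasi-norm makes sense (with values in $[0,\infty]$) for all $f\in\mathscr{M}(\mathcal{X})$, such that: (i) $\|f\|_{Y(\mathcal{X})}=0$ implies $f=0$ $\mu$-a.e.; (ii) $|g|\le|f|$ $\mu$-a.e. implies $\|g\|_{Y(\mathcal{X})}\le\|f\|_{Y(\mathcal{X})}$; (iii) $0\le f_m\uparrow f$ $\mu$-a.e. implies $\|f_m\|_{Y(\mathcal{X})}\uparrow\|f\|_{Y(\mathcal{X})}$; (iv) $\mathbf{1}_B\in Y(\mathcal{X})$ for every ball $B$. It is a ball Banach function space if moreover (v) the triangle inequality holds and (vi) for each ball $B$ there is $C_{(B)}\in(0,\infty)$ with $\int_B|f|\,d\mu\le C_{(B)}\|f\|_{Y(\mathcal{X})}$ for all $f\in Y(\mathcal{X})$. For $t\in(0,\infty)$, $Y^t(\mathcal{X}):=\{f\in\mathscr{M}(\mathcal{X}):|f|^t\in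 Y(\mathcal{X})\}$ with $\|f\|_{Y^t(\mathcal{X})}:=\||f|^t\|_{Y(\mathcal{X})}^{1/t}$. For a ball Banach function space $Z(\mathcal{X})$, $[Z(\mathcal{X})]':=\{f\in\mathscr{M}(\mathcal{X}):\|f\|_{[Z(\mathcal{X})]'}:=\sup_{\|g\|_{Z(\mathcal{X})}\le1}\|fg\|_{L^1(\mathcal{X})}<\infty\}$. $\mathcal{M}f(x):=\sup_{B\ni x}\frac1{\mu(B)}\int_B|f|\,d\mu$, supremum over all balls containing $x$. $Y(\mathcal{X})$ has an absolutely continuous quasi-norm if $\|f\mathbf{1}_{E_j}\|_{Y(\mathcal{X})}\to0$ whenever $f\in Y(\mathcal{X})$ and $\{E_j\}$ are measurable sets with $\mathbf{1}_{E_j}\to0$ $\mu$-a.e. $Y(\Omega):=\{f\in\mathscr{M}(\Omega): f=g|_\Omega\text{ for some }g\in Y(\mathcal{X})\}$ with $\|f\|_{Y(\Omega)}:=\inf\{\|g\|_{Y(\mathcal{X})}:g\in Y(\mathcal{X}),g|_\Omega=f\}$ (and $\infty$ if no such $g$). $\dot W^{s,q}_Y(\Omega)$: all $f\in\mathscr{M}(\Omega)$ with $\big\|\{\int_{\Omega}\frac{|f(\cdot)-f(y)|^q}{U(\cdot,y)[\rho(\cdot,y)]^{sq}}d\mu(y)\}^{1/q}\big\|_{Y(\Omega)}<\infty$. $Y(\Omega)/\mathbb{R}$: (classes modulo additive real constants of) measurable $f$ on $\Omega$ with $\|f\|_{Y(\Omega)/\mathbb{R}}:=\inf_{a\in\mathbb{R}}\|f+a\|_{Y(\Omega)}<\infty$.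 $C^\beta_{\mathrm b}(\mathcal{X})$: complex-valued functions $g$ on $\mathcal{X}$ with bounded support $\{g\ne0\}$ and $\sup_{x\ne y}|g(x)-g(y)|/[\rho(x,y)]^\beta<\infty$. $C^\beta_{\mathrm b}(\Omega)$: functions $f$ on $\Omega$ for which there is $g\in C^\beta_{\mathrm b}(\mathcal{X})$ with $g=f$ on $\Omega$ and $g\equiv0$ on $\mathcal{X}\setminus\Omega$. $s\to0^+$ means $s\in(0,1)$, $s\to0$. *)

theory Defs
  imports "HOL-Analysis.Analysis"
begin

text \<open>
  The underlying set is the carrier \<open>space M\<close> of a measure \<open>M\<close>. A complex function
  on \<open>space M\<close>, or on a subset \<open>\<Omega>\<close>, is a total function of which only the values on that set
  matter; the measurable functions are \<open>borel_measurable M\<close> and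
  \<open>borel_measurable (restrict_space M \<Omega>)\<close>. Quantities that may be infinite live in
  \<^typ>\<open>ennreal\<close>.
\<close>

text \<open>Only used with positive exponents.\<close>
definition ennpowr :: "ennreal \<Rightarrow> real \<Rightarrow> ennreal" where
  "ennpowr x a = (if x = top then top else ennreal (enn2real x powr a))"


section \<open>Spaces of homogeneous type\<close>

definition quasi_metric_on :: "'a set \<Rightarrow> ('a \<Rightarrow> 'a \<Rightarrow> real) \<Rightarrow> bool" where
  "quasi_metric_on X \<rho> \<longleftrightarrow>
     X \<noteq> {} \<and>
     (\<forall>x\<in>X. \<forall>y\<in>X. 0 \<le> \<rho> x y \<and> (\<rho> x y = 0 \<longleftrightarrow> x = y) \<and> \<rho> x y = \<rho> y x) \<and>
     (\<exists>K\<^sub>0\<ge>1. \<forall>x\<in>X. \<forall>y\<in>X. \<forall>z\<in>X. \<rho> x z \<le> K\<^sub>0 * (\<rho> x y + \<rho> y z))"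

definition qball :: "'a measure \<Rightarrow> ('a \<Rightarrow> 'a \<Rightarrow> real) \<Rightarrow> 'a \<Rightarrow> real \<Rightarrow> 'a set" where
  "qball M \<rho> x r = {y \<in> space M. \<rho> x y < r}"

definition homogeneous_type :: "'a measure \<Rightarrow> ('a \<Rightarrow> 'a \<Rightarrow> real) \<Rightarrow> bool" where
  "homogeneous_type M \<rho> \<longleftrightarrow>
     quasi_metric_on (space M) \<rho> \<and>
     (\<forall>x\<in>space M. \<forall>r>0. qball M \<rho> x r \<in> sets M) \<and>
     (\<exists>L::real. L \<ge> 1 \<and> (\<forall>x\<in>space M. \<forall>r>0.
        0 < emeasure M (qball M \<rho> x (2 * r)) \<and>
        emeasure M (qball M \<rho> x (2 * r)) \<le> ennreal L * emeasure M (qball M \<rho> x r) \<and>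
        ennreal L * emeasure M (qball M \<rho> x r) < top))"

definition weak_reverse_doubling :: "'a measure \<Rightarrow> ('a \<Rightarrow> 'a \<Rightarrow> real) \<Rightarrow> bool" where
  "weak_reverse_doubling M \<rho> \<longleftrightarrow>
     (\<exists>x\<^sub>0\<in>space M. \<exists>l>1. \<exists>C::real. C > 1 \<and>
        Liminf at_top (\<lambda>r::real. emeasure M (qball M \<rho> x\<^sub>0 (l * r)) / emeasure M (qball M \<rho> x\<^sub>0 r))
          \<ge> ennreal C)"

definition weak_measure_density :: "'a measure \<Rightarrow> ('a \<Rightarrow> 'a \<Rightarrow> real) \<Rightarrow> 'a set \<Rightarrow> bool" where
  "weak_measure_density M \<rho> \<Omega> \<longleftrightarrow>
     (\<exists>x\<^sub>0\<in>space M. \<exists>C\<^sub>0::real. 0 < C\<^sub>0 \<and> C\<^sub>0 \<le> 1 \<and>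
        Liminf at_top (\<lambda>r::real. emeasure M (qball M \<rho> x\<^sub>0 r \<inter> \<Omega>) / emeasure M (qball M \<rho> x\<^sub>0 r))
          \<ge> ennreal C\<^sub>0)"


section \<open>Ball quasi-Banach function spaces\<close>

text \<open>
  A space \<open>Y\<close> is represented by its quasi-norm \<open>N\<close>, defined on all measurable functions with
  values in \<open>[0,\<infinity>]\<close>; membership in \<open>Y\<close> is finiteness of \<open>N\<close>. The values of \<open>N\<close> on
  nonmeasurable functions are irrelevant.
\<close>

type_synonym 'a fun_norm = "('a \<Rightarrow> complex) \<Rightarrow> ennreal"

definition fun_space :: "'a measure \<Rightarrow> 'a fun_norm \<Rightarrow> ('a \<Rightarrow> complex) set" where
  "fun_space M N = {f \<in> borel_measurable M. N f < top}"

definition quasi_norm_on :: "'a measure \<Rightarrow> 'a fun_norm \<Rightarrow> bool" where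
  "quasi_norm_on M N \<longleftrightarrow>
     (\<forall>f\<in>borel_measurable M. \<forall>c::complex. N (\<lambda>x. c * f x) = ennreal (cmod c) * N f) \<and>
     (\<exists>K::real. K \<ge> 1 \<and> (\<forall>f\<in>borel_measurable M. \<forall>g\<in>borel_measurable M.
        N (\<lambda>x. f x + g x) \<le> ennreal K * (N f + N g)))"

definition complete_fun_space :: "'a measure \<Rightarrow> 'a fun_norm \<Rightarrow> bool" where
  "complete_fun_space M N \<longleftrightarrow>
     (\<forall>u::nat \<Rightarrow> 'a \<Rightarrow> complex.
        (\<forall>n. u n \<in> fun_space M N) \<and>
        (\<forall>e>0. \<exists>n0. \<forall>m\<ge>n0. \<forall>n\<ge>n0. N (\<lambda>x. u m x - u n x) < e) \<longrightarrow>
        (\<exists>f\<in>fun_space M N. (\<lambda>n. N (\<lambda>x. u n x - f x)) \<longlonglongrightarrow> 0))"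

definition ball_quasi_banach :: "'a measure \<Rightarrow> ('a \<Rightarrow> 'a \<Rightarrow> real) \<Rightarrow> 'a fun_norm \<Rightarrow> bool" where
  "ball_quasi_banach M \<rho> N \<longleftrightarrow>
     quasi_norm_on M N \<and> complete_fun_space M N \<and>
     (\<forall>f\<in>borel_measurable M. N f = 0 \<longrightarrow> (AE x in M. f x = 0)) \<and>
     (\<forall>f\<in>borel_measurable M. \<forall>g\<in>borel_measurable M.
        (AE x in M. cmod (g x) \<le> cmod (f x)) \<longrightarrow> N g \<le> N f) \<and>
     (\<forall>(u::nat \<Rightarrow> 'a \<Rightarrow> real) v.
        (\<forall>m. u m \<in> borel_measurable M) \<and> v \<in> borel_measurable M \<and>
        (AE x in M. (\<forall>m. 0 \<le> u m x) \<and> incseq (\<lambda>m. u m x) \<and> (\<lambda>m. u m x) \<longlonglongrightarrow> v x) \<longrightarrow>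
        incseq (\<lambda>m. N (\<lambda>x. complex_of_real (u m x))) \<and>
        (\<lambda>m. N (\<lambda>x. complex_of_real (u m x))) \<longlonglongrightarrow> N (\<lambda>x. complex_of_real (v x))) \<and>
     (\<forall>x\<in>space M. \<forall>r>0. indicator (qball M \<rho> x r) \<in> fun_space M N)"

definition ball_banach :: "'a measure \<Rightarrow> ('a \<Rightarrow> 'a \<Rightarrow> real) \<Rightarrow> 'a fun_norm \<Rightarrow> bool" where
  "ball_banach M \<rho> N \<longleftrightarrow>
     ball_quasi_banach M \<rho> N \<and>
     (\<forall>f\<in>borel_measurable M. \<forall>g\<in>borel_measurable M. N (\<lambda>x. f x + g x) \<le> N f + N g) \<and>
     (\<forall>x\<in>space M. \<forall>r>0. \<exists>C::real. C > 0 \<and> (\<forall>f\<in>fun_space M N.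
        (\<integral>\<^sup>+y\<in>qball M \<rho> x r. ennreal (cmod (f y)) \<partial>M) \<le> ennreal C * N f))"

text \<open>The quasi-norm of the power space \<open>Y\<^sup>t\<close>.\<close>
definition power_norm :: "'a fun_norm \<Rightarrow> real \<Rightarrow> 'a fun_norm" where
  "power_norm N t f = ennpowr (N (\<lambda>x. complex_of_real (cmod (f x) powr t))) (1 / t)"

definition abs_continuous_norm :: "'a measure \<Rightarrow> 'a fun_norm \<Rightarrow> bool" where
  "abs_continuous_norm M N \<longleftrightarrow>
     (\<forall>f\<in>fun_space M N. \<forall>E::nat \<Rightarrow> 'a set.
        (\<forall>j. E j \<in> sets M) \<and> (AE x in M. (\<lambda>j. indicator (E j) x :: real) \<longlonglongrightarrow> 0) \<longrightarrow>
        (\<lambda>j. N (\<lambda>x. f x * indicator (E j) x)) \<longlonglongrightarrow> 0)"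

text \<open>
  The norm of the associate space is stated for \<open>[0,\<infinity>]\<close>-valued functions, so that it also applies
  to a maximal function; a complex function enters through its modulus.
\<close>
definition assoc_norm :: "'a measure \<Rightarrow> 'a fun_norm \<Rightarrow> ('a \<Rightarrow> ennreal) \<Rightarrow> ennreal" where
  "assoc_norm M Z h =
     (SUP g\<in>{g \<in> borel_measurable M. Z g \<le> 1}. \<integral>\<^sup>+x. h x * ennreal (cmod (g x)) \<partial>M)"

definition assoc_space :: "'a measure \<Rightarrow> 'a fun_norm \<Rightarrow> ('a \<Rightarrow> complex) set" where
  "assoc_space M Z = {f \<in> borel_measurable M. assoc_norm M Z (\<lambda>x. ennreal (cmod (f x))) < top}"

definition maximal_fun ::
    "'a measure \<Rightarrow> ('a \<Rightarrow> 'a \<Rightarrow> real) \<Rightarrow> ('a \<Rightarrow> complex) \<Rightarrow> 'a \<Rightarrow> ennreal" where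
  "maximal_fun M \<rho> f x =
     (SUP B\<in>{qball M \<rho> z r |z r. z \<in> space M \<and> r > 0 \<and> x \<in> qball M \<rho> z r}.
        (\<integral>\<^sup>+y\<in>B. ennreal (cmod (f y)) \<partial>M) / emeasure M B)"

definition maximal_bounded_on_assoc ::
    "'a measure \<Rightarrow> ('a \<Rightarrow> 'a \<Rightarrow> real) \<Rightarrow> 'a fun_norm \<Rightarrow> bool" where
  "maximal_bounded_on_assoc M \<rho> Z \<longleftrightarrow>
     (\<exists>C::real. C > 0 \<and> (\<forall>f\<in>assoc_space M Z.
        assoc_norm M Z (maximal_fun M \<rho> f)
          \<le> ennreal C * assoc_norm M Z (\<lambda>x. ennreal (cmod (f x)))))"


section \<open>Function spaces on a subset\<close>

definition restr_norm :: "'a measure \<Rightarrow> 'a fun_norm \<Rightarrow> 'a set \<Rightarrow> 'a fun_norm" where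
  "restr_norm M N \<Omega> f =
     Inf {N g |g. g \<in> fun_space M N \<and> (AE x in M. x \<in> \<Omega> \<longrightarrow> g x = f x)}"

text \<open>
  The same quasi-norm for \<open>[0,\<infinity>]\<close>-valued functions. Functions in \<open>Y\<close> are finite, so a function
  that is infinite on a subset of \<open>\<Omega>\<close> of positive measure has no extension in \<open>Y\<close>.
  The last branch is a convention for functions that are not measurable on \<open>\<Omega>\<close>, where
  the quasi-norm has no meaning a priori: as the balls of a quasi-metric space need not be open,
  nor \<open>\<rho>\<close> jointly measurable, the function \<open>gagliardo\<close> below can be of this kind. By the lattice
  property the value for a measurable function is also given by the formula in the last branch.
\<close>
definition restr_norm_enn ::
    "'a measure \<Rightarrow> 'a fun_norm \<Rightarrow> 'a set \<Rightarrow> ('a \<Rightarrow> ennreal) \<Rightarrow> ennreal" where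
  "restr_norm_enn M N \<Omega> h =
     (if h \<in> borel_measurable (restrict_space M \<Omega>) then
        (if AE x in M. x \<in> \<Omega> \<longrightarrow> h x < top
         then restr_norm M N \<Omega> (\<lambda>x. complex_of_real (enn2real (h x)))
         else top)
      else Inf {N g |g. g \<in> fun_space M N \<and> (AE x in M. x \<in> \<Omega> \<longrightarrow> h x \<le> ennreal (cmod (g x)))})"

definition U_fun :: "'a measure \<Rightarrow> ('a \<Rightarrow> 'a \<Rightarrow> real) \<Rightarrow> 'a \<Rightarrow> 'a \<Rightarrow> ennreal" where
  "U_fun M \<rho> x y =
     min (emeasure M (qball M \<rho> x (\<rho> x y))) (emeasure M (qball M \<rho> y (\<rho> x y)))"

definition gagliardo ::
    "'a measure \<Rightarrow> ('a \<Rightarrow> 'a \<Rightarrow> real) \<Rightarrow> 'a set \<Rightarrow> real \<Rightarrow> real \<Rightarrow> ('a \<Rightarrow> complex) \<Rightarrow> 'a \<Rightarrow> ennreal" where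
  "gagliardo M \<rho> \<Omega> s q f x =
     ennpowr
       (\<integral>\<^sup>+y\<in>\<Omega>. (if y = x then 0
                 else ennreal (cmod (f x - f y) powr q)
                        / (U_fun M \<rho> x y * ennreal (\<rho> x y powr (s * q)))) \<partial>M)
       (1 / q)"

definition sobolev_seminorm ::
    "'a measure \<Rightarrow> ('a \<Rightarrow> 'a \<Rightarrow> real) \<Rightarrow> 'a fun_norm \<Rightarrow> 'a set \<Rightarrow> real \<Rightarrow> real \<Rightarrow> 'a fun_norm" where
  "sobolev_seminorm M \<rho> N \<Omega> s q f = restr_norm_enn M N \<Omega> (gagliardo M \<rho> \<Omega> s q f)"

definition sobolev_space ::
    "'a measure \<Rightarrow> ('a \<Rightarrow> 'a \<Rightarrow> real) \<Rightarrow> 'a fun_norm \<Rightarrow> 'a set \<Rightarrow> real \<Rightarrow> real \<Rightarrow> ('a \<Rightarrow> complex) set" where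
  "sobolev_space M \<rho> N \<Omega> s q =
     {f \<in> borel_measurable (restrict_space M \<Omega>). sobolev_seminorm M \<rho> N \<Omega> s q f < top}"

definition quot_norm :: "'a measure \<Rightarrow> 'a fun_norm \<Rightarrow> 'a set \<Rightarrow> 'a fun_norm" where
  "quot_norm M N \<Omega> f = (INF a::real. restr_norm M N \<Omega> (\<lambda>x. f x + complex_of_real a))"

text \<open>Represented by functions instead of classes modulo real constants; everything stated about
  them below is invariant under adding a real constant.\<close>
definition quot_space :: "'a measure \<Rightarrow> 'a fun_norm \<Rightarrow> 'a set \<Rightarrow> ('a \<Rightarrow> complex) set" where
  "quot_space M N \<Omega> =
     {f \<in> borel_measurable (restrict_space M \<Omega>). quot_norm M N \<Omega> f < top}"

definition holder_bs :: "'a measure \<Rightarrow> ('a \<Rightarrow> 'a \<Rightarrow> real) \<Rightarrow> real \<Rightarrow> ('a \<Rightarrow> complex) set" where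
  "holder_bs M \<rho> \<beta> =
     {g. (\<exists>x\<in>space M. \<exists>r>0. {y \<in> space M. g y \<noteq> 0} \<subseteq> qball M \<rho> x r) \<and>
         (\<exists>L::real. \<forall>x\<in>space M. \<forall>y\<in>space M. x \<noteq> y \<longrightarrow> cmod (g x - g y) / \<rho> x y powr \<beta> \<le> L)}"

definition holder_bs_on ::
    "'a measure \<Rightarrow> ('a \<Rightarrow> 'a \<Rightarrow> real) \<Rightarrow> 'a set \<Rightarrow> real \<Rightarrow> ('a \<Rightarrow> complex) set" where
  "holder_bs_on M \<rho> \<Omega> \<beta> =
     {f. \<exists>g\<in>holder_bs M \<rho> \<beta>. (\<forall>x\<in>\<Omega>. g x = f x) \<and> (\<forall>x\<in>space M - \<Omega>. g x = 0)}"

end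

theory Submission
  imports Defs
begin

text \<open>
  Write \<open>Z\<close> for the space \<open>Y\<^sup>1\<^sup>/\<^sup>p\<close>, \<open>V(x,r)\<close>
  for \<open>\<mu>(B(x,r))\<close>, and read functions on \<open>\<Omega>\<close> as functions on the
  whole space that vanish outside \<open>\<Omega>\<close>.

  Upper estimate. Split the Gagliardo integral at distance \<open>1\<close>. The near part is at most
  the integral for a fixed \<open>s\<^sub>0 > s\<close> at which the seminorm is finite, so the factor
  \<open>s\<^sup>1\<^sup>/\<^sup>q\<close> makes it vanish in the limit. In the far part \<open>|f(x) -
  f(y)|\<^sup>q\<close> is at most \<open>2\<^sup>q (|f(x)|\<^sup>q + |f(y)|\<^sup>q)\<close>. By
  doubling, the dyadic shell at distance about \<open>2\<^sup>k\<close> carries a mass of the kernel of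
  order \<open>2\<^sup>-\<^sup>k\<^sup>s\<^sup>q\<close>, and the sum of these masses is of order
  \<open>1/s\<close>. After multiplication by \<open>s\<close> the first term gives a multiple of
  \<open>|f(x)|\<^sup>q\<close>, and the second one a convex combination of the averages of
  \<open>|f|\<^sup>q\<close> over the balls \<open>B(x,2\<^sup>k)\<close>. Thus everything reduces to a
  bound in \<open>Y\<close>, uniform in the weights, for such combinations of averages (lemma
  \<open>weighted_averages_bound_N\<close>). As \<open>q \<le> p\<close>, it suffices to bound the
  averages of \<open>|f|\<^sup>p\<close> in \<open>Z\<close>. Tested against a function \<open>u\<close>
  in the unit ball of the associate space \<open>Z'\<close>, an average passes to \<open>u\<close>,
  where it is dominated by the maximal function of \<open>u\<close>, which is bounded in
  \<open>Z'\<close>. To return from these tests to the norm of \<open>Z\<close> one needs the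
  Lorentz--Luxemburg theorem \<open>Z'' = Z\<close> (lemma \<open>Lorentz_Luxemburg\<close>). It is a
  separation theorem for the unit ball of \<open>Z\<close>, and it follows from the existence of nearest
  points in \<open>L\<^sup>2\<close>.

  Lower estimate. Let \<open>x\<close> lie in a ball \<open>B\<close> about a fixed centre and
  \<open>y\<close> outside a much larger concentric ball \<open>B'\<close>. Then
  \<open>|f(x)|\<^sup>q\<close> is at most \<open>2\<^sup>q (|f(x) - f(y)|\<^sup>q +
  |f(y)|\<^sup>q)\<close>. Reverse doubling and the density of \<open>\<Omega>\<close> make the mass of
  the kernel over \<open>\<Omega> - B'\<close> at least \<open>c/s\<close> for small \<open>s\<close>
  (lemma \<open>kernel_mass_lower_bound\<close>), so integration in \<open>y\<close> bounds
  \<open>|f|\<close> on \<open>B\<close> by the normalised Gagliardo function and by averages of the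
  part of \<open>f\<close> outside \<open>B'\<close>. The latter are controlled by the norm of that
  part. It is zero for large \<open>B\<close> if \<open>f\<close> has bounded support, and tends to zero
  if the quasi-norm is absolutely continuous. For functions modulo constants the estimates are applied
  to a translate of \<open>f\<close> that belongs to the space.

  Measurability. Since \<open>\<rho>\<close> is measurable in each variable only, neither the averages
  nor the Gagliardo function need be measurable in \<open>x\<close>. Averages are therefore replaced by
  step functions subordinate to a countable net, for which duality needs no Fubini theorem, and the
  seminorm is handled through the majorants of the Gagliardo function.
\<close>

section \<open>Volumes of balls and nets in a space of homogeneous type\<close>

locale homogeneous_space =
  fixes M :: "'a measure" and \<rho> :: "'a \<Rightarrow> 'a \<Rightarrow> real" and K L :: real
  assumes space_nonempty: "space M \<noteq> {}"
    and K1: "1 \<le> K" and L1: "1 \<le> L"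
    and rho_nonneg: "\<And>x y. x \<in> space M \<Longrightarrow> y \<in> space M \<Longrightarrow> 0 \<le> \<rho> x y"
    and rho_eq_0_iff: "\<And>x y. x \<in> space M \<Longrightarrow> y \<in> space M \<Longrightarrow> \<rho> x y = 0 \<longleftrightarrow> x = y"
    and rho_sym: "\<And>x y. x \<in> space M \<Longrightarrow> y \<in> space M \<Longrightarrow> \<rho> x y = \<rho> y x"
    and rho_triangle: "\<And>x y z. x \<in> space M \<Longrightarrow> y \<in> space M \<Longrightarrow> z \<in> space M \<Longrightarrow> \<rho> x z \<le> K * (\<rho> x y + \<rho> y z)"
    and ball_sets_pos: "\<And>x r. x \<in> space M \<Longrightarrow> 0 < r \<Longrightarrow> qball M \<rho> x r \<in> sets M"
    and ball_pos: "\<And>x r. x \<in> space M \<Longrightarrow> 0 < r \<Longrightarrow> 0 < emeasure M (qball M \<rho> x r)"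
    and ball_finite: "\<And>x r. x \<in> space M \<Longrightarrow> 0 < r \<Longrightarrow> emeasure M (qball M \<rho> x r) < top"
    and ball_doubling: "\<And>x r. x \<in> space M \<Longrightarrow> 0 < r \<Longrightarrow>
      emeasure M (qball M \<rho> x (2 * r)) \<le> ennreal L * emeasure M (qball M \<rho> x r)"

lemma homogeneous_type_imp_homogeneous_space:
  assumes "homogeneous_type M \<rho>"
  obtains K L where "homogeneous_space M \<rho> K L"
proof -
  have qm: "quasi_metric_on (space M) \<rho>" and bs: "\<And>x r. x \<in> space M \<Longrightarrow> 0 < r \<Longrightarrow> qball M \<rho> x r \<in> sets M"
    using assms unfolding homogeneous_type_def by blast+
  obtain L :: real where L: "L \<ge> 1" and D: "\<And>x r. x \<in> space M \<Longrightarrow> 0 < r \<Longrightarrow>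
        0 < emeasure M (qball M \<rho> x (2 * r)) \<and>
        emeasure M (qball M \<rho> x (2 * r)) \<le> ennreal L * emeasure M (qball M \<rho> x r) \<and>
        ennreal L * emeasure M (qball M \<rho> x r) < top"
    using assms unfolding homogeneous_type_def by blast
  obtain K where K: "K \<ge> 1" "\<And>x y z. x \<in> space M \<Longrightarrow> y \<in> space M \<Longrightarrow> z \<in> space M \<Longrightarrow> \<rho> x z \<le> K * (\<rho> x y + \<rho> y z)"
    using qm unfolding quasi_metric_on_def by metis
  have "homogeneous_space M \<rho> K L"
  proof
    fix x r assume x: "x \<in> space M" and r: "0 < (r::real)"
    show "0 < emeasure M (qball M \<rho> x r)"
    proof -
      have "0 < emeasure M (qball M \<rho> x (2 * (r / 2)))" using D[OF x, of "r/2"] r by (simp only: half_gt_zero)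
      then show ?thesis by simp
    qed
    show "emeasure M (qball M \<rho> x r) < top"
    proof -
      have "ennreal L * emeasure M (qball M \<rho> x r) < top" using D[OF x r] by blast
      then show ?thesis using L by (auto simp: ennreal_mult_less_top)
    qed
    show "emeasure M (qball M \<rho> x (2 * r)) \<le> ennreal L * emeasure M (qball M \<rho> x r)"
      using D[OF x r] by blast
    show "qball M \<rho> x r \<in> sets M" by (rule bs[OF x r])
  next
    fix x y assume "x \<in> space M" "y \<in> space M"
    then show "0 \<le> \<rho> x y" "\<rho> x y = 0 \<longleftrightarrow> x = y" "\<rho> x y = \<rho> y x"
      using qm unfolding quasi_metric_on_def by blast+
  next
    show "space M \<noteq> {}" using qm unfolding quasi_metric_on_def by blast
  qed (use K L in blast)+
  then show thesis by (rule that)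
qed

lemma divide_ennreal_pos: "0 < v \<Longrightarrow> x / ennreal v = ennreal (1 / v) * x"
  by (simp add: divide_ennreal_def inverse_ennreal inverse_eq_divide mult.commute)

context homogeneous_space
begin

abbreviation B :: "'a \<Rightarrow> real \<Rightarrow> 'a set" where "B x r \<equiv> qball M \<rho> x r"

definition V :: "'a \<Rightarrow> real \<Rightarrow> real" where "V x r = measure M (B x r)"

abbreviation avg :: "'a \<Rightarrow> real \<Rightarrow> ('a \<Rightarrow> ennreal) \<Rightarrow> ennreal" where
  "avg x r H \<equiv> (\<integral>\<^sup>+y\<in>B x r. H y \<partial>M) / emeasure M (B x r)"

lemma mem_ball: "y \<in> B x r \<longleftrightarrow> y \<in> space M \<and> \<rho> x y < r"
  unfolding qball_def by auto

lemma ball_empty: "x \<in> space M \<Longrightarrow> r \<le> 0 \<Longrightarrow> B x r = {}"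
  using order_trans[OF _ rho_nonneg[of x]] by (fastforce simp: mem_ball not_less)

lemma ball_sets [measurable]: "x \<in> space M \<Longrightarrow> B x r \<in> sets M"
  using ball_sets_pos[of x r] ball_empty[of x r] by (cases "0 < r") auto

lemma emeasure_ball:
  assumes "x \<in> space M" shows "emeasure M (B x r) = ennreal (V x r)"
proof -
  have "emeasure M (B x r) < top"
    using ball_finite[OF assms, of r] ball_empty[OF assms, of r] by (cases "0 < r") auto
  then show ?thesis unfolding V_def by (simp add: emeasure_eq_ennreal_measure)
qed

lemma V_pos: "x \<in> space M \<Longrightarrow> 0 < r \<Longrightarrow> 0 < V x r"
  using ball_pos[of x r] by (simp add: emeasure_ball)

lemma V_nonneg [simp]: "0 \<le> V x r" by (simp add: V_def)

lemma V_mono_ball: "x \<in> space M \<Longrightarrow> y \<in> space M \<Longrightarrow> B x r \<subseteq> B y s \<Longrightarrow> V x r \<le> V y s"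
  using emeasure_mono[of "B x r" "B y s" M] by (simp add: emeasure_ball)

lemma V_mono: "x \<in> space M \<Longrightarrow> r \<le> s \<Longrightarrow> V x r \<le> V x s"
  by (rule V_mono_ball) (auto simp: mem_ball)

lemma V_double: "x \<in> space M \<Longrightarrow> 0 < r \<Longrightarrow> V x (2 * r) \<le> L * V x r"
  using ball_doubling[of x r] L1 by (simp add: emeasure_ball ennreal_mult[symmetric])

lemma V_dilation: "\<exists>D::real\<ge>1. \<forall>x\<in>space M. \<forall>r>0. V x (a * r) \<le> D * V x r"
proof -
  obtain n where n: "a \<le> 2 ^ n" using real_arch_pow[of 2 a] by (auto intro: less_imp_le)
  have pow: "V x (2 ^ n * r) \<le> L ^ n * V x r" if x: "x \<in> space M" and r: "0 < r" for x r n
  proof (induction n)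
    case (Suc n)
    have "V x (2 ^ Suc n * r) \<le> L * V x (2 ^ n * r)"
      using V_double[OF x, of "2 ^ n * r"] r by (simp add: mult.assoc)
    also have "\<dots> \<le> L * (L ^ n * V x r)" using Suc L1 by (intro mult_left_mono) auto
    finally show ?case by (simp add: mult.assoc)
  qed simp
  show ?thesis
  proof (intro exI[of _ "L ^ n"] conjI ballI allI impI)
    fix x r assume x: "x \<in> space M" and r: "0 < (r::real)"
    have "V x (a * r) \<le> V x (2 ^ n * r)" using n r by (intro V_mono[OF x] mult_right_mono) auto
    also have "\<dots> \<le> L ^ n * V x r" by (rule pow[OF x r])
    finally show "V x (a * r) \<le> L ^ n * V x r" .
  qed (use L1 in simp)
qed

lemma ball_subset:
  assumes "x \<in> space M" "y \<in> space M" "\<rho> y x \<le> s"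
  shows "B x r \<subseteq> B y (K * (s + r))"
proof
  fix z assume z: "z \<in> B x r"
  then have "\<rho> y z \<le> K * (\<rho> y x + \<rho> x z)" using assms by (intro rho_triangle) (auto simp: mem_ball)
  also have "\<dots> < K * (s + r)" using z assms K1 by (intro mult_strict_left_mono) (auto simp: mem_ball)
  finally show "z \<in> B y (K * (s + r))" using z by (simp add: mem_ball)
qed

text \<open>
  The ball \<open>B(x,ar)\<close> lies in \<open>B(y,2Kar)\<close>, whose volume is comparable to that
  of \<open>B(y,r)\<close> by doubling.
\<close>
lemma V_compare:
  "\<exists>D::real\<ge>1. \<forall>x\<in>space M. \<forall>y\<in>space M. \<forall>r>0. \<rho> x y \<le> a * r \<longrightarrow> V x (a * r) \<le> D * V y r"
proof -
  obtain D where D: "1 \<le> D" "\<And>x r. x \<in> space M \<Longrightarrow> 0 < r \<Longrightarrow> V x (K * (a + a) * r) \<le> D * V x r"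
    using V_dilation[of "K * (a + a)"] by blast
  show ?thesis
  proof (intro exI[of _ D] conjI ballI allI impI D(1))
    fix x y r assume *: "x \<in> space M" "y \<in> space M" "0 < r" "\<rho> x y \<le> a * r"
    have "B x (a * r) \<subseteq> B y (K * (a * r + a * r))"
      by (rule ball_subset) (use * rho_sym in auto)
    then have "V x (a * r) \<le> V y (K * (a * r + a * r))" by (rule V_mono_ball[rotated 2]) (use * in auto)
    also have "\<dots> = V y (K * (a + a) * r)" by (simp add: algebra_simps)
    also have "\<dots> \<le> D * V y r" using D * by blast
    finally show "V x (a * r) \<le> D * V y r" .
  qed
qed

text \<open>
  By doubling, the balls around the points of a separated set have measures bounded below, so that a
  separated subset of a ball has boundedly many points, and a maximal one is a net.
\<close>
lemma ball_totally_bounded: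
  assumes x0: "x0 \<in> space M" and r: "0 < r"
  shows "\<exists>F. finite F \<and> F \<subseteq> space M \<and> B x0 R \<subseteq> (\<Union>x\<in>F. B x r)"
proof (cases "R > 0")
  case False
  then show ?thesis using ball_empty[OF x0, of R] by (intro exI[of _ "{}"]) auto
next
  case R: True
  \<comment> \<open>Balls of radius \<open>e\<close> about points at distance at least \<open>r\<close> are disjoint.\<close>
  define e where "e = r / (2 * K)"
  have e: "e > 0" using r K1 unfolding e_def by simp
  have Ke: "K * (e + e) = r" using K1 unfolding e_def by (simp add: field_simps)
  define b where "b = K * (R + e)"
  obtain D where D: "1 \<le> D" "\<forall>x\<in>space M. \<forall>y\<in>space M. \<forall>r>0. \<rho> x y \<le> R/e * r \<longrightarrow> V x (R/e * r) \<le> D * V y r"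
    using V_compare[of "R/e"] by blast
  define d where "d = V x0 R / D"
  have d: "d > 0" unfolding d_def using V_pos[OF x0 R] D(1) by simp
  have dV: "d \<le> V x e" if "x \<in> B x0 R" for x
  proof -
    have "V x0 (R / e * e) \<le> D * V x e"
      by (rule D(2)[rule_format]) (use that x0 e in \<open>auto simp: mem_ball\<close>)
    then have "V x0 R \<le> D * V x e" using e by simp
    then show ?thesis unfolding d_def using D(1) by (simp add: divide_le_eq mult.commute)
  qed
  define sep where "sep F \<longleftrightarrow> finite F \<and> F \<subseteq> B x0 R \<and> (\<forall>x\<in>F. \<forall>y\<in>F. x \<noteq> y \<longrightarrow> r \<le> \<rho> x y)" for F
  have bound: "card F \<le> nat \<lceil>V x0 b / d\<rceil>" if "sep F" for F
  proof -
    have F: "finite F" "F \<subseteq> B x0 R" "\<And>x y. x \<in> F \<Longrightarrow> y \<in> F \<Longrightarrow> x \<noteq> y \<Longrightarrow> r \<le> \<rho> x y"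
      using that unfolding sep_def by auto
    have FM: "x \<in> space M" if "x \<in> F" for x using that F by (auto simp: mem_ball)
    have disj: "disjoint_family_on (\<lambda>x. B x e) F"
    proof (unfold disjoint_family_on_def, intro ballI impI equals0I)
      fix x y z assume xy: "x \<in> F" "y \<in> F" "x \<noteq> y" and z: "z \<in> B x e \<inter> B y e"
      then have "\<rho> x y \<le> K * (\<rho> x z + \<rho> z y)" using FM by (intro rho_triangle) (auto simp: mem_ball)
      also have "\<dots> < K * (e + e)" using z K1 xy FM rho_sym[of z y]
        by (intro mult_strict_left_mono add_strict_mono) (auto simp: mem_ball)
      finally show False using F(3)[OF xy] Ke by simp
    qed
    have "ennreal (real (card F) * d) = (\<Sum>x\<in>F. ennreal d)"
      using d by (subst sum_ennreal) auto
    also have "\<dots> \<le> (\<Sum>x\<in>F. emeasure M (B x e))"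
      using F dV FM by (intro sum_mono) (auto simp: emeasure_ball intro!: ennreal_leI)
    also have "\<dots> = emeasure M (\<Union>x\<in>F. B x e)"
      by (rule sum_emeasure[OF _ disj F(1)]) (use FM in auto)
    also have "\<dots> \<le> emeasure M (B x0 b)"
    proof (rule emeasure_mono)
      show "(\<Union>x\<in>F. B x e) \<subseteq> B x0 b" unfolding b_def
        using F(2) FM by (intro UN_least ball_subset) (auto simp: mem_ball x0)
    qed (use x0 in auto)
    finally have "real (card F) * d \<le> V x0 b"
      by (subst (asm) emeasure_ball[OF x0], subst (asm) ennreal_le_iff) (rule V_nonneg)
    then have "real (card F) \<le> V x0 b / d" using d by (simp add: field_simps)
    then show ?thesis by linarith
  qed
  have "sep {}" unfolding sep_def by simp
  have "\<forall>G. sep G \<longrightarrow> card G < Suc (nat \<lceil>V x0 b / d\<rceil>)"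
    by (intro allI impI le_imp_less_Suc bound)
  from ex_has_greatest_nat[of sep "{}" card, OF \<open>sep {}\<close> this]
  obtain F where F: "sep F" and max: "\<forall>G. sep G \<longrightarrow> card G \<le> card F" by (elim exE conjE)
  have "B x0 R \<subseteq> (\<Union>x\<in>F. B x r)"
  proof
    fix y assume y: "y \<in> B x0 R"
    show "y \<in> (\<Union>x\<in>F. B x r)"
    proof (rule ccontr)
      assume *: "y \<notin> (\<Union>x\<in>F. B x r)"
      have FM: "x \<in> space M" if "x \<in> F" for x using that F by (auto simp: mem_ball sep_def)
      have far: "r \<le> \<rho> x y" if "x \<in> F" for x
      proof -
        have "y \<notin> B x r" using * that by blast
        then show ?thesis using y by (auto simp: mem_ball not_less)
      qed
      have yM: "y \<in> space M" using y by (simp add: mem_ball)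
      have "y \<notin> F" using far[of y] r rho_eq_0_iff[OF yM yM] by auto
      moreover have sepy: "sep (insert y F)"
        unfolding sep_def
      proof (intro conjI ballI impI)
        fix x x' assume xx: "x \<in> insert y F" "x' \<in> insert y F" "x \<noteq> x'"
        then consider "x = y" "x' \<in> F" | "x' = y" "x \<in> F" | "x \<in> F" "x' \<in> F" by blast
        then show "r \<le> \<rho> x x'"
          by cases (use far rho_sym[OF yM FM] F xx in \<open>auto simp: sep_def\<close>)
      qed (use F y in \<open>auto simp: sep_def\<close>)
      ultimately have "card F < card (insert y F)" using F by (simp add: sep_def)
      then show False using max sepy by (meson not_less)
    qed
  qed
  moreover have "finite F" "F \<subseteq> space M" using F by (auto simp: sep_def mem_ball)
  ultimately show ?thesis by (intro exI[of _ F] conjI)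
qed

lemma space_eq_Union_balls: "x0 \<in> space M \<Longrightarrow> space M = (\<Union>n. B x0 (real (Suc n)))"
proof (intro equalityI subsetI)
  fix y assume x0: "x0 \<in> space M" and y: "y \<in> space M"
  obtain n where "\<rho> x0 y < real n" using reals_Archimedean2 by blast
  then have "y \<in> B x0 (real (Suc n))" using y by (simp add: mem_ball)
  then show "y \<in> (\<Union>n. B x0 (real (Suc n)))" by blast
qed (auto simp: mem_ball)

lemma countable_ball_cover:
  assumes r: "0 < r"
  shows "\<exists>z::nat \<Rightarrow> 'a. (\<forall>i. z i \<in> space M) \<and> space M = (\<Union>i. B (z i) r)"
proof -
  obtain x0 where x0: "x0 \<in> space M" using space_nonempty by auto
  have "\<exists>F. finite F \<and> F \<subseteq> space M \<and> B x0 (real (Suc n)) \<subseteq> (\<Union>x\<in>F. B x r)" for n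
    by (rule ball_totally_bounded[OF x0 r])
  then obtain F where F: "\<And>n. finite (F n)" "\<And>n. F n \<subseteq> space M" "\<And>n. B x0 (real (Suc n)) \<subseteq> (\<Union>x\<in>F n. B x r)"
    by metis
  define G where "G = insert x0 (\<Union>n. F n)"
  have G: "countable G" "G \<noteq> {}" "G \<subseteq> space M"
    using F x0 unfolding G_def by (auto intro: countable_finite)
  have "space M \<subseteq> (\<Union>x\<in>G. B x r)"
    unfolding space_eq_Union_balls[OF x0] using F(3) unfolding G_def by blast
  also have "(\<Union>x\<in>G. B x r) = (\<Union>x\<in>range (from_nat_into G). B x r)"
    using range_from_nat_into[OF G(2,1)] by simp
  also have "\<dots> = (\<Union>i. B (from_nat_into G i) r)" by auto
  finally have "space M = (\<Union>i. B (from_nat_into G i) r)" by (auto simp: mem_ball)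
  moreover have "from_nat_into G i \<in> space M" for i using from_nat_into[OF G(2)] G(3) by blast
  ultimately show ?thesis by (intro exI[of _ "from_nat_into G"]) simp
qed

section \<open>Averages over balls of a fixed radius\<close>

text \<open>
  Both an upper bound for the averages of \<open>H\<close> over balls of radius \<open>r\<close> and a
  bound for its integrals against nonnegative functions \<open>u\<close>: the function \<open>S\<close>
  is what the adjoint of \<open>H \<mapsto> T\<close> makes of \<open>u\<close>.
\<close>
definition step_majorant :: "real \<Rightarrow> real \<Rightarrow> ('a \<Rightarrow> ennreal) \<Rightarrow> ('a \<Rightarrow> ennreal) \<Rightarrow> bool" where
  "step_majorant D r H T \<longleftrightarrow> T \<in> borel_measurable M \<and>
         (\<forall>x\<in>space M. avg x r H \<le> ennreal D * T x) \<and>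
         (\<forall>u::'a \<Rightarrow> real. u \<in> borel_measurable M \<longrightarrow> (\<forall>x. 0 \<le> u x) \<longrightarrow>
           (\<exists>S\<in>borel_measurable M.
             (\<forall>y\<in>space M. S y \<le> ennreal D * maximal_fun M \<rho> (\<lambda>x. complex_of_real (u x)) y) \<and>
             (\<integral>\<^sup>+x. T x * ennreal (u x) \<partial>M) = (\<integral>\<^sup>+x. H x * S x \<partial>M)))"

text \<open>
  Averaging over \<open>B(x,r)\<close> need not produce a measurable function of \<open>x\<close>. By
  doubling, the average is at most a constant times an average over an enlarged ball about any point at
  distance less than \<open>r\<close> from \<open>x\<close>. Hence it is bounded by a step function
  \<open>T\<close> that is constant on the pieces \<open>Q\<^sub>i\<close> of a partition subordinate to
  a net of mesh \<open>r\<close>. The adjoint \<open>S\<close> of this step operator is an explicit sum.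
  At a point \<open>y\<close> the sum involves pieces near \<open>y\<close> only, and these are
  disjoint, so that it is a multiple of a single average about \<open>y\<close>.
\<close>
lemma average_step_majorant:
  obtains D :: real where "1 \<le> D"
    "\<And>r H. 0 < r \<Longrightarrow> H \<in> borel_measurable M \<Longrightarrow>
       \<exists>T. step_majorant D r H T"
proof -
  \<comment> \<open>With this \<open>a\<close> the ball \<open>B(y,ar)\<close> contains every piece whose enlarged ball contains \<open>y\<close>.\<close>
  define a where "a = K * (2 * K + 1)"
  have a: "a > 0" "1 \<le> a" "2 * K \<le> a" unfolding a_def using K1 mult_mono[of 1 K 1 "2*K+1"] mult_mono[of 1 K "2*K" "2*K+1"] by auto
  obtain D where D: "1 \<le> D"
    "\<forall>x\<in>space M. \<forall>y\<in>space M. \<forall>r>0. \<rho> x y \<le> a * r \<longrightarrow> V x (a * r) \<le> D * V y r"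
    using V_compare[of a] by blast
  show ?thesis
  proof (rule that[OF D(1)])
    fix r :: real and H :: "'a \<Rightarrow> ennreal"
    assume r: "0 < r" and H [measurable]: "H \<in> borel_measurable M"
    obtain z :: "nat \<Rightarrow> 'a" where z: "\<And>i. z i \<in> space M" and cover: "space M = (\<Union>i. B (z i) r)"
      using countable_ball_cover[OF r] by blast
    define Q where "Q = disjointed (\<lambda>i. B (z i) r)"
    have Q_sets [measurable]: "Q i \<in> sets M" for i
    proof -
      have "range (\<lambda>i. B (z i) r) \<subseteq> sets M" using z by (auto intro: ball_sets)
      then show ?thesis unfolding Q_def using sets.range_disjointed_sets by blast
    qed
    have Q_sub: "Q i \<subseteq> B (z i) r" for i unfolding Q_def by (rule disjointed_subset)
    have Q_disj: "disjoint_family Q" unfolding Q_def by (rule disjoint_family_disjointed)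
    have Q_cover: "(\<Union>i. Q i) = space M" unfolding Q_def cover by (rule UN_disjointed_eq)
    define E where "E i = B (z i) (2 * K * r)" for i
    have E_sets [measurable]: "E i \<in> sets M" for i unfolding E_def using z by simp
    define v where "v i = V (z i) r" for i
    have v: "v i > 0" for i unfolding v_def using V_pos z r by blast
    define T where "T x = (\<Sum>i. indicator (Q i) x * (ennreal (1 / v i) * (\<integral>\<^sup>+y\<in>E i. H y \<partial>M)))" for x
    have T_meas [measurable]: "T \<in> borel_measurable M" unfolding T_def by measurable
    have avg: "avg x r H \<le> ennreal D * T x" if x: "x \<in> space M" for x
    proof -
      obtain i where i: "x \<in> Q i" using x Q_cover by auto
      then have "x \<in> B (z i) r" using Q_sub[of i] by blast
      then have zx: "\<rho> (z i) x < r" by (simp add: mem_ball)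
      have "B x r \<subseteq> B (z i) (K * (r + r))" by (rule ball_subset) (use x z zx in auto)
      then have "B x r \<subseteq> E i" unfolding E_def by (simp add: algebra_simps)
      then have I: "(\<integral>\<^sup>+y\<in>B x r. H y \<partial>M) \<le> (\<integral>\<^sup>+y\<in>E i. H y \<partial>M)"
        by (intro nn_integral_mono mult_left_mono) (auto simp: indicator_def)
      have ar: "r \<le> a * r" using a r by simp
      have "V (z i) r \<le> V (z i) (a * r)" by (rule V_mono[OF z ar])
      also have "\<dots> \<le> D * V x r" by (rule D(2)[rule_format, OF z x r order_trans[OF less_imp_le[OF zx] ar]])
      finally have "1 / V x r \<le> D * (1 / v i)"
        using v[of i] V_pos[OF x r] unfolding v_def by (simp add: field_simps)
      then have "ennreal (1 / V x r) * (\<integral>\<^sup>+y\<in>B x r. H y \<partial>M) \<le> ennreal (D * (1 / v i)) * (\<integral>\<^sup>+y\<in>E i. H y \<partial>M)"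
        by (intro mult_mono ennreal_leI I) auto
      also have "\<dots> = ennreal D * (indicator (Q i) x * (ennreal (1 / v i) * (\<integral>\<^sup>+y\<in>E i. H y \<partial>M)))"
        using i D(1) v[of i] by (subst ennreal_mult) (auto simp: mult.assoc less_imp_le)
      also have "\<dots> \<le> ennreal D * T x"
        unfolding T_def
      proof (rule mult_left_mono)
        show "indicator (Q i) x * (ennreal (1 / v i) * (\<integral>\<^sup>+y\<in>E i. H y \<partial>M))
            \<le> (\<Sum>i. indicator (Q i) x * (ennreal (1 / v i) * (\<integral>\<^sup>+y\<in>E i. H y \<partial>M)))"
          using sum_le_suminf[OF summableI, of "{i}" "\<lambda>i. indicator (Q i) x * (ennreal (1 / v i) * (\<integral>\<^sup>+y\<in>E i. H y \<partial>M))"]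
          by (simp only: sum.insert sum.empty finite.intros not_False_eq_True empty_iff add_0_right zero_le)
      qed simp
      finally show ?thesis
        using V_pos[OF x r] by (simp add: emeasure_ball[OF x] divide_ennreal_pos)
    qed
    have dual: "\<exists>S\<in>borel_measurable M.
             (\<forall>y\<in>space M. S y \<le> ennreal D * maximal_fun M \<rho> (\<lambda>x. complex_of_real (u x)) y) \<and>
             (\<integral>\<^sup>+x. T x * ennreal (u x) \<partial>M) = (\<integral>\<^sup>+x. H x * S x \<partial>M)"
      if u [measurable]: "u \<in> borel_measurable M" and u0: "\<And>x. 0 \<le> u x" for u :: "'a \<Rightarrow> real"
    proof -
      define S where "S y = (\<Sum>i. indicator (E i) y * (ennreal (1 / v i) * (\<integral>\<^sup>+x\<in>Q i. ennreal (u x) \<partial>M)))" for y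
      have S_meas [measurable]: "S \<in> borel_measurable M" unfolding S_def by measurable
      have S_le: "S y \<le> ennreal D * maximal_fun M \<rho> (\<lambda>x. complex_of_real (u x)) y" if y: "y \<in> space M" for y
      proof -
        define R where "R = a * r"
        have R: "R > 0" unfolding R_def using a r by simp
        define c where "c = ennreal (D / V y R)"
        have summand: "indicator (E i) y * (ennreal (1 / v i) * (\<integral>\<^sup>+x\<in>Q i. ennreal (u x) \<partial>M))
            \<le> c * (\<integral>\<^sup>+x. ennreal (u x) * indicator (B y R) x * indicator (Q i) x \<partial>M)" for i
        proof (cases "y \<in> E i")
          case True
          then have yz: "\<rho> y (z i) \<le> 2 * K * r" using rho_sym[OF z y, of i] by (simp add: E_def mem_ball)
          have 2: "2 * K * r \<le> a * r" using a(3) r by (intro mult_right_mono) auto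
          have "V y R \<le> D * v i" unfolding v_def R_def by (rule D(2)[rule_format, OF y z r order_trans[OF yz 2]])
          then have "1 / v i \<le> D / V y R"
            using v[of i] V_pos[OF y R] by (simp add: field_simps)
          then have 1: "ennreal (1 / v i) \<le> c" unfolding c_def by (rule ennreal_leI)
          have "B (z i) r \<subseteq> B y (K * (2 * K * r + r))" by (rule ball_subset) (use z y yz in auto)
          then have "Q i \<subseteq> B y R" using Q_sub[of i] unfolding R_def a_def by (auto simp: algebra_simps)
          then have "(\<integral>\<^sup>+x\<in>Q i. ennreal (u x) \<partial>M) \<le> (\<integral>\<^sup>+x. ennreal (u x) * indicator (B y R) x * indicator (Q i) x \<partial>M)"
            by (intro nn_integral_mono) (auto simp: indicator_def)
          with 1 show ?thesis using True by (simp add: mult_mono)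
        qed simp
        have "S y \<le> (\<Sum>i. c * (\<integral>\<^sup>+x. ennreal (u x) * indicator (B y R) x * indicator (Q i) x \<partial>M))"
          unfolding S_def by (intro suminf_le summand) auto
        also have "\<dots> = c * (\<Sum>i. (\<integral>\<^sup>+x. ennreal (u x) * indicator (B y R) x * indicator (Q i) x \<partial>M))"
          by simp
        also have "(\<Sum>i. (\<integral>\<^sup>+x. ennreal (u x) * indicator (B y R) x * indicator (Q i) x \<partial>M))
            = (\<integral>\<^sup>+x\<in>(\<Union>i. Q i). ennreal (u x) * indicator (B y R) x \<partial>M)"
          using y Q_disj by (intro nn_integral_disjoint_family[symmetric]) auto
        also have "\<dots> = (\<integral>\<^sup>+x\<in>B y R. ennreal (u x) \<partial>M)"
          unfolding Q_cover by (intro nn_integral_cong) auto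
        also have "c * \<dots> = ennreal D * ((\<integral>\<^sup>+x\<in>B y R. ennreal (cmod (complex_of_real (u x))) \<partial>M) / emeasure M (B y R))"
          using V_pos[OF y R] D(1) u0 unfolding c_def emeasure_ball[OF y]
          by (simp add: divide_ennreal_pos mult.assoc[symmetric] ennreal_mult[symmetric])
        also have "\<dots> \<le> ennreal D * maximal_fun M \<rho> (\<lambda>x. complex_of_real (u x)) y"
          unfolding maximal_fun_def
        proof (intro mult_left_mono SUP_upper)
          show "B y R \<in> {qball M \<rho> z r |z r. z \<in> space M \<and> 0 < r \<and> y \<in> qball M \<rho> z r}"
            unfolding mem_Collect_eq using y R rho_eq_0_iff[of y y]
            by (intro exI[of _ y] exI[of _ R]) (auto simp: mem_ball)
        qed simp
        finally show ?thesis .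
      qed
      have "(\<integral>\<^sup>+x. T x * ennreal (u x) \<partial>M) = (\<integral>\<^sup>+x. H x * S x \<partial>M)"
      proof -
        have "(\<integral>\<^sup>+x. T x * ennreal (u x) \<partial>M) = (\<integral>\<^sup>+x. (\<Sum>i. (ennreal (1 / v i) * (\<integral>\<^sup>+y\<in>E i. H y \<partial>M)) * (ennreal (u x) * indicator (Q i) x)) \<partial>M)"
          unfolding T_def by (subst ennreal_suminf_multc[symmetric]) (simp add: mult_ac)
        also have "\<dots> = (\<Sum>i. (ennreal (1 / v i) * (\<integral>\<^sup>+y\<in>E i. H y \<partial>M)) * (\<integral>\<^sup>+x\<in>Q i. ennreal (u x) \<partial>M))"
          by (subst nn_integral_suminf) (auto simp: nn_integral_cmult)
        also have "\<dots> = (\<Sum>i. (ennreal (1 / v i) * (\<integral>\<^sup>+x\<in>Q i. ennreal (u x) \<partial>M)) * (\<integral>\<^sup>+y\<in>E i. H y \<partial>M))"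
          by (simp add: mult_ac)
        also have "\<dots> = (\<integral>\<^sup>+x. (\<Sum>i. (ennreal (1 / v i) * (\<integral>\<^sup>+y\<in>Q i. ennreal (u y) \<partial>M)) * (H x * indicator (E i) x)) \<partial>M)"
          by (subst nn_integral_suminf) (auto simp: nn_integral_cmult)
        also have "\<dots> = (\<integral>\<^sup>+x. H x * S x \<partial>M)"
          unfolding S_def by (subst ennreal_suminf_cmult[symmetric]) (simp add: mult_ac)
        finally show ?thesis .
      qed
      then show ?thesis using S_meas S_le by (intro bexI[of _ S] conjI ballI) auto
    qed
    show "\<exists>T. step_majorant D r H T"
      unfolding step_majorant_def
      using T_meas avg dual by (intro exI[of _ T] conjI ballI allI impI) auto
  qed
qed

end

section \<open>Lattice quasi-norms\<close>

lemma quasi_norm_homog: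
  assumes "ball_quasi_banach M \<rho> N" and "f \<in> borel_measurable M"
  shows "N (\<lambda>x. c * f x) = ennreal (cmod c) * N f"
  using assms unfolding ball_quasi_banach_def quasi_norm_on_def by blast

lemma quasi_norm_mono:
  assumes "ball_quasi_banach M \<rho> N" and "f \<in> borel_measurable M" and "g \<in> borel_measurable M"
    and "AE x in M. cmod (g x) \<le> cmod (f x)"
  shows "N g \<le> N f"
  using assms unfolding ball_quasi_banach_def by blast

lemma quasi_norm_cong_cmod:
  assumes "ball_quasi_banach M \<rho> N" and "f \<in> borel_measurable M" and "g \<in> borel_measurable M"
    and "AE x in M. cmod (g x) = cmod (f x)"
  shows "N g = N f"
proof (rule antisym)
  show "N g \<le> N f" by (rule quasi_norm_mono[OF assms(1-3)]) (use assms(4) in auto)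
  show "N f \<le> N g" by (rule quasi_norm_mono[OF assms(1,3,2)]) (use assms(4) in auto)
qed

lemma quasi_norm_triangle:
  assumes "ball_quasi_banach M \<rho> N"
  obtains K :: real where "K \<ge> 1"
    "\<And>f g. f \<in> borel_measurable M \<Longrightarrow> g \<in> borel_measurable M \<Longrightarrow>
       N (\<lambda>x. f x + g x) \<le> ennreal K * (N f + N g)"
proof -
  have "quasi_norm_on M N" using assms unfolding ball_quasi_banach_def by blast
  then show thesis using that unfolding quasi_norm_on_def by blast
qed

lemma quasi_norm_monotone_limit:
  fixes u :: "nat \<Rightarrow> 'a \<Rightarrow> real"
  assumes "ball_quasi_banach M \<rho> N" and "\<And>m. u m \<in> borel_measurable M" and "v \<in> borel_measurable M"
    and "AE x in M. (\<forall>m. 0 \<le> u m x) \<and> incseq (\<lambda>m. u m x) \<and> (\<lambda>m. u m x) \<longlonglongrightarrow> v x"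
  shows "(\<lambda>m. N (\<lambda>x. complex_of_real (u m x))) \<longlonglongrightarrow> N (\<lambda>x. complex_of_real (v x))"
  using assms unfolding ball_quasi_banach_def by blast

lemma quasi_norm_zero_iff:
  assumes "ball_quasi_banach M \<rho> N" and "f \<in> borel_measurable M"
  shows "N f = 0 \<longleftrightarrow> (AE x in M. f x = 0)"
proof
  show "N f = 0 \<Longrightarrow> AE x in M. f x = 0"
    using assms unfolding ball_quasi_banach_def by blast
  assume *: "AE x in M. f x = 0"
  have "N f \<le> N (\<lambda>x. 0 * f x)"
    by (rule quasi_norm_mono[OF assms(1) _ assms(2)]) (use * assms(2) in auto)
  also have "\<dots> = 0" using quasi_norm_homog[OF assms, of 0] by simp
  finally show "N f = 0" by simp
qed

section \<open>The Lorentz--Luxemburg theorem\<close>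

locale ball_banach_lattice =
  fixes M :: "'a measure" and \<rho> :: "'a \<Rightarrow> 'a \<Rightarrow> real" and Z :: "'a fun_norm"
  assumes ball_banach: "ball_banach M \<rho> Z"
begin

lemma quasi_banach: "ball_quasi_banach M \<rho> Z"
  using ball_banach unfolding ball_banach_def by blast

abbreviation RZ :: "('a \<Rightarrow> real) \<Rightarrow> ennreal" where
  "RZ u \<equiv> Z (\<lambda>x. complex_of_real (u x))"

lemma RZ_mono:
  assumes "u \<in> borel_measurable M" "v \<in> borel_measurable M" "AE x in M. \<bar>u x\<bar> \<le> \<bar>v x\<bar>"
  shows "RZ u \<le> RZ v"
  by (rule quasi_norm_mono[OF quasi_banach]) (use assms in auto)

lemma RZ_cmod:
  assumes "g \<in> borel_measurable M" shows "RZ (\<lambda>x. cmod (g x)) = Z g"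
  by (rule quasi_norm_cong_cmod[OF quasi_banach]) (use assms in auto)

lemma RZ_scale:
  assumes "u \<in> borel_measurable M" shows "RZ (\<lambda>x. c * u x) = ennreal \<bar>c\<bar> * RZ u"
  using quasi_norm_homog[OF quasi_banach, of "\<lambda>x. complex_of_real (u x)" "complex_of_real c"] assms by simp

lemma RZ_add:
  assumes "u \<in> borel_measurable M" "v \<in> borel_measurable M"
  shows "RZ (\<lambda>x. u x + v x) \<le> RZ u + RZ v"
  using ball_banach assms unfolding ball_banach_def by simp

lemma RZ_convex:
  assumes [measurable]: "u \<in> borel_measurable M" "v \<in> borel_measurable M"
    and "RZ u \<le> 1" "RZ v \<le> 1" and t: "0 \<le> t" "t \<le> 1"
  shows "RZ (\<lambda>x. (1 - t) * u x + t * v x) \<le> 1"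
proof -
  have "RZ (\<lambda>x. (1 - t) * u x + t * v x) \<le> RZ (\<lambda>x. (1 - t) * u x) + RZ (\<lambda>x. t * v x)"
    using RZ_add[of "\<lambda>x. (1 - t) * u x" "\<lambda>x. t * v x"] by simp
  also have "\<dots> = ennreal (1 - t) * RZ u + ennreal t * RZ v"
    using t RZ_scale[of u "1-t"] RZ_scale[of v t] by simp
  also have "\<dots> \<le> ennreal (1 - t) * 1 + ennreal t * 1"
    by (intro add_mono mult_left_mono assms) auto
  also have "\<dots> = 1" using t by (simp flip: ennreal_plus)
  finally show ?thesis .
qed

text \<open>
  The monotone convergence axiom is applied to the functions \<open>inf\<^sub>m\<^sub>\<ge>\<^sub>n
  u\<^sub>m\<close>.
\<close>
lemma RZ_Fatou:
  fixes u :: "nat \<Rightarrow> 'a \<Rightarrow> real"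
  assumes [measurable]: "\<And>n. u n \<in> borel_measurable M" "v \<in> borel_measurable M"
    and nonneg: "\<And>n x. 0 \<le> u n x"
    and lim: "AE x in M. (\<lambda>n. u n x) \<longlonglongrightarrow> v x"
    and bound: "\<And>n. RZ (u n) \<le> c"
  shows "RZ v \<le> c"
proof -
  define w where "w n x = (INF m\<in>{n..}. u m x)" for n x
  have bdd: "bdd_below ((\<lambda>m. u m x) ` {n..})" for n x
    by (rule bdd_belowI[of _ 0]) (use nonneg in auto)
  have w_meas [measurable]: "w n \<in> borel_measurable M" for n
    unfolding w_def by measurable
  have w_le: "w n x \<le> u n x" for n x
    unfolding w_def by (rule cINF_lower[OF bdd]) auto
  have w0: "0 \<le> w n x" for n x
    unfolding w_def by (rule cINF_greatest) (use nonneg in auto)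
  have w_inc: "incseq (\<lambda>n. w n x)" for x
    unfolding incseq_def w_def by (intro allI impI cINF_superset_mono bdd) auto
  have w_lim: "(\<lambda>n. w n x) \<longlonglongrightarrow> v x" if l: "(\<lambda>n. u n x) \<longlonglongrightarrow> v x" for x
  proof (rule LIMSEQ_I)
    fix e :: real assume "e > 0"
    then obtain n0 where n0: "\<And>n. n \<ge> n0 \<Longrightarrow> norm (u n x - v x) < e / 2"
      using LIMSEQ_D[OF l, of "e/2"] by auto
    have "norm (w n x - v x) < e" if "n \<ge> n0" for n
    proof -
      have "v x - e / 2 \<le> w n x" unfolding w_def
      proof (rule cINF_greatest)
        fix m assume "m \<in> {n..}"
        then have "\<bar>u m x - v x\<bar> < e / 2" using n0[of m] that by simp
        then show "v x - e / 2 \<le> u m x" by linarith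
      qed simp
      moreover have "w n x \<le> u n x" by (rule w_le)
      moreover have "\<bar>u n x - v x\<bar> < e / 2" using n0[OF that] by simp
      ultimately show ?thesis using \<open>e > 0\<close> unfolding real_norm_def by linarith
    qed
    then show "\<exists>no. \<forall>n\<ge>no. norm (w n x - v x) < e" by blast
  qed
  have "(\<lambda>m. RZ (w m)) \<longlonglongrightarrow> RZ v"
    by (rule quasi_norm_monotone_limit[OF quasi_banach]) (use lim w_lim w0 w_inc in auto)
  moreover have "RZ (w m) \<le> c" for m
  proof -
    have "RZ (w m) \<le> RZ (u m)"
      by (rule RZ_mono) (use w_le w0 nonneg in auto)
    then show ?thesis using bound order_trans by blast
  qed
  ultimately show ?thesis by (intro LIMSEQ_le_const2) auto
qed

text \<open>
  The unit ball of \<open>Z\<close> is convex, and by the Fatou property it is closed under limits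
  almost everywhere. Hence a minimizing sequence for the \<open>L\<^sup>2\<close> distance, which is
  Cauchy in \<open>L\<^sup>2\<close>, has a subsequence converging to a minimizer. Restricting the
  competitors to \<open>[0,f]\<close>, where \<open>f\<close> is bounded with support of finite measure,
  makes all integrals finite.
\<close>
lemma unit_ball_nearest_point:
  fixes f :: "'a \<Rightarrow> real"
  assumes f_meas [measurable]: "f \<in> borel_measurable M" and A [measurable]: "A \<in> sets M" and A_fin: "emeasure M A < top"
    and f0: "\<And>x. 0 \<le> f x" and f_le: "\<And>x. f x \<le> c" and f_supp: "\<And>x. x \<notin> A \<Longrightarrow> f x = 0"
  obtains g where "g \<in> borel_measurable M" "\<And>x. 0 \<le> g x" "\<And>x. g x \<le> f x" "RZ g \<le> 1"
    "\<And>h. h \<in> borel_measurable M \<Longrightarrow> (\<And>x. 0 \<le> h x) \<Longrightarrow> (\<And>x. h x \<le> f x) \<Longrightarrow> RZ h \<le> 1 \<Longrightarrow>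
       (\<integral>x. (f x - g x)\<^sup>2 \<partial>M) \<le> (\<integral>x. (f x - h x)\<^sup>2 \<partial>M)"
proof -
  define S where "S = {h. h \<in> borel_measurable M \<and> (\<forall>x. 0 \<le> h x \<and> h x \<le> f x) \<and> RZ h \<le> 1}"
  define J where "J h = (\<integral>x. (f x - h x)\<^sup>2 \<partial>M)" for h
  have c0: "0 \<le> c" using f0 f_le order_trans by blast
  have int_A: "integrable M k" if "k \<in> borel_measurable M" "\<And>x. \<bar>k x\<bar> \<le> b * indicator A x" for k :: "'a \<Rightarrow> real" and b
    by (rule Bochner_Integration.integrable_bound[of M "\<lambda>x. b * indicator A x"])
       (use that A_fin in \<open>auto simp: intro!: order_trans[OF that(2)] integrable_real_indicator\<close>)
  have f_ind: "f x \<le> c * indicator A x" for x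
    using f_le[of x] f_supp[of x] by (auto simp: indicator_def)
  have sq_bound: "t\<^sup>2 \<le> c\<^sup>2 * indicator A x" if "\<bar>t\<bar> \<le> f x" for t x
  proof (cases "x \<in> A")
    case True
    have "\<bar>t\<bar> \<le> \<bar>c\<bar>" using that f_le[of x] c0 by linarith
    then show ?thesis using True by (simp add: abs_le_square_iff)
  next
    case False
    then show ?thesis using that f_supp[of x] by simp
  qed
  have int_sq: "integrable M (\<lambda>x. (h x - k x)\<^sup>2)"
    if [measurable]: "h \<in> borel_measurable M" "k \<in> borel_measurable M" and "\<And>x. 0 \<le> h x" "\<And>x. h x \<le> f x" "\<And>x. 0 \<le> k x" "\<And>x. k x \<le> f x" for h k
  proof (rule int_A)
    fix x have "(h x - k x)\<^sup>2 \<le> c\<^sup>2 * indicator A x" by (rule sq_bound) (use that(3-6)[of x] in linarith)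
    then show "\<bar>(h x - k x)\<^sup>2\<bar> \<le> c\<^sup>2 * indicator A x" by simp
  qed measurable
  have zeroS: "(\<lambda>x. 0) \<in> S" unfolding S_def
    using f0 quasi_norm_zero_iff[OF quasi_banach, of "\<lambda>x. 0"] by simp
  define d where "d = Inf (J ` S)"
  have J0: "0 \<le> J h" for h unfolding J_def by (rule Bochner_Integration.integral_nonneg) auto
  have bddJ: "bdd_below (J ` S)" by (rule bdd_belowI[of _ 0]) (use J0 in auto)
  have d_le: "d \<le> J h" if "h \<in> S" for h unfolding d_def by (rule cInf_lower[OF _ bddJ]) (use that in auto)
  have "\<exists>h\<in>S. J h < d + 1 / Suc n" for n
  proof -
    have "Inf (J ` S) < d + 1 / Suc n" unfolding d_def by simp
    then show ?thesis using zeroS bddJ by (subst (asm) cInf_less_iff) auto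
  qed
  then obtain h where hS: "\<And>n. h n \<in> S" and hJ: "\<And>n. J (h n) < d + 1 / Suc n" by metis
  have h_meas [measurable]: "h n \<in> borel_measurable M" and h0: "0 \<le> h n x" and hf: "h n x \<le> f x" and hR: "RZ (h n) \<le> 1" for n x
    using hS[of n] unfolding S_def by auto
  \<comment> \<open>The parallelogram law makes a minimizing sequence Cauchy.\<close>
  have par: "(\<integral>x. (h n x - h m x)\<^sup>2 \<partial>M) \<le> 2 / Suc n + 2 / Suc m" for n m
  proof -
    define k where "k x = (1 - 1/2) * h n x + (1/2) * h m x" for x
    have k0: "0 \<le> k x" and kf: "k x \<le> f x" for x
      using h0[of n x] h0[of m x] hf[of n x] hf[of m x] unfolding k_def by (auto simp: field_simps)
    have k_meas [measurable]: "k \<in> borel_measurable M" unfolding k_def by measurable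
    have "RZ k \<le> 1" unfolding k_def using RZ_convex[of "h n" "h m" "1/2"] hR by simp
    then have "k \<in> S" unfolding S_def using k0 kf by auto
    have "(\<integral>x. (h n x - h m x)\<^sup>2 \<partial>M) = (\<integral>x. 2 * (f x - h n x)\<^sup>2 + 2 * (f x - h m x)\<^sup>2 - 4 * (f x - k x)\<^sup>2 \<partial>M)"
      unfolding k_def by (intro Bochner_Integration.integral_cong) (auto simp: power2_eq_square field_simps)
    also have "\<dots> = 2 * J (h n) + 2 * J (h m) - 4 * J k"
      unfolding J_def using int_sq[of f "h n"] int_sq[of f "h m"] int_sq[of f k] f0 h0 hf k0 kf
      by (simp)
    also have "\<dots> \<le> 2 / Suc n + 2 / Suc m"
    proof -
      have "2 * J (h n) + 2 * J (h m) - 4 * J k \<le> 2 * (1 / Suc n) + 2 * (1 / Suc m)"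
        using hJ[of n] hJ[of m] d_le[OF \<open>k \<in> S\<close>] by linarith
      then show ?thesis by simp
    qed
    finally show ?thesis .
  qed
  have int_h: "integrable M (h n)" for n
    by (rule int_A[of _ c]) (use h0 order_trans[OF hf f_ind] in auto)
  have int_hd: "integrable M (\<lambda>x. (h n x - h m x)\<^sup>2)" for n m
    by (rule int_sq) (use h0 hf in auto)
  have cauchy: "\<exists>n0. \<forall>i\<ge>n0. \<forall>j\<ge>n0. (\<integral>x. norm (h i x - h j x) \<partial>M) < e" if "e > 0" for e :: real
  proof -
    \<comment> \<open>On \<open>A\<close> the inequality \<open>|t| \<le> a + t\<^sup>2/a\<close> turns smallness in \<open>L\<^sup>2\<close> into smallness in \<open>L\<^sup>1\<close>.\<close>
    define a where "a = e / (2 * (measure M A + 1))"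
    have a: "a > 0" unfolding a_def using that by (simp add: add_nonneg_pos)
    have "a * measure M A \<le> a * (measure M A + 1)" using a by (intro mult_left_mono) auto
    also have "\<dots> = e / 2"
    proof -
      have "e / (2 * m) * m = e / 2" if "m \<noteq> 0" for m :: real using that by simp
      from this[of "measure M A + 1"] show ?thesis
        unfolding a_def using measure_nonneg[of M A] by linarith
    qed
    finally have aM: "a * measure M A \<le> e / 2" .
    obtain n0 where n0: "4 / (a * (e/2)) < real n0" using reals_Archimedean2 by blast
    have "(\<integral>x. norm (h i x - h j x) \<partial>M) < e" if ij: "i \<ge> n0" "j \<ge> n0" for i j
    proof -
      have "(\<integral>x. norm (h i x - h j x) \<partial>M) \<le> (\<integral>x. a * indicator A x + (1 / a) * (h i x - h j x)\<^sup>2 \<partial>M)"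
      proof (rule integral_mono)
        show "integrable M (\<lambda>x. norm (h i x - h j x))" using int_h by auto
        show "integrable M (\<lambda>x. a * indicator A x + 1 / a * (h i x - h j x)\<^sup>2)"
          using int_hd A_fin by (auto intro!: integrable_real_indicator)
        fix x
        show "norm (h i x - h j x) \<le> a * indicator A x + 1 / a * (h i x - h j x)\<^sup>2"
        proof (cases "x \<in> A")
          case True
          have "a * \<bar>h i x - h j x\<bar> \<le> a * a + (h i x - h j x)\<^sup>2"
          proof (cases "\<bar>h i x - h j x\<bar> \<le> a")
            case False
            then have "a * \<bar>h i x - h j x\<bar> \<le> \<bar>h i x - h j x\<bar> * \<bar>h i x - h j x\<bar>"
              using a by (intro mult_right_mono) auto
            also have "\<dots> = (h i x - h j x)\<^sup>2" by (simp add: power2_eq_square)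
            finally show ?thesis using a by (simp add: add_increasing)
          qed (use a in \<open>simp add: add_increasing2\<close>)
          then show ?thesis using a True by (simp add: field_simps)
        next
          case False
          then have "h i x = 0" "h j x = 0" using h0[of _ x] hf[of _ x] f_supp[of x] by (metis antisym)+
          then show ?thesis using False by simp
        qed
      qed
      also have "\<dots> = a * measure M A + (1 / a) * (\<integral>x. (h i x - h j x)\<^sup>2 \<partial>M)"
        using int_hd A_fin by (simp add: integrable_real_indicator)
      also have "\<dots> \<le> e / 2 + (1 / a) * (2 / Suc i + 2 / Suc j)"
        using aM par[of i j] a by (intro add_mono mult_left_mono) auto
      also have "\<dots> < e / 2 + (1 / a) * (a * (e / 2))"
      proof -
        have n0': "real n0 > 0" using n0 a that \<open>0 < e\<close> by (meson divide_pos_pos half_gt_zero_iff less_trans mult_pos_pos zero_less_numeral)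
        have "2 / real (Suc i) \<le> 2 / real n0" "2 / real (Suc j) \<le> 2 / real n0"
          using ij n0' by (auto intro!: divide_left_mono)
        then have "2 / Suc i + 2 / Suc j \<le> 4 / real n0" by simp
        also have "\<dots> < a * (e / 2)" using n0 n0' a \<open>0 < e\<close> by (simp add: field_simps)
        finally show ?thesis using a by (intro add_strict_left_mono mult_strict_left_mono) auto
      qed
      also have "\<dots> = e" using a by simp
      finally show ?thesis .
    qed
    then show ?thesis by blast
  qed
  obtain r where r: "strict_mono r" and rC: "AE x in M. Cauchy (\<lambda>i. h (r i) x)"
    using cauchy_L1_AE_cauchy_subseq[OF int_h cauchy] by blast
  define l where "l x = lim (\<lambda>i. h (r i) x)" for x
  \<comment> \<open>Clamping changes \<open>l\<close> only where the subsequence diverges.\<close>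
  define g where "g x = max 0 (min (f x) (l x))" for x
  have [measurable]: "l \<in> borel_measurable M" unfolding l_def by measurable
  have g_meas [measurable]: "g \<in> borel_measurable M" unfolding g_def by measurable
  have g0: "0 \<le> g x" and gf: "g x \<le> f x" for x using f0[of x] unfolding g_def by auto
  have lim: "AE x in M. (\<lambda>i. h (r i) x) \<longlonglongrightarrow> g x"
    using rC
  proof eventually_elim
    case (elim x)
    then have L: "(\<lambda>i. h (r i) x) \<longlonglongrightarrow> l x" unfolding l_def
      using Cauchy_convergent convergent_LIMSEQ_iff by blast
    have "0 \<le> l x" by (rule LIMSEQ_le_const[OF L]) (use h0 in auto)
    moreover have "l x \<le> f x" by (rule LIMSEQ_le_const2[OF L]) (use hf in auto)
    ultimately have "g x = l x" unfolding g_def by simp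
    then show ?case using L by simp
  qed
  have gR: "RZ g \<le> 1" by (rule RZ_Fatou[OF _ _ _ lim]) (use h0 hR in auto)
  have "(\<lambda>i. J (h (r i))) \<longlonglongrightarrow> J g" unfolding J_def
  proof (rule integral_dominated_convergence[where w = "\<lambda>x. c\<^sup>2 * indicator A x"])
    show "AE x in M. (\<lambda>i. (f x - h (r i) x)\<^sup>2) \<longlonglongrightarrow> (f x - g x)\<^sup>2"
      using lim by eventually_elim (intro tendsto_intros)
    show "AE x in M. norm ((f x - h (r i) x)\<^sup>2) \<le> c\<^sup>2 * indicator A x" for i
    proof (intro AE_I2)
      fix x
      have "(f x - h (r i) x)\<^sup>2 \<le> c\<^sup>2 * indicator A x"
        by (rule sq_bound) (use h0[of "r i" x] hf[of "r i" x] in linarith)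
      then show "norm ((f x - h (r i) x)\<^sup>2) \<le> c\<^sup>2 * indicator A x" by simp
    qed
  qed (use A_fin in \<open>auto intro!: integrable_real_indicator\<close>)
  moreover have "(\<lambda>i. d + 1 / Suc (r i)) \<longlonglongrightarrow> d + 0"
    using LIMSEQ_subseq_LIMSEQ[OF LIMSEQ_Suc[OF lim_const_over_n[of 1]] r]
    by (intro tendsto_add tendsto_const) (simp add: o_def)
  ultimately have "J g \<le> d + 0"
    by (rule LIMSEQ_le) (use hJ less_imp_le in blast)
  then have "J g \<le> J k" if "k \<in> S" for k using d_le[OF that] by simp
  then show ?thesis
    using that[of g] g_meas g0 gf gR unfolding J_def S_def by blast
qed

text \<open>
  A bounded function outside the unit ball is separated from it by a functional given by a function: the
  difference between the function and its nearest point in the unit ball.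
\<close>
lemma unit_ball_separation:
  fixes f :: "'a \<Rightarrow> real"
  assumes f_meas [measurable]: "f \<in> borel_measurable M" and A [measurable]: "A \<in> sets M" and A_fin: "emeasure M A < top"
    and f0: "\<And>x. 0 \<le> f x" and f_le: "\<And>x. f x \<le> c" and f_supp: "\<And>x. x \<notin> A \<Longrightarrow> f x = 0"
    and big: "1 < RZ f"
  shows "\<exists>u::'a \<Rightarrow> real. u \<in> borel_measurable M \<and> (\<forall>x. 0 \<le> u x) \<and>
    assoc_norm M Z (\<lambda>x. ennreal (u x)) \<le> 1 \<and> 1 < (\<integral>\<^sup>+x. ennreal (f x) * ennreal (u x) \<partial>M)"
proof -
  obtain g where g_meas [measurable]: "g \<in> borel_measurable M" and g0: "\<And>x. 0 \<le> g x"
    and gf: "\<And>x. g x \<le> f x" and gR: "RZ g \<le> 1"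
    and near: "\<And>h. h \<in> borel_measurable M \<Longrightarrow> (\<And>x. 0 \<le> h x) \<Longrightarrow> (\<And>x. h x \<le> f x) \<Longrightarrow> RZ h \<le> 1 \<Longrightarrow>
       (\<integral>x. (f x - g x)\<^sup>2 \<partial>M) \<le> (\<integral>x. (f x - h x)\<^sup>2 \<partial>M)"
    using unit_ball_nearest_point[OF f_meas A A_fin f0 f_le f_supp] by blast
  define w where "w x = f x - g x" for x
  have w_meas [measurable]: "w \<in> borel_measurable M" unfolding w_def by measurable
  have w0: "0 \<le> w x" and wf: "w x \<le> f x" for x using g0[of x] gf[of x] unfolding w_def by auto
  have c0: "0 \<le> c" using f0 f_le order_trans by blast
  have f_ind: "f x \<le> c * indicator A x" for x
    using f_le[of x] f_supp[of x] by (auto simp: indicator_def)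
  have g_ind: "g x \<le> c * indicator A x" and w_ind: "w x \<le> c * indicator A x" for x
    using f_ind[of x] gf[of x] wf[of x] by linarith+
  have int_A: "integrable M k" if "k \<in> borel_measurable M" "\<And>x. \<bar>k x\<bar> \<le> b * indicator A x" for k :: "'a \<Rightarrow> real" and b
    by (rule Bochner_Integration.integrable_bound[of M "\<lambda>x. b * indicator A x"])
       (use that A_fin in \<open>auto simp: intro!: order_trans[OF that(2)] integrable_real_indicator\<close>)
  have int_prod: "integrable M (\<lambda>x. k x * l x)"
    if [measurable]: "k \<in> borel_measurable M" "l \<in> borel_measurable M"
      and k: "\<And>x. \<bar>k x\<bar> \<le> b * indicator A x" and l: "\<And>x. \<bar>l x\<bar> \<le> b' * indicator A x" for k l :: "'a \<Rightarrow> real" and b b'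
  proof (rule int_A[of _ "b * b'"])
    fix x
    have "\<bar>k x * l x\<bar> \<le> (b * indicator A x) * (b' * indicator A x)"
      unfolding abs_mult by (rule mult_mono[OF k l order_trans[OF abs_ge_zero k]]) auto
    then show "\<bar>k x * l x\<bar> \<le> b * b' * indicator A x" by (auto simp: indicator_def)
  qed measurable
  define W where "W = (\<integral>x. w x * w x \<partial>M)"
  define G where "G = (\<integral>x. g x * w x \<partial>M)"
  have int_ww: "integrable M (\<lambda>x. w x * w x)"
    by (rule int_prod[of _ _ c c]) (use w0 w_ind in auto)
  have int_gw: "integrable M (\<lambda>x. g x * w x)"
    by (rule int_prod[of _ _ c c]) (use w0 w_ind g0 g_ind in auto)
  have W0: "W > 0"
  proof -
    have "W \<ge> 0" unfolding W_def by (rule Bochner_Integration.integral_nonneg) auto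
    moreover have "W \<noteq> 0"
    proof
      assume "W = 0"
      then have "AE x in M. w x * w x = 0"
        unfolding W_def using int_ww by (subst (asm) integral_nonneg_eq_0_iff_AE) auto
      then have "AE x in M. \<bar>f x\<bar> \<le> \<bar>g x\<bar>"
        by eventually_elim (auto simp: w_def)
      then have "RZ f \<le> RZ g" by (intro RZ_mono) auto
      then show False using gR big by (meson leD order_trans)
    qed
    ultimately show ?thesis by simp
  qed
  have G0: "G \<ge> 0" unfolding G_def by (rule Bochner_Integration.integral_nonneg) (use g0 w0 in auto)
  \<comment> \<open>First variation along the segment from the nearest point to another point of the ball.\<close>
  have var: "(\<integral>x. k x * w x \<partial>M) \<le> G"
    if k_meas [measurable]: "k \<in> borel_measurable M" and k0: "\<And>x. 0 \<le> k x" and kb: "\<And>x. k x \<le> b * indicator A x"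
      and kR: "RZ k \<le> 1" for k and b
  proof -
    define z where "z x = k x - g x" for x
    have z_meas [measurable]: "z \<in> borel_measurable M" unfolding z_def by measurable
    have zb: "\<bar>z x\<bar> \<le> (b + c) * indicator A x" for x
      using k0[of x] kb[of x] g0[of x] g_ind[of x] unfolding z_def by (auto simp: algebra_simps abs_le_iff)
    have int_wz: "integrable M (\<lambda>x. w x * z x)"
      by (rule int_prod[of _ _ c "b + c"]) (use w0 w_ind zb in auto)
    have int_zz: "integrable M (\<lambda>x. z x * z x)"
      by (rule int_prod[of _ _ "b + c" "b + c"]) (use zb in auto)
    have int_kw: "integrable M (\<lambda>x. k x * w x)"
      by (rule int_prod[of _ _ b c]) (use w0 w_ind k0 kb in auto)
    have step: "2 * (\<integral>x. w x * z x \<partial>M) \<le> t * (\<integral>x. z x * z x \<partial>M)" if t: "0 < t" "t < 1" for t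
    proof -
      define h where "h x = (1 - t) * g x + t * k x" for x
      have h_meas [measurable]: "h \<in> borel_measurable M" unfolding h_def by measurable
      have h0: "0 \<le> h x" for x unfolding h_def using t g0[of x] k0[of x] by simp
      have hR: "RZ h \<le> 1" unfolding h_def using RZ_convex[of g k t] gR kR t by simp
      \<comment> \<open>Cutting a competitor at \<open>f\<close> keeps it in the ball and brings it closer to \<open>f\<close>.\<close>
      have "RZ (\<lambda>x. min (f x) (h x)) \<le> RZ h"
        by (rule RZ_mono) (use f0 h0 in auto)
      then have "(\<integral>x. (f x - g x)\<^sup>2 \<partial>M) \<le> (\<integral>x. (f x - min (f x) (h x))\<^sup>2 \<partial>M)"
        using f0 h0 hR by (intro near) (auto intro: order_trans)
      also have "\<dots> \<le> (\<integral>x. w x * w x - 2 * t * (w x * z x) + t * t * (z x * z x) \<partial>M)"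
      proof (rule integral_mono_AE')
        show "integrable M (\<lambda>x. w x * w x - 2 * t * (w x * z x) + t * t * (z x * z x))"
          using int_ww int_wz int_zz by auto
        have "(f x - min (f x) (h x))\<^sup>2 \<le> (f x - h x)\<^sup>2" for x
          by (auto simp: min_def)
        moreover have "(f x - h x)\<^sup>2 = w x * w x - 2 * t * (w x * z x) + t * t * (z x * z x)" for x
          unfolding h_def w_def z_def by (simp add: power2_eq_square algebra_simps)
        ultimately have "(f x - min (f x) (h x))\<^sup>2 \<le> w x * w x - 2 * t * (w x * z x) + t * t * (z x * z x)" for x
          by metis
        then show "AE x in M. (f x - min (f x) (h x))\<^sup>2 \<le> w x * w x - 2 * t * (w x * z x) + t * t * (z x * z x)"
          by blast
        then show "AE x in M. 0 \<le> w x * w x - 2 * t * (w x * z x) + t * t * (z x * z x)"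
          by eventually_elim (meson order_trans zero_le_power2)
      qed
      also have "\<dots> = W - 2 * t * (\<integral>x. w x * z x \<partial>M) + t * t * (\<integral>x. z x * z x \<partial>M)"
        unfolding W_def using int_ww int_wz int_zz by simp
      finally have "t * (2 * (\<integral>x. w x * z x \<partial>M)) \<le> t * (t * (\<integral>x. z x * z x \<partial>M))"
        unfolding W_def w_def[symmetric] by (simp add: power2_eq_square)
      then show ?thesis using t by simp
    qed
    have "2 * (\<integral>x. w x * z x \<partial>M) \<le> 0"
    proof (rule tendsto_lowerbound)
      show "((\<lambda>t. t * (\<integral>x. z x * z x \<partial>M)) \<longlongrightarrow> 0) (at_right 0)"
        by (rule tendsto_eq_intros refl | simp)+
      show "\<forall>\<^sub>F t in at_right 0. 2 * (\<integral>x. w x * z x \<partial>M) \<le> t * (\<integral>x. z x * z x \<partial>M)"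
      proof -
        have "\<forall>\<^sub>F t in at_right (0::real). t \<in> {0<..<1}" by (rule eventually_at_right_real) simp
        then show ?thesis by eventually_elim (rule step, auto)
      qed
    qed simp
    moreover have "(\<integral>x. w x * z x \<partial>M) = (\<integral>x. k x * w x \<partial>M) - G"
      unfolding G_def z_def using int_kw int_gw
      by (subst Bochner_Integration.integral_diff[symmetric]) (auto simp: algebra_simps)
    ultimately show ?thesis by simp
  qed
  have var': "(\<integral>\<^sup>+x. ennreal (w x) * ennreal (k x) \<partial>M) \<le> ennreal G"
    if [measurable]: "k \<in> borel_measurable M" and k0: "\<And>x. 0 \<le> k x" and kR: "RZ k \<le> 1" for k
  proof -
    define h where "h n x = min (k x) (real n * indicator A x)" for n x
    have h_meas [measurable]: "h n \<in> borel_measurable M" for n unfolding h_def by measurable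
    have h0: "0 \<le> h n x" and hk: "h n x \<le> k x" and hA: "h n x \<le> real n * indicator A x" for n x
      using k0[of x] unfolding h_def by auto
    have hR: "RZ (h n) \<le> 1" for n
      by (rule order_trans[OF RZ_mono[of "h n" k] kR]) (use h0 hk k0 in auto)
    have "(\<lambda>n. \<integral>\<^sup>+x. ennreal (h n x * w x) \<partial>M) \<longlonglongrightarrow> (\<integral>\<^sup>+x. ennreal (k x * w x) \<partial>M)"
    proof (rule nn_integral_LIMSEQ)
      show "incseq (\<lambda>n x. ennreal (h n x * w x))"
      proof (unfold incseq_def le_fun_def, intro allI impI)
        fix m n :: nat and x assume "m \<le> n"
        then have "real m * indicator A x \<le> real n * indicator A x" by (intro mult_right_mono) auto
        then have "h m x \<le> h n x" unfolding h_def by auto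
        then show "ennreal (h m x * w x) \<le> ennreal (h n x * w x)"
          using w0[of x] by (intro ennreal_leI mult_right_mono)
      qed
      fix x
      show "(\<lambda>n. ennreal (h n x * w x)) \<longlonglongrightarrow> ennreal (k x * w x)"
      proof (rule tendsto_eventually)
        obtain n0 where n0: "k x \<le> real n0" using real_arch_simple by blast
        have "h n x * w x = k x * w x" if "n \<ge> n0" for n
        proof (cases "x \<in> A")
          case True
          then have "h n x = k x" unfolding h_def using n0 that by auto
          then show ?thesis by simp
        next
          case False
          then have "w x = 0" using w0[of x] wf[of x] f_supp[of x] by simp
          then show ?thesis by simp
        qed
        then show "\<forall>\<^sub>F n in sequentially. ennreal (h n x * w x) = ennreal (k x * w x)"
          unfolding eventually_sequentially by metis
      qed
    qed measurable
    moreover have "(\<integral>\<^sup>+x. ennreal (h n x * w x) \<partial>M) \<le> ennreal G" for n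
    proof -
      have "integrable M (\<lambda>x. h n x * w x)"
        by (rule int_prod[of _ _ "real n" c]) (use h0 hA w0 w_ind in auto)
      then have "(\<integral>\<^sup>+x. ennreal (h n x * w x) \<partial>M) = ennreal (\<integral>x. h n x * w x \<partial>M)"
        by (rule nn_integral_eq_integral) (use h0 w0 in auto)
      also have "\<dots> \<le> ennreal G" by (rule ennreal_leI, rule var[OF _ h0 hA hR]) auto
      finally show ?thesis .
    qed
    ultimately have "(\<integral>\<^sup>+x. ennreal (k x * w x) \<partial>M) \<le> ennreal G" by (intro LIMSEQ_le_const2) auto
    moreover have "ennreal (w x) * ennreal (k x) = ennreal (k x * w x)" for x
      using k0 w0 by (simp add: ennreal_mult mult.commute)
    ultimately show ?thesis by simp
  qed
  \<comment> \<open>Any normalisation strictly between \<open>G\<close> and \<open>G + W\<close> would do; it also covers \<open>G = 0\<close>.\<close>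
  define b where "b = G + W / 2"
  have b: "b > 0" "G < b" "b < G + W" unfolding b_def using W0 G0 by auto
  define u where "u x = (1 / b) * w x" for x
  have u_meas: "u \<in> borel_measurable M" unfolding u_def by measurable
  have u0: "0 \<le> u x" for x unfolding u_def using w0[of x] b by simp
  have u_enn: "ennreal (u x) = ennreal (1 / b) * ennreal (w x)" for x
    unfolding u_def using b w0[of x] by (simp add: ennreal_mult[symmetric])
  have "assoc_norm M Z (\<lambda>x. ennreal (u x)) \<le> 1"
    unfolding assoc_norm_def
  proof (rule SUP_least)
    fix v assume "v \<in> {g \<in> borel_measurable M. Z g \<le> 1}"
    then have v [measurable]: "v \<in> borel_measurable M" and "Z v \<le> 1" by auto
    then have "RZ (\<lambda>x. cmod (v x)) \<le> 1" using RZ_cmod by simp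
    have "(\<integral>\<^sup>+x. ennreal (u x) * ennreal (cmod (v x)) \<partial>M) = ennreal (1 / b) * (\<integral>\<^sup>+x. ennreal (w x) * ennreal (cmod (v x)) \<partial>M)"
      unfolding u_enn by (simp add: nn_integral_cmult mult.assoc)
    also have "\<dots> \<le> ennreal (1 / b) * ennreal G"
      by (intro mult_left_mono var') (use \<open>RZ (\<lambda>x. cmod (v x)) \<le> 1\<close> in auto)
    also have "\<dots> = ennreal (G / b)" using b G0 by (simp add: ennreal_mult[symmetric])
    also have "\<dots> \<le> 1" using b G0 by (simp add: ennreal_le_1)
    finally show "(\<integral>\<^sup>+x. ennreal (u x) * ennreal (cmod (v x)) \<partial>M) \<le> 1" .
  qed
  moreover have "1 < (\<integral>\<^sup>+x. ennreal (f x) * ennreal (u x) \<partial>M)"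
  proof -
    have "ennreal (f x) * ennreal (u x) = ennreal (1/b) * ennreal (g x * w x + w x * w x)" for x
    proof -
      have "f x * ((1 / b) * w x) = (1 / b) * (g x * w x + w x * w x)" unfolding w_def by (simp add: field_simps)
      moreover have "ennreal (f x) * ennreal (u x) = ennreal (f x * ((1 / b) * w x))"
        unfolding u_def using f0[of x] w0[of x] b by (subst ennreal_mult) auto
      moreover have "ennreal ((1 / b) * (g x * w x + w x * w x)) = ennreal (1/b) * ennreal (g x * w x + w x * w x)"
        using w0[of x] g0[of x] b by (subst ennreal_mult) auto
      ultimately show ?thesis by metis
    qed
    then have "(\<integral>\<^sup>+x. ennreal (f x) * ennreal (u x) \<partial>M) = ennreal (1/b) * (\<integral>\<^sup>+x. ennreal (g x * w x + w x * w x) \<partial>M)"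
      by (simp add: nn_integral_cmult)
    also have "(\<integral>\<^sup>+x. ennreal (g x * w x + w x * w x) \<partial>M) = ennreal (\<integral>x. g x * w x + w x * w x \<partial>M)"
      by (rule nn_integral_eq_integral) (use int_gw int_ww g0 w0 in auto)
    also have "\<dots> = ennreal (G + W)" unfolding G_def W_def using int_gw int_ww by simp
    also have "ennreal (1/b) * \<dots> = ennreal ((G + W) / b)"
      using b G0 W0 by (subst ennreal_mult[symmetric]) auto
    also have "\<dots> > 1" using b by (simp add: one_less_ennreal)
    finally show ?thesis .
  qed
  ultimately show ?thesis using u_meas u0 by (intro exI[of _ u]) blast
qed

lemma assoc_norm_Holder:
  assumes [measurable]: "v \<in> borel_measurable M" and h [measurable]: "h \<in> borel_measurable M" and fin: "Z h < top"
  shows "(\<integral>\<^sup>+x. v x * ennreal (cmod (h x)) \<partial>M) \<le> assoc_norm M Z v * Z h"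
proof (cases "Z h = 0")
  case True
  then have "AE x in M. h x = 0" using quasi_norm_zero_iff[OF quasi_banach h] by simp
  then have "(\<integral>\<^sup>+x. v x * ennreal (cmod (h x)) \<partial>M) = (\<integral>\<^sup>+x. 0 \<partial>M)"
    by (intro nn_integral_cong_AE) auto
  then show ?thesis by simp
next
  case False
  define b where "b = enn2real (Z h)"
  have Zb: "Z h = ennreal b" unfolding b_def using fin by simp
  have b: "b > 0" unfolding b_def using False fin by (simp add: enn2real_positive_iff zero_less_iff_neq_zero)
  define g where "g x = complex_of_real (1 / b) * h x" for x
  have g [measurable]: "g \<in> borel_measurable M" unfolding g_def by measurable
  have "Z g = ennreal (1 / b) * ennreal b"
    unfolding g_def using quasi_norm_homog[OF quasi_banach h, of "complex_of_real (1/b)"] b Zb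
    by (simp add: norm_divide)
  then have Zg: "Z g \<le> 1" using b by (simp add: ennreal_mult[symmetric])
  have "v x * ennreal (cmod (h x)) = ennreal b * (v x * ennreal (cmod (g x)))" for x
  proof -
    have "cmod (h x) = b * cmod (g x)" unfolding g_def using b by (simp add: norm_mult norm_divide)
    then show ?thesis using b by (simp add: ennreal_mult mult.left_commute)
  qed
  then have "(\<integral>\<^sup>+x. v x * ennreal (cmod (h x)) \<partial>M) = ennreal b * (\<integral>\<^sup>+x. v x * ennreal (cmod (g x)) \<partial>M)"
    by (simp add: nn_integral_cmult)
  also have "\<dots> \<le> ennreal b * assoc_norm M Z v"
    unfolding assoc_norm_def by (intro mult_left_mono SUP_upper) (use Zg g in auto)
  finally show ?thesis unfolding Zb by (simp add: mult.commute)
qed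

end

locale ball_banach_on_homogeneous =
  homogeneous_space M \<rho> K L + ball_banach_lattice M \<rho> Z
  for M :: "'a measure" and \<rho> :: "'a \<Rightarrow> 'a \<Rightarrow> real" and K L :: real and Z :: "'a fun_norm"
begin

text \<open>
  Local integrability of the functions in \<open>Z\<close> says that multiples of indicators of balls
  belong to the associate space, which therefore has enough functions to detect where a function is
  finite.
\<close>
lemma ball_test_function:
  assumes x: "x \<in> space M" and r: "0 < r"
  obtains b :: real where "0 < b" "assoc_norm M Z (\<lambda>y. ennreal (b * indicator (B x r) y)) \<le> 1"
proof -
  have [measurable]: "B x r \<in> sets M" by (rule ball_sets[OF x])
  obtain C :: real where C: "C > 0"
    "\<forall>f\<in>fun_space M Z. (\<integral>\<^sup>+y\<in>qball M \<rho> x r. ennreal (cmod (f y)) \<partial>M) \<le> ennreal C * Z f"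
    using ball_banach x r unfolding ball_banach_def by blast
  have "assoc_norm M Z (\<lambda>y. ennreal (1 / C * indicator (B x r) y)) \<le> 1"
    unfolding assoc_norm_def
  proof (rule SUP_least)
    fix g assume "g \<in> {g \<in> borel_measurable M. Z g \<le> 1}"
    then have g [measurable]: "g \<in> borel_measurable M" and "Z g \<le> 1" by auto
    then have gZ: "g \<in> fun_space M Z" unfolding fun_space_def by (auto intro: le_less_trans)
    have "(\<integral>\<^sup>+y. ennreal (1 / C * indicator (B x r) y) * ennreal (cmod (g y)) \<partial>M)
        = (\<integral>\<^sup>+y. ennreal (1 / C) * (ennreal (cmod (g y)) * indicator (B x r) y) \<partial>M)"
      by (intro nn_integral_cong) (auto simp: indicator_def)
    also have "\<dots> = ennreal (1 / C) * (\<integral>\<^sup>+y\<in>B x r. ennreal (cmod (g y)) \<partial>M)"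
      by (intro nn_integral_cmult) measurable
    also have "\<dots> \<le> ennreal (1 / C) * (ennreal C * 1)"
    proof (intro mult_left_mono)
      have "(\<integral>\<^sup>+y\<in>B x r. ennreal (cmod (g y)) \<partial>M) \<le> ennreal C * Z g" using C(2) gZ by blast
      also have "\<dots> \<le> ennreal C * 1" by (intro mult_left_mono \<open>Z g \<le> 1\<close>) simp
      finally show "(\<integral>\<^sup>+y\<in>B x r. ennreal (cmod (g y)) \<partial>M) \<le> ennreal C * 1" .
    qed simp
    also have "\<dots> = 1" using C(1) by (simp add: ennreal_mult[symmetric])
    finally show "(\<integral>\<^sup>+y. ennreal (1 / C * indicator (B x r) y) * ennreal (cmod (g y)) \<partial>M) \<le> 1" .
  qed
  moreover have "0 < 1 / C" using C(1) by simp
  ultimately show ?thesis by (rule that[rotated])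
qed

text \<open>
  The theorem \<open>Z'' = Z\<close>, with equality of norms, for \<open>[0,\<infinity>]\<close>-valued
  functions. Truncations of \<open>h\<close> are bounded with support in a ball; if one of them had norm
  above the bound, a separating functional would contradict the hypothesis. The Fatou property then
  removes the truncation.
\<close>
lemma Lorentz_Luxemburg:
  fixes h :: "'a \<Rightarrow> ennreal"
  assumes h [measurable]: "h \<in> borel_measurable M" and c: "c < top"
    and dual: "\<And>u::'a \<Rightarrow> real. u \<in> borel_measurable M \<Longrightarrow> (\<And>x. 0 \<le> u x) \<Longrightarrow>
      assoc_norm M Z (\<lambda>x. ennreal (u x)) \<le> 1 \<Longrightarrow> (\<integral>\<^sup>+x. h x * ennreal (u x) \<partial>M) \<le> c"
  shows "AE x in M. h x < top" and "RZ (\<lambda>x. enn2real (h x)) \<le> c"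
proof -
  obtain x0 where x0: "x0 \<in> space M" using space_nonempty by auto
  define A where "A n = B x0 (real (Suc n))" for n
  have A [measurable]: "A n \<in> sets M" for n unfolding A_def using x0 by simp
  have A_fin: "emeasure M (A n) < top" for n unfolding A_def using emeasure_ball[OF x0] by simp
  have A_mono: "m \<le> n \<Longrightarrow> A m \<subseteq> A n" for m n unfolding A_def by (auto simp: mem_ball)
  have A_cover: "x \<in> space M \<Longrightarrow> \<exists>n. x \<in> A n" for x
    using space_eq_Union_balls[OF x0] unfolding A_def by blast
  have "AE x in M. h x * indicator (A n) x < top" for n
  proof -
    obtain b where b: "0 < b" and b1: "assoc_norm M Z (\<lambda>y. ennreal (b * indicator (A n) y)) \<le> 1"
      unfolding A_def using ball_test_function[OF x0, of "real (Suc n)"] by auto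
    have "(\<integral>\<^sup>+x. h x * ennreal (b * indicator (A n) x) \<partial>M) \<le> c"
      by (rule dual[OF _ _ b1]) (use b in auto)
    then have "(\<integral>\<^sup>+x. h x * ennreal (b * indicator (A n) x) \<partial>M) \<noteq> \<infinity>" using c by auto
    then have "AE x in M. h x * ennreal (b * indicator (A n) x) \<noteq> \<infinity>"
      by (intro nn_integral_noteq_infinite) measurable
    then show ?thesis
    proof eventually_elim
      case (elim x)
      show ?case
      proof (cases "x \<in> A n")
        case True
        then have "h x \<noteq> top" using elim b by (auto simp: ennreal_top_mult)
        then show ?thesis using True by (simp add: less_top)
      qed simp
    qed
  qed
  then have "AE x in M. \<forall>n. h x * indicator (A n) x < top" by (simp add: AE_all_countable)
  then show fin: "AE x in M. h x < top"
  proof (rule AE_mp, intro AE_I2 impI)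
    fix x assume "x \<in> space M" and *: "\<forall>n. h x * indicator (A n) x < top"
    then obtain n where "x \<in> A n" using A_cover by blast
    then show "h x < top" using *[rule_format, of n] by simp
  qed
  show "RZ (\<lambda>x. enn2real (h x)) \<le> c"
  proof (rule ennreal_le_epsilon)
    fix e :: real assume e: "0 < e"
    define d where "d = enn2real c + e"
    have d: "d > 0" "c \<le> ennreal d" "c + ennreal e = ennreal d"
    proof -
      show "d > 0" unfolding d_def using e by (simp add: add_nonneg_pos)
      show "c + ennreal e = ennreal d" unfolding d_def using c e by (simp add: ennreal_plus)
      have "c \<le> c + ennreal e" by simp
      then show "c \<le> ennreal d" unfolding \<open>c + ennreal e = ennreal d\<close> .
    qed
    define v where "v n x = min (enn2real (h x)) (real n) * indicator (A n) x" for n x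
    have v [measurable]: "v n \<in> borel_measurable M" for n unfolding v_def by measurable
    have v0: "0 \<le> v n x" and vn: "v n x \<le> real n" and vh: "v n x \<le> enn2real (h x)" for n x
      unfolding v_def by (auto simp: indicator_def)
    have "RZ (v n) \<le> ennreal d" for n
    proof (rule ccontr)
      assume "\<not> RZ (v n) \<le> ennreal d"
      then have big: "ennreal d < RZ (v n)" by simp
      define f where "f x = (1 / d) * v n x" for x
      have f [measurable]: "f \<in> borel_measurable M" unfolding f_def by measurable
      have "RZ f = ennreal (1 / d) * RZ (v n)"
        unfolding f_def using RZ_scale[of "v n" "1 / d"] d(1) by simp
      also have "\<dots> > ennreal (1 / d) * ennreal d"
        by (rule ennreal_mult_strict_left_mono[OF big]) (use d(1) in simp_all)
      also have "ennreal (1 / d) * ennreal d = 1" using d(1) by (simp add: ennreal_mult[symmetric])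
      finally have "1 < RZ f" .
      then obtain u :: "'a \<Rightarrow> real" where u [measurable]: "u \<in> borel_measurable M" and u0: "\<And>x. 0 \<le> u x"
        and u1: "assoc_norm M Z (\<lambda>x. ennreal (u x)) \<le> 1" and fu: "1 < (\<integral>\<^sup>+x. ennreal (f x) * ennreal (u x) \<partial>M)"
      proof -
        have "\<exists>u::'a \<Rightarrow> real. u \<in> borel_measurable M \<and> (\<forall>x. 0 \<le> u x) \<and>
            assoc_norm M Z (\<lambda>x. ennreal (u x)) \<le> 1 \<and> 1 < (\<integral>\<^sup>+x. ennreal (f x) * ennreal (u x) \<partial>M)"
        proof (rule unit_ball_separation[OF f A[of n] A_fin[of n]])
          show "f x \<le> real n / d" for x
            unfolding f_def using vn[of n x] d(1) by (simp add: divide_right_mono)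
          show "0 \<le> f x" for x unfolding f_def using v0[of n x] d(1) by simp
          show "f x = 0" if "x \<notin> A n" for x unfolding f_def v_def using that by simp
        qed fact
        then show thesis using that by blast
      qed
      have "(\<integral>\<^sup>+x. ennreal (f x) * ennreal (u x) \<partial>M) \<le> (\<integral>\<^sup>+x. ennreal (1 / d) * (h x * ennreal (u x)) \<partial>M)"
      proof (rule nn_integral_mono_AE)
        show "AE x in M. ennreal (f x) * ennreal (u x) \<le> ennreal (1 / d) * (h x * ennreal (u x))"
          using fin
        proof eventually_elim
          case (elim x)
          have "ennreal (f x) = ennreal (1 / d) * ennreal (v n x)"
            unfolding f_def using d(1) v0[of n x] by (intro ennreal_mult) simp_all
          also have "\<dots> \<le> ennreal (1 / d) * h x"
          proof (rule mult_left_mono)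
            have "ennreal (v n x) \<le> ennreal (enn2real (h x))" by (rule ennreal_leI[OF vh])
            then show "ennreal (v n x) \<le> h x" using elim by simp
          qed simp
          finally show ?case by (simp add: mult_right_mono mult.assoc[symmetric])
        qed
      qed
      also have "\<dots> = ennreal (1 / d) * (\<integral>\<^sup>+x. h x * ennreal (u x) \<partial>M)"
        by (intro nn_integral_cmult) measurable
      also have "\<dots> \<le> ennreal (1 / d) * ennreal d"
        by (intro mult_left_mono order_trans[OF dual[OF u u0 u1] d(2)]) simp
      also have "\<dots> = 1" using d(1) by (simp add: ennreal_mult[symmetric])
      finally show False using fu by simp
    qed
    then have v_bound: "RZ (v n) \<le> ennreal d" for n .
    have "RZ (\<lambda>x. enn2real (h x)) \<le> ennreal d"
    proof (rule RZ_Fatou[of v, OF v _ v0 _ v_bound])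
      show "(\<lambda>x. enn2real (h x)) \<in> borel_measurable M" by measurable
      show "AE x in M. (\<lambda>n. v n x) \<longlonglongrightarrow> enn2real (h x)"
      proof (rule AE_I2)
        fix x assume "x \<in> space M"
        then obtain m where m: "x \<in> A m" using A_cover by blast
        obtain k where k: "enn2real (h x) \<le> real k" using real_arch_simple by blast
        have "v n x = enn2real (h x)" if "n \<ge> max m k" for n
        proof -
          have "x \<in> A n" using A_mono[of m n] m that by auto
          moreover have "enn2real (h x) \<le> real n" using k that by simp
          ultimately show ?thesis unfolding v_def by simp
        qed
        then have "\<forall>\<^sub>F n in sequentially. v n x = enn2real (h x)"
          unfolding eventually_sequentially by (intro exI[of _ "max m k"]) blast
        then show "(\<lambda>n. v n x) \<longlonglongrightarrow> enn2real (h x)" by (rule tendsto_eventually)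
      qed
    qed
    then show "RZ (\<lambda>x. enn2real (h x)) \<le> c + ennreal e" unfolding d(3) .
  qed
qed

section \<open>Averages in a space with bounded maximal operator on its associate\<close>

lemma assoc_norm_mono:
  assumes "\<And>x. x \<in> space M \<Longrightarrow> v x \<le> w x"
  shows "assoc_norm M Z v \<le> assoc_norm M Z w"
  unfolding assoc_norm_def
  by (intro SUP_mono) (auto intro!: nn_integral_mono mult_right_mono assms bexI)

text \<open>
  By the Lorentz--Luxemburg theorem the bound may be tested on \<open>u\<close> in the unit ball of the
  associate space. There the step majorant of each average can be moved to \<open>u\<close>, which
  yields the maximal function of \<open>u\<close> and a constant that depends neither on the radius nor
  on the weights. Testing the whole sum at once gives its finiteness almost everywhere as well.
\<close>
lemma weighted_averages_bound:
  assumes "maximal_bounded_on_assoc M \<rho> Z"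
  shows "\<exists>D::real>0. \<forall>w r. \<forall>F\<in>fun_space M Z. (\<forall>k::nat. 0 < r k) \<longrightarrow> (\<Sum>k. w k) \<le> (1::ennreal) \<longrightarrow>
     (\<exists>G::'a \<Rightarrow> real. G \<in> borel_measurable M \<and> (\<forall>x. 0 \<le> G x) \<and> RZ G \<le> ennreal D * Z F \<and>
        (AE x in M. (\<Sum>k. w k * avg x (r k) (\<lambda>y. ennreal (cmod (F y)))) \<le> ennreal (G x)))"
proof -
  obtain C :: real where C: "C > 0" and max: "\<forall>f\<in>assoc_space M Z.
        assoc_norm M Z (maximal_fun M \<rho> f) \<le> ennreal C * assoc_norm M Z (\<lambda>x. ennreal (cmod (f x)))"
    using assms unfolding maximal_bounded_on_assoc_def by blast
  obtain D :: real where D: "1 \<le> D" and step: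
    "\<forall>r H. 0 < r \<longrightarrow> H \<in> borel_measurable M \<longrightarrow>
       (\<exists>T. step_majorant D r H T)"
    using average_step_majorant by blast
  have D0: "0 < D" using D by simp
  show ?thesis
  proof (intro exI[of _ "D * D * C"] conjI allI ballI impI)
    show "0 < D * D * C" using D0 C by simp
    fix w :: "nat \<Rightarrow> ennreal" and r :: "nat \<Rightarrow> real" and F
    assume "F \<in> fun_space M Z" and r: "\<forall>k. 0 < r k" and w: "(\<Sum>k. w k) \<le> 1"
    then have F [measurable]: "F \<in> borel_measurable M" and ZF: "Z F < top"
      unfolding fun_space_def by auto
    define H where "H y = ennreal (cmod (F y))" for y
    have H [measurable]: "H \<in> borel_measurable M" unfolding H_def by measurable
    have "\<exists>T. step_majorant D (r k) H T" for k
      using step[rule_format, of "r k" H] r H by blast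
    then obtain T where T': "\<forall>k. step_majorant D (r k) H (T k)"
      by (rule choice[THEN exE, OF allI])
    have T [measurable]: "T k \<in> borel_measurable M" for k using T' unfolding step_majorant_def by blast
    have T_avg: "avg x (r k) H \<le> ennreal D * T k x" if "x \<in> space M" for k x
      using T' that unfolding step_majorant_def by blast
    have T_dual: "(\<integral>\<^sup>+x. T k x * ennreal (u x) \<partial>M) \<le> ennreal (D * C) * Z F"
      if u [measurable]: "u \<in> borel_measurable M" and u0: "\<And>x. 0 \<le> u x"
        and u1: "assoc_norm M Z (\<lambda>x. ennreal (u x)) \<le> 1" for k and u :: "'a \<Rightarrow> real"
    proof -
      let ?m = "maximal_fun M \<rho> (\<lambda>x. complex_of_real (u x))"
      obtain S where S [measurable]: "S \<in> borel_measurable M" and S_le: "\<forall>y\<in>space M. S y \<le> ennreal D * ?m y"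
        and TS: "(\<integral>\<^sup>+x. T k x * ennreal (u x) \<partial>M) = (\<integral>\<^sup>+x. H x * S x \<partial>M)"
        using T'[rule_format, of k] u u0 unfolding step_majorant_def by blast
      define S' where "S' x = ennreal (1 / D) * S x" for x
      have S' [measurable]: "S' \<in> borel_measurable M" unfolding S'_def by measurable
      have D1: "ennreal D * (ennreal (1 / D) * x) = x" "ennreal (1 / D) * (ennreal D * x) = x" for x
        using D0 by (simp_all add: mult.assoc[symmetric] ennreal_mult[symmetric])
      have "S' y \<le> ?m y" if "y \<in> space M" for y
        using mult_left_mono[OF S_le[rule_format, OF that], of "ennreal (1 / D)"] unfolding S'_def D1 by simp
      then have "assoc_norm M Z S' \<le> assoc_norm M Z ?m" by (rule assoc_norm_mono)
      also have "\<dots> \<le> ennreal C * assoc_norm M Z (\<lambda>x. ennreal (cmod (complex_of_real (u x))))"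
      proof (rule max[rule_format])
        show "(\<lambda>x. complex_of_real (u x)) \<in> assoc_space M Z"
          unfolding assoc_space_def using u0 le_less_trans[OF u1, of top] by auto
      qed
      also have "\<dots> \<le> ennreal C * 1" using u0 u1 by (intro mult_left_mono) auto
      finally have S'C: "assoc_norm M Z S' \<le> ennreal C" by simp
      have "(\<integral>\<^sup>+x. H x * S x \<partial>M) = (\<integral>\<^sup>+x. ennreal D * (S' x * ennreal (cmod (F x))) \<partial>M)"
        unfolding S'_def H_def mult.assoc D1 by (simp add: mult.commute)
      also have "\<dots> = ennreal D * (\<integral>\<^sup>+x. S' x * ennreal (cmod (F x)) \<partial>M)"
        by (intro nn_integral_cmult) measurable
      also have "\<dots> \<le> ennreal D * (assoc_norm M Z S' * Z F)"
        by (intro mult_left_mono assoc_norm_Holder S' F ZF) simp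
      also have "\<dots> \<le> ennreal D * (ennreal C * Z F)"
        by (intro mult_left_mono mult_right_mono S'C) simp_all
      also have "\<dots> = ennreal (D * C) * Z F"
        using D0 C by (simp add: ennreal_mult mult.assoc)
      finally show ?thesis unfolding TS .
    qed
    define h where "h x = (\<Sum>k. w k * (ennreal D * T k x))" for x
    have h [measurable]: "h \<in> borel_measurable M" unfolding h_def by measurable
    define c where "c = ennreal (D * D * C) * Z F"
    have c: "c < top" unfolding c_def using ZF by (simp add: ennreal_mult_less_top)
    have h_dual: "(\<integral>\<^sup>+x. h x * ennreal (u x) \<partial>M) \<le> c"
      if u [measurable]: "u \<in> borel_measurable M" and u0: "\<And>x. 0 \<le> u x"
        and u1: "assoc_norm M Z (\<lambda>x. ennreal (u x)) \<le> 1" for u :: "'a \<Rightarrow> real"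
    proof -
      have "(\<integral>\<^sup>+x. h x * ennreal (u x) \<partial>M) = (\<integral>\<^sup>+x. (\<Sum>k. (w k * ennreal D) * (T k x * ennreal (u x))) \<partial>M)"
        unfolding h_def ennreal_suminf_multc[symmetric] by (simp add: mult_ac)
      also have "\<dots> = (\<Sum>k. (w k * ennreal D) * (\<integral>\<^sup>+x. T k x * ennreal (u x) \<partial>M))"
        by (subst nn_integral_suminf) (simp_all add: nn_integral_cmult)
      also have "\<dots> \<le> (\<Sum>k. w k * c)"
      proof (intro suminf_le summableI)
        fix k
        have "(w k * ennreal D) * (\<integral>\<^sup>+x. T k x * ennreal (u x) \<partial>M) \<le> (w k * ennreal D) * (ennreal (D * C) * Z F)"
          by (intro mult_left_mono T_dual u u0 u1) simp
        also have "\<dots> = w k * ((ennreal D * ennreal (D * C)) * Z F)" by (simp only: mult.assoc)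
        also have "ennreal D * ennreal (D * C) = ennreal (D * D * C)"
          using D0 C by (simp add: ennreal_mult[symmetric] mult.assoc)
        finally show "(w k * ennreal D) * (\<integral>\<^sup>+x. T k x * ennreal (u x) \<partial>M) \<le> w k * c"
          unfolding c_def .
      qed
      also have "\<dots> = (\<Sum>k. w k) * c" by simp
      also have "\<dots> \<le> 1 * c" by (intro mult_right_mono w) simp
      finally show ?thesis by simp
    qed
    have h_fin: "AE x in M. h x < top"
      by (rule Lorentz_Luxemburg(1)[OF h c]) (rule h_dual, auto)
    have h_le: "RZ (\<lambda>x. enn2real (h x)) \<le> c"
      by (rule Lorentz_Luxemburg(2)[OF h c]) (rule h_dual, auto)
    define G where "G x = enn2real (h x)" for x
    have "G \<in> borel_measurable M" unfolding G_def by measurable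
    moreover have "\<forall>x. 0 \<le> G x" unfolding G_def by simp
    moreover have "RZ G \<le> ennreal (D * D * C) * Z F"
      using h_le unfolding G_def c_def .
    moreover have "AE x in M. (\<Sum>k. w k * avg x (r k) (\<lambda>y. ennreal (cmod (F y)))) \<le> ennreal (G x)"
      using h_fin
    proof (rule AE_mp, intro AE_I2 impI)
      fix x assume x: "x \<in> space M" and "h x < top"
      have "(\<Sum>k. w k * avg x (r k) (\<lambda>y. ennreal (cmod (F y)))) \<le> h x"
        unfolding h_def by (intro suminf_le summableI mult_left_mono T_avg[unfolded H_def] x) simp
      then show "(\<Sum>k. w k * avg x (r k) (\<lambda>y. ennreal (cmod (F y)))) \<le> ennreal (G x)"
        unfolding G_def using \<open>h x < top\<close> by simp
    qed
    ultimately show "\<exists>G::'a \<Rightarrow> real. G \<in> borel_measurable M \<and> (\<forall>x. 0 \<le> G x) \<and> RZ G \<le> ennreal (D * D * C) * Z F \<and>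
        (AE x in M. (\<Sum>k. w k * avg x (r k) (\<lambda>y. ennreal (cmod (F y)))) \<le> ennreal (G x))"
      by (intro exI[of _ G] conjI)
  qed
qed

end

section \<open>Powers of the quasi-norm\<close>

lemma ennpowr_ennreal: "0 \<le> c \<Longrightarrow> ennpowr (ennreal c) a = ennreal (c powr a)"
  unfolding ennpowr_def by simp

lemma ennpowr_top [simp]: "ennpowr top a = top"
  unfolding ennpowr_def by simp

lemma ennpowr_eq_top_iff [simp]: "ennpowr x a = top \<longleftrightarrow> x = top"
  by (cases x) (auto simp: ennpowr_ennreal)

lemma ennpowr_le_iff: "0 < a \<Longrightarrow> ennpowr x a \<le> ennpowr y a \<longleftrightarrow> x \<le> y"
proof -
  assume a: "0 < a"
  have le: "c powr a \<le> d powr a \<longleftrightarrow> c \<le> d" if "0 \<le> c" "0 \<le> d" for c d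
    using that powr_mono2[of a c d] powr_less_mono2[of a d c] a by force
  show ?thesis
    by (cases x; cases y) (auto simp: ennpowr_ennreal le top_unique)
qed

lemma ennpowr_ennpowr: "ennpowr (ennpowr x a) b = ennpowr x (a * b)"
  by (cases x) (auto simp: ennpowr_ennreal powr_powr)

lemma ennpowr_one [simp]: "ennpowr x 1 = x"
  by (cases x) (auto simp: ennpowr_ennreal)

lemma ennpowr_cmult: "0 < c \<Longrightarrow> ennpowr (ennreal c * x) a = ennreal (c powr a) * ennpowr x a"
  by (cases x) (auto simp: ennpowr_ennreal ennreal_mult[symmetric] powr_mult ennreal_mult_top)

lemma powr_le_scaled_sum:
  fixes t :: real
  assumes "0 \<le> t" "0 < l" "0 < q" "q \<le> p"
  shows "t powr q \<le> l powr q + l powr (q - p) * t powr p"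
proof (cases "t \<le> l")
  case True
  then have "t powr q \<le> l powr q" using assms by (intro powr_mono2) auto
  moreover have "0 \<le> l powr (q - p) * t powr p" by simp
  ultimately show ?thesis by linarith
next
  case False
  then have t: "0 < t" "l \<le> t" using assms by auto
  have "t powr q = t powr (q - p) * t powr p" using t by (simp add: powr_add[symmetric])
  also have "\<dots> \<le> l powr (q - p) * t powr p"
    using t assms by (intro mult_right_mono powr_mono2') auto
  finally show ?thesis using powr_ge_zero[of l q] by linarith
qed

context homogeneous_space
begin

abbreviation mod_powr :: "real \<Rightarrow> ('a \<Rightarrow> complex) \<Rightarrow> 'a \<Rightarrow> ennreal" where
  "mod_powr t F y \<equiv> ennreal (cmod (F y) powr t)"

text \<open>
  A power mean inequality, up to the factor \<open>2\<close>: if \<open>\<lambda>\<^sup>p\<close> bounds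
  the averaged \<open>p\<close>-th powers, the inequality \<open>t\<^sup>q \<le> \<lambda>\<^sup>q +
  \<lambda>\<^sup>q\<^sup>-\<^sup>p t\<^sup>p\<close> can be averaged term by term.
\<close>
lemma weighted_averages_power_le:
  assumes x: "x \<in> space M" and r: "\<And>k. 0 < r k" and w: "(\<Sum>k. w k) \<le> (1::ennreal)"
    and F [measurable]: "F \<in> borel_measurable M" and qp: "0 < q" "q \<le> p" and l: "0 < l"
    and le: "(\<Sum>k::nat. w k * avg x (r k) (mod_powr p F)) \<le> ennreal (l powr p)"
  shows "(\<Sum>k. w k * avg x (r k) (mod_powr q F)) \<le> ennreal (2 * l powr q)"
proof -
  define P where "P k = avg x (r k) (mod_powr p F)" for k
  have summand: "avg x (r k) (mod_powr q F)
      \<le> ennreal (l powr q) + ennreal (l powr (q - p)) * P k" for k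
  proof -
    have [measurable]: "B x (r k) \<in> sets M" by (rule ball_sets[OF x])
    have "(\<integral>\<^sup>+y\<in>B x (r k). ennreal (cmod (F y) powr q) \<partial>M)
        \<le> (\<integral>\<^sup>+y. ennreal (l powr q) * indicator (B x (r k)) y + ennreal (l powr (q - p)) * (ennreal (cmod (F y) powr p) * indicator (B x (r k)) y) \<partial>M)"
    proof (rule nn_integral_mono)
      fix y
      have "ennreal (cmod (F y) powr q) \<le> ennreal (l powr q + l powr (q - p) * cmod (F y) powr p)"
        by (intro ennreal_leI powr_le_scaled_sum) (use l qp in auto)
      then show "ennreal (cmod (F y) powr q) * indicator (B x (r k)) y \<le> ennreal (l powr q) * indicator (B x (r k)) y
          + ennreal (l powr (q - p)) * (ennreal (cmod (F y) powr p) * indicator (B x (r k)) y)"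
        by (auto simp: indicator_def ennreal_mult)
    qed
    also have "\<dots> = ennreal (l powr q) * emeasure M (B x (r k)) + ennreal (l powr (q - p)) * (\<integral>\<^sup>+y\<in>B x (r k). ennreal (cmod (F y) powr p) \<partial>M)"
      by (subst nn_integral_add) (simp_all add: nn_integral_cmult nn_integral_cmult_indicator)
    finally have "avg x (r k) (mod_powr q F) \<le> (ennreal (l powr q) * emeasure M (B x (r k)) + ennreal (l powr (q - p)) * (\<integral>\<^sup>+y\<in>B x (r k). ennreal (cmod (F y) powr p) \<partial>M)) / emeasure M (B x (r k))"
      by (rule divide_right_mono_ennreal)
    also have "\<dots> = ennreal (l powr q) + ennreal (l powr (q - p)) * P k"
    proof -
      have v: "0 < V x (r k)" by (rule V_pos[OF x r])
      have "ennreal (1 / V x (r k)) * ennreal (V x (r k)) = 1" using v by (simp add: ennreal_mult[symmetric])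
      then have "ennreal (1 / V x (r k)) * (ennreal (l powr q) * ennreal (V x (r k))) = ennreal (l powr q)"
        by (subst mult.left_commute) simp
      then show ?thesis unfolding P_def emeasure_ball[OF x] divide_ennreal_pos[OF v] distrib_left
        by (subst mult.left_commute[of "ennreal (1 / V x (r k))" "ennreal (l powr (q - p))"]) simp
    qed
    finally show ?thesis .
  qed
  have "(\<Sum>k. w k * avg x (r k) (mod_powr q F))
      \<le> (\<Sum>k. w k * ennreal (l powr q) + ennreal (l powr (q - p)) * (w k * P k))"
  proof (intro suminf_le summableI)
    fix k
    show "w k * avg x (r k) (mod_powr q F)
        \<le> w k * ennreal (l powr q) + ennreal (l powr (q - p)) * (w k * P k)"
      using mult_left_mono[OF summand[of k], of "w k"]
      unfolding distrib_left mult.left_commute[of "w k" "ennreal (l powr (q - p))"] by simp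
  qed
  also have "\<dots> = (\<Sum>k. w k) * ennreal (l powr q) + ennreal (l powr (q - p)) * (\<Sum>k. w k * P k)"
    unfolding ennreal_suminf_multc[symmetric] ennreal_suminf_cmult[symmetric]
    by (rule suminf_add[symmetric]) (rule summableI)+
  also have "\<dots> \<le> 1 * ennreal (l powr q) + ennreal (l powr (q - p)) * ennreal (l powr p)"
    by (intro add_mono mult_right_mono mult_left_mono w le[folded P_def]) simp_all
  also have "\<dots> = ennreal (2 * l powr q)"
  proof -
    have "ennreal (l powr (q - p)) * ennreal (l powr p) = ennreal (l powr q)"
      using l by (simp add: ennreal_mult[symmetric] powr_add[symmetric])
    then show ?thesis by (simp only: mult_1 mult_2 ennreal_plus[symmetric] powr_ge_zero)
  qed
  finally show ?thesis .
qed

end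

locale ball_quasi_banach_setting =
  homogeneous_space M \<rho> K L for M :: "'a measure" and \<rho> :: "'a \<Rightarrow> 'a \<Rightarrow> real" and K L :: real +
  fixes N :: "'a fun_norm" and p q :: real
  assumes q_pos: "0 < q" and q_le_p: "q \<le> p"
    and N_quasi_banach: "ball_quasi_banach M \<rho> N"
    and Z_banach: "ball_banach M \<rho> (power_norm N (1 / p))"
    and maximal: "maximal_bounded_on_assoc M \<rho> (power_norm N (1 / p))"
begin

lemma p_pos: "0 < p" using q_pos q_le_p by simp

abbreviation RN :: "('a \<Rightarrow> real) \<Rightarrow> ennreal" where
  "RN u \<equiv> N (\<lambda>x. complex_of_real (u x))"

lemma RN_mono:
  assumes "u \<in> borel_measurable M" "v \<in> borel_measurable M" "AE x in M. \<bar>u x\<bar> \<le> \<bar>v x\<bar>"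
  shows "RN u \<le> RN v"
  by (rule quasi_norm_mono[OF N_quasi_banach]) (use assms in auto)

lemma RN_cmod:
  assumes "g \<in> borel_measurable M" shows "RN (\<lambda>x. cmod (g x)) = N g"
  by (rule quasi_norm_cong_cmod[OF N_quasi_banach]) (use assms in auto)

lemma RN_scale:
  assumes "u \<in> borel_measurable M" "0 \<le> c" shows "RN (\<lambda>x. c * u x) = ennreal c * RN u"
  using quasi_norm_homog[OF N_quasi_banach, of "\<lambda>x. complex_of_real (u x)" "complex_of_real c"] assms by simp

text \<open>
  The bound for \<open>|F|\<^sup>p\<close> in \<open>Y\<^sup>1\<^sup>/\<^sup>p\<close>, which is the
  bound for \<open>F\<close> in \<open>Y\<close>, with the exponent then lowered from \<open>p\<close>
  to \<open>q\<close>.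
\<close>
lemma weighted_averages_bound_N:
  "\<exists>D::real>0. \<forall>w r. \<forall>F\<in>fun_space M N. (\<forall>k::nat. 0 < r k) \<longrightarrow> (\<Sum>k. w k) \<le> (1::ennreal) \<longrightarrow>
     (\<exists>G::'a \<Rightarrow> real. G \<in> borel_measurable M \<and> (\<forall>x. 0 \<le> G x) \<and> RN G \<le> ennreal D * N F \<and>
        (AE x in M. (\<Sum>k. w k * avg x (r k) (mod_powr q F)) \<le> ennreal (G x powr q)))"
proof -
  let ?Z = "power_norm N (1 / p)"
  interpret Z: ball_banach_on_homogeneous M \<rho> K L ?Z
    by unfold_locales (rule Z_banach)
  obtain D :: real where D: "0 < D" and bound:
    "\<forall>w r. \<forall>F\<in>fun_space M ?Z. (\<forall>k::nat. 0 < r k) \<longrightarrow> (\<Sum>k. w k) \<le> (1::ennreal) \<longrightarrow>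
     (\<exists>G::'a \<Rightarrow> real. G \<in> borel_measurable M \<and> (\<forall>x. 0 \<le> G x) \<and> ?Z (\<lambda>x. complex_of_real (G x)) \<le> ennreal D * ?Z F \<and>
        (AE x in M. (\<Sum>k. w k * avg x (r k) (\<lambda>y. ennreal (cmod (F y)))) \<le> ennreal (G x)))"
    using Z.weighted_averages_bound[OF maximal] by (elim exE conjE)
  define C where "C = 2 powr (1 / q) * D powr (1 / p)"
  have C: "C > 0" unfolding C_def using D by simp
  show ?thesis
  proof (intro exI[of _ C] conjI allI ballI impI C)
    fix w :: "nat \<Rightarrow> ennreal" and r :: "nat \<Rightarrow> real" and F
    assume "F \<in> fun_space M N" and r: "\<forall>k. 0 < r k" and w: "(\<Sum>k. w k) \<le> 1"
    then have F [measurable]: "F \<in> borel_measurable M" and NF: "N F < top"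
      unfolding fun_space_def by auto
    define E where "E x = complex_of_real (cmod (F x) powr p)" for x
    have E [measurable]: "E \<in> borel_measurable M" unfolding E_def by measurable
    have "(\<lambda>x. complex_of_real (cmod (E x) powr (1 / p))) = (\<lambda>x. complex_of_real (cmod (F x)))"
      unfolding E_def using p_pos by (simp add: powr_powr)
    then have ZE: "?Z E = ennpowr (N F) p"
      unfolding power_norm_def using RN_cmod[OF F] by simp
    then have EZ: "E \<in> fun_space M ?Z" unfolding fun_space_def using NF by (simp add: less_top[symmetric])
    note bound[THEN spec, THEN spec, THEN bspec, OF EZ, THEN mp, OF r, THEN mp, OF w]
    then obtain G0 :: "'a \<Rightarrow> real" where G0 [measurable]: "G0 \<in> borel_measurable M" and G0_0: "\<forall>x. 0 \<le> G0 x"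
      and ZG0: "?Z (\<lambda>x. complex_of_real (G0 x)) \<le> ennreal D * ?Z E"
      and avg: "AE x in M. (\<Sum>k. w k * avg x (r k) (\<lambda>y. ennreal (cmod (E y)))) \<le> ennreal (G0 x)"
      by (elim exE conjE)
    define G where "G x = 2 powr (1 / q) * G0 x powr (1 / p)" for x
    have G [measurable]: "G \<in> borel_measurable M" unfolding G_def by measurable
    have "ennpowr (RN (\<lambda>x. G0 x powr (1 / p))) p \<le> ennreal D * ennpowr (N F) p"
      using ZG0 G0_0 unfolding ZE by (simp add: power_norm_def)
    also have "\<dots> = ennpowr (ennreal (D powr (1 / p)) * N F) p"
      using D p_pos by (subst ennpowr_cmult) (simp_all add: powr_powr)
    finally have "RN (\<lambda>x. G0 x powr (1 / p)) \<le> ennreal (D powr (1 / p)) * N F"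
      using ennpowr_le_iff[OF p_pos] by blast
    then have "ennreal (2 powr (1 / q)) * RN (\<lambda>x. G0 x powr (1 / p)) \<le> ennreal (2 powr (1 / q)) * (ennreal (D powr (1 / p)) * N F)"
      by (intro mult_left_mono) auto
    also have "\<dots> = ennreal C * N F" unfolding C_def by (simp add: ennreal_mult mult.assoc)
    also have "ennreal (2 powr (1 / q)) * RN (\<lambda>x. G0 x powr (1 / p)) = RN G"
      unfolding G_def by (rule RN_scale[symmetric]) auto
    finally have RNG: "RN G \<le> ennreal C * N F" .
    have G_powr: "G x powr q = 2 * (G0 x powr (1 / p)) powr q" for x
      unfolding G_def using q_pos by (simp add: powr_mult powr_powr)
    have "AE x in M. (\<Sum>k. w k * avg x (r k) (mod_powr q F)) \<le> ennreal (G x powr q)"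
      using avg
    proof (rule AE_mp, intro AE_I2 impI)
      fix x assume x: "x \<in> space M"
        and "(\<Sum>k. w k * avg x (r k) (\<lambda>y. ennreal (cmod (E y)))) \<le> ennreal (G0 x)"
      then have le: "(\<Sum>k. w k * avg x (r k) (mod_powr p F)) \<le> ennreal (G0 x)"
        unfolding E_def by simp
      let ?S = "\<Sum>k. w k * avg x (r k) (mod_powr q F)"
      have main: "?S \<le> ennreal (2 * l powr q)" if "0 < l" "G0 x \<le> l powr p" for l
        by (rule weighted_averages_power_le[OF x r[rule_format] w F q_pos q_le_p that(1)])
           (rule order_trans[OF le ennreal_leI[OF that(2)]])
      show "?S \<le> ennreal (G x powr q)"
      proof (cases "G0 x = 0")
        case False
        then show ?thesis unfolding G_powr using G0_0[rule_format, of x] p_pos by (intro main) (simp_all add: powr_powr)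
      next
        case True
        \<comment> \<open>Here the natural choice \<open>\<lambda> = 0\<close> is excluded, but every positive \<open>\<lambda>\<close> is allowed.\<close>
        have "?S \<le> 0 + ennreal e" if "0 < e" for e
        proof -
          have "?S \<le> ennreal (2 * ((e / 2) powr (1 / q)) powr q)"
            by (rule main) (use that True in simp_all)
          then show ?thesis using that q_pos by (simp add: powr_powr)
        qed
        then have "?S \<le> 0" by (rule ennreal_le_epsilon)
        then show ?thesis by simp
      qed
    qed
    then show "\<exists>G::'a \<Rightarrow> real. G \<in> borel_measurable M \<and> (\<forall>x. 0 \<le> G x) \<and> RN G \<le> ennreal C * N F \<and>
        (AE x in M. (\<Sum>k. w k * avg x (r k) (mod_powr q F)) \<le> ennreal (G x powr q))"
      using G RNG by (intro exI[of _ G] conjI) (simp_all add: G_def)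
  qed
qed

end

section \<open>Integrals of the kernel\<close>

lemma suminf_geometric_ennreal:
  assumes "0 \<le> a" "0 \<le> w" "w < 1"
  shows "(\<Sum>k. ennreal (a * w ^ k)) = ennreal (a / (1 - w))"
proof (rule suminf_ennreal_eq)
  show "0 \<le> a * w ^ i" for i using assms by simp
  have "(\<lambda>k. w ^ k) sums (1 / (1 - w))" using geometric_sums[of w] assms by simp
  from sums_mult[OF this, of a] show "(\<lambda>k. a * w ^ k) sums (a / (1 - w))" by simp
qed

lemma dyadic_bracket:
  fixes t :: real
  assumes "1 \<le> t"
  obtains k :: nat where "2 ^ k \<le> t" "t < 2 ^ Suc k"
proof -
  define n where "n = (LEAST n. t < 2 ^ n)"
  obtain m where "t < 2 ^ m" using real_arch_pow[of 2 t] by auto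
  then have n: "t < 2 ^ n" unfolding n_def by (rule LeastI)
  have "n \<noteq> 0"
  proof
    assume "n = 0" then show False using n assms by simp
  qed
  then obtain k where k: "n = Suc k" by (cases n) auto
  have "\<not> t < 2 ^ k" using not_less_Least[of k "\<lambda>n. t < 2 ^ n"] k unfolding n_def[symmetric] by simp
  then show ?thesis using that[of k] n k by simp
qed

lemma powr_minus_power_swap:
  fixes b u :: real
  assumes "0 < b" shows "(b powr - u) ^ k = (b ^ k) powr - u"
proof -
  have "(b powr - u) ^ k = (b powr - u) powr real k" using assms by (simp add: powr_realpow)
  also have "\<dots> = (b powr real k) powr - u" unfolding powr_powr by (simp add: mult.commute)
  also have "b powr real k = b ^ k" using assms by (simp add: powr_realpow)
  finally show ?thesis .
qed

lemma one_minus_powr_bounds: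
  fixes b u :: real
  assumes "1 < b" "0 < u"
  shows "1 - b powr - u \<le> u * ln b" "u * ln b / (1 + u * ln b) \<le> 1 - b powr - u"
proof -
  define t where "t = u * ln b"
  have t: "0 < t" unfolding t_def using assms by simp
  have e: "b powr - u = exp (- t)" unfolding powr_def t_def using assms by simp
  have "1 + (- t) \<le> exp (- t)" by (rule exp_ge_add_one_self)
  then show "1 - b powr - u \<le> u * ln b" unfolding e t_def by linarith
  have "1 + t \<le> exp t" by (rule exp_ge_add_one_self)
  then have "exp (- t) \<le> 1 / (1 + t)" unfolding exp_minus using t by (simp add: inverse_eq_divide frac_le)
  moreover have "1 - 1 / (1 + t) = t / (1 + t)" using t by (simp add: field_simps)
  ultimately show "u * ln b / (1 + u * ln b) \<le> 1 - b powr - u" unfolding e t_def[symmetric] by linarith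
qed

context homogeneous_space
begin

text \<open>
  The kernel of the Gagliardo integral with \<open>U(x,y)\<close> replaced by the comparable
  \<open>V(x,\<rho>(x,y))\<close>, which is measurable in \<open>y\<close>. As \<open>V(x,0) = 0\<close>
  and \<open>1/0 = 0\<close>, its value at \<open>y = x\<close> is \<open>0\<close>.
\<close>
definition kern :: "real \<Rightarrow> 'a \<Rightarrow> 'a \<Rightarrow> real" where
  "kern \<sigma> x y = 1 / (V x (\<rho> x y) * \<rho> x y powr \<sigma>)"

lemma kern_nonneg [simp]: "0 \<le> kern \<sigma> x y"
  unfolding kern_def by simp

lemma rho_measurable [measurable]: "x \<in> space M \<Longrightarrow> \<rho> x \<in> borel_measurable M"
proof (rule borel_measurable_iff_less[THEN iffD2], intro allI)
  fix r assume "x \<in> space M"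
  then show "{y \<in> space M. \<rho> x y < r} \<in> sets M" using ball_sets[of x r] by (simp add: qball_def)
qed

lemma V_radius_measurable [measurable]: "x \<in> space M \<Longrightarrow> V x \<in> borel_measurable borel"
  by (rule borel_measurable_mono) (auto intro!: monoI V_mono)

lemma kern_measurable [measurable]:
  assumes "x \<in> space M" shows "kern \<sigma> x \<in> borel_measurable M"
proof -
  have [measurable]: "\<rho> x \<in> borel_measurable M" by (rule rho_measurable[OF assms])
  have [measurable]: "V x \<in> borel_measurable borel" by (rule V_radius_measurable[OF assms])
  show ?thesis unfolding kern_def by measurable
qed

text \<open>
  The part of the kernel at distance at least \<open>1\<close> is a superposition of averages: the
  dyadic shell at distance about \<open>2\<^sup>k\<close> contributes the average over \<open>B(x,
  2\<^sup>k\<^sup>+\<^sup>1)\<close> with weight \<open>2\<^sup>-\<^sup>k\<^sup>\<sigma>\<close>.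
\<close>
lemma far_kernel_le_averages:
  assumes x: "x \<in> space M" and H [measurable]: "H \<in> borel_measurable M" and \<sigma>: "0 < \<sigma>"
  shows "(\<integral>\<^sup>+y\<in>space M - B x 1. H y * ennreal (kern \<sigma> x y) \<partial>M)
    \<le> (\<Sum>k. ennreal (L * (2 powr - \<sigma>) ^ k) * avg x (2 ^ Suc k) H)"
proof -
  have [measurable]: "B x r \<in> sets M" for r by (rule ball_sets[OF x])
  have [measurable]: "kern \<sigma> x \<in> borel_measurable M" by (rule kern_measurable[OF x])
  define c where "c k = L * (2 powr - \<sigma>) ^ k / V x (2 ^ Suc k)" for k
  have Vp: "0 < V x (2 ^ k)" for k :: nat by (rule V_pos[OF x]) simp
  have c0: "0 \<le> c k" for k unfolding c_def using L1 by simp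
  have "(\<integral>\<^sup>+y\<in>space M - B x 1. H y * ennreal (kern \<sigma> x y) \<partial>M)
      \<le> (\<integral>\<^sup>+y. (\<Sum>k. ennreal (c k) * (H y * indicator (B x (2 ^ Suc k)) y)) \<partial>M)"
  proof (rule nn_integral_mono)
    fix y assume y: "y \<in> space M"
    show "H y * ennreal (kern \<sigma> x y) * indicator (space M - B x 1) y
        \<le> (\<Sum>k. ennreal (c k) * (H y * indicator (B x (2 ^ Suc k)) y))"
    proof (cases "y \<in> B x 1")
      case False
      then have "1 \<le> \<rho> x y" using y by (simp add: mem_ball)
      then obtain k where k: "2 ^ k \<le> \<rho> x y" "\<rho> x y < 2 ^ Suc k" by (rule dyadic_bracket)
      have "V x (2 ^ Suc k) \<le> L * V x (2 ^ k)" using V_double[OF x, of "2 ^ k"] by simp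
      also have "\<dots> \<le> L * V x (\<rho> x y)" using V_mono[OF x k(1)] L1 by (intro mult_left_mono) auto
      finally have V: "V x (2 ^ Suc k) / L \<le> V x (\<rho> x y)" using L1 by (simp add: divide_le_eq mult.commute)
      have P: "(2 ^ k) powr \<sigma> \<le> \<rho> x y powr \<sigma>" using k(1) \<sigma> by (intro powr_mono2) auto
      have VP: "V x (2 ^ Suc k) / L * (2 ^ k) powr \<sigma> \<le> V x (\<rho> x y) * \<rho> x y powr \<sigma>"
        by (rule mult_mono[OF V P]) auto
      have pos: "0 < V x (2 ^ Suc k) / L * (2 ^ k) powr \<sigma>" using Vp[of "Suc k"] L1 by simp
      have "kern \<sigma> x y \<le> 1 / (V x (2 ^ Suc k) / L * (2 ^ k) powr \<sigma>)"
        unfolding kern_def by (rule frac_le[OF _ _ pos VP]) simp_all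
      also have "\<dots> = c k"
      proof -
        have "(2 powr - \<sigma>) ^ k = 1 / (2 ^ k) powr \<sigma>"
          unfolding powr_minus_power_swap[of 2 \<sigma> k, OF zero_less_numeral] by (rule powr_minus_divide)
        then show ?thesis unfolding c_def by simp
      qed
      finally have "kern \<sigma> x y \<le> c k" .
      then have "H y * ennreal (kern \<sigma> x y) \<le> H y * ennreal (c k)"
        by (intro mult_left_mono ennreal_leI) auto
      also have "\<dots> = (\<Sum>j\<in>{k}. ennreal (c j) * (H y * indicator (B x (2 ^ Suc j)) y))"
        using k(2) y by (simp add: mem_ball mult.commute)
      also have "\<dots> \<le> (\<Sum>k. ennreal (c k) * (H y * indicator (B x (2 ^ Suc k)) y))"
        by (rule sum_le_suminf[OF summableI]) auto
      finally show ?thesis using False y by simp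
    qed simp
  qed
  also have "\<dots> = (\<Sum>k. ennreal (c k) * (\<integral>\<^sup>+y\<in>B x (2 ^ Suc k). H y \<partial>M))"
    by (subst nn_integral_suminf) (measurable, simp add: nn_integral_cmult)
  also have "\<dots> = (\<Sum>k. ennreal (L * (2 powr - \<sigma>) ^ k) * avg x (2 ^ Suc k) H)"
  proof (rule arg_cong[where f = suminf], rule ext)
    fix k
    have "ennreal (c k) = ennreal (L * (2 powr - \<sigma>) ^ k) * ennreal (1 / V x (2 ^ Suc k))"
      unfolding c_def using L1 by (subst ennreal_mult[symmetric]) auto
    then show "ennreal (c k) * (\<integral>\<^sup>+y\<in>B x (2 ^ Suc k). H y \<partial>M) = ennreal (L * (2 powr - \<sigma>) ^ k) * avg x (2 ^ Suc k) H"
      unfolding emeasure_ball[OF x] divide_ennreal_pos[OF Vp] by (simp only: mult.assoc)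
  qed
  finally show ?thesis .
qed

text \<open>
  Since \<open>\<Sum>\<^sub>k 2\<^sup>-\<^sup>k\<^sup>s\<^sup>q\<close> is comparable to
  \<open>1/s\<close>, multiplication by \<open>s\<close> normalises the weights. This is where the
  factor \<open>s\<^sup>1\<^sup>/\<^sup>q\<close> of the theorem comes from.
\<close>
lemma far_kernel_le_normalised_averages:
  assumes "0 < q"
  shows "\<exists>C::real>0. \<forall>s. 0 < s \<and> s < 1 \<longrightarrow> (\<forall>x\<in>space M. \<forall>H\<in>borel_measurable M.
    ennreal s * (\<integral>\<^sup>+y\<in>space M - B x 1. H y * ennreal (kern (s * q) x y) \<partial>M)
    \<le> ennreal C * (\<Sum>k. ennreal ((1 - 2 powr - (s * q)) * (2 powr - (s * q)) ^ k) *
        avg x (2 ^ Suc k) H))"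
proof -
  define b where "b = q * ln 2"
  have b: "0 < b" unfolding b_def using assms by simp
  define C where "C = L * ((1 + b) / b)"
  have C: "0 < C" unfolding C_def using b L1 by simp
  show ?thesis
  proof (intro exI[of _ C] conjI allI impI ballI C)
    fix s :: real and x and H :: "'a \<Rightarrow> ennreal"
    assume s: "0 < s \<and> s < 1" and x: "x \<in> space M" and H: "H \<in> borel_measurable M"
    define w where "w = 2 powr - (s * q)"
    have "s * b / (1 + s * b) \<le> 1 - w"
      using one_minus_powr_bounds(2)[of 2 "s * q"] s assms unfolding w_def b_def by (simp add: mult.assoc)
    moreover have "s * b / (1 + b) \<le> s * b / (1 + s * b)"
    proof (rule frac_le)
      show "1 + s * b \<le> 1 + b" using s b by simp
      show "0 < 1 + s * b" using s b by (simp add: add_pos_pos)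
    qed (use s b in auto)
    ultimately have "s * b / (1 + b) \<le> 1 - w" by linarith
    then have "s * b \<le> (1 - w) * (1 + b)" using b by (simp add: divide_le_eq)
    then have sw: "s \<le> (1 + b) / b * (1 - w)" using b by (simp add: pos_le_divide_eq mult.commute)
    let ?A = "\<lambda>k. avg x (2 ^ Suc k) H"
    have w0: "0 \<le> w" unfolding w_def by simp
    have "ennreal s * (\<integral>\<^sup>+y\<in>space M - B x 1. H y * ennreal (kern (s * q) x y) \<partial>M)
        \<le> ennreal s * (\<Sum>k. ennreal (L * w ^ k) * ?A k)"
      unfolding w_def by (intro mult_left_mono far_kernel_le_averages[OF x H]) (use s assms in auto)
    also have "\<dots> = (\<Sum>k. ennreal s * (ennreal (L * w ^ k) * ?A k))" by (rule ennreal_suminf_cmult[symmetric])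
    also have "\<dots> \<le> (\<Sum>k. ennreal C * (ennreal ((1 - w) * w ^ k) * ?A k))"
    proof (intro suminf_le summableI)
      fix k
      have "s * (L * w ^ k) \<le> (1 + b) / b * (1 - w) * (L * w ^ k)"
        using sw L1 w0 by (intro mult_right_mono) auto
      also have "\<dots> = C * ((1 - w) * w ^ k)" unfolding C_def by (simp add: mult_ac)
      finally have *: "s * (L * w ^ k) \<le> C * ((1 - w) * w ^ k)" .
      have "ennreal s * ennreal (L * w ^ k) = ennreal (s * (L * w ^ k))"
        using s L1 w0 by (intro ennreal_mult[symmetric]) auto
      also have "\<dots> \<le> ennreal (C * ((1 - w) * w ^ k))" by (rule ennreal_leI[OF *])
      also have "\<dots> = ennreal C * ennreal ((1 - w) * w ^ k)" using C by (intro ennreal_mult') auto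
      finally show "ennreal s * (ennreal (L * w ^ k) * ?A k) \<le> ennreal C * (ennreal ((1 - w) * w ^ k) * ?A k)"
        unfolding mult.assoc[symmetric] by (intro mult_right_mono) auto
    qed
    also have "\<dots> = ennreal C * (\<Sum>k. ennreal ((1 - w) * w ^ k) * ?A k)" by (rule ennreal_suminf_cmult)
    finally show "ennreal s * (\<integral>\<^sup>+y\<in>space M - B x 1. H y * ennreal (kern (s * q) x y) \<partial>M)
      \<le> ennreal C * (\<Sum>k. ennreal ((1 - 2 powr - (s * q)) * (2 powr - (s * q)) ^ k) * ?A k)"
      unfolding w_def .
  qed
qed

lemma normalised_weights: "0 < u \<Longrightarrow> (\<Sum>k. ennreal ((1 - 2 powr - u) * (2 powr - u) ^ k)) = 1"
  for u :: real
proof -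
  assume u: "0 < u"
  have w: "2 powr - u < (1::real)" using powr_less_mono[of "- u" 0 2] u by simp
  then have "(\<Sum>k. ennreal ((1 - 2 powr - u) * (2 powr - u) ^ k)) = ennreal ((1 - 2 powr - u) / (1 - 2 powr - u))"
    by (intro suminf_geometric_ennreal) auto
  then show ?thesis using w u by simp
qed

section \<open>The mass of the kernel far away\<close>

text \<open>
  Reverse doubling forces \<open>\<mu>(B(x,r))\<close> to be a small fraction of
  \<open>\<mu>(B(x,\<Lambda>r))\<close> for \<open>\<Lambda>\<close> large, so that the density of
  \<open>\<Omega>\<close> in large balls passes to large annuli. The two conditions may refer to
  different centres, which does not matter at large scales.
\<close>
lemma annulus_density:
  assumes wrd: "weak_reverse_doubling M \<rho>" and wmd: "weak_measure_density M \<rho> \<Omega>"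
    and \<Omega> [measurable]: "\<Omega> \<in> sets M"
  shows "\<exists>x0\<in>space M. \<exists>\<Lambda>>1. \<exists>c>0. \<exists>r0>0. \<forall>r\<ge>r0.
    ennreal (c * V x0 (\<Lambda> * r)) \<le> emeasure M (\<Omega> \<inter> (B x0 (\<Lambda> * r) - B x0 r))"
proof -
  obtain x0 C0 where x0: "x0 \<in> space M" and C0: "0 < (C0::real)"
    and LI0: "ennreal C0 \<le> Liminf at_top (\<lambda>r::real. emeasure M (B x0 r \<inter> \<Omega>) / emeasure M (B x0 r))"
    using wmd unfolding weak_measure_density_def by blast
  obtain x1 l C where x1: "x1 \<in> space M" and l: "1 < (l::real)" and C: "1 < (C::real)"
    and LI1: "ennreal C \<le> Liminf at_top (\<lambda>r::real. emeasure M (B x1 (l * r)) / emeasure M (B x1 r))"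
    using wrd unfolding weak_reverse_doubling_def by blast
  have [measurable]: "B x0 r \<in> sets M" for r by (rule ball_sets[OF x0])
  have "ennreal (C0 / 2) < ennreal C0" using C0 by (simp add: ennreal_less_iff)
  then have "\<forall>\<^sub>F r in at_top. ennreal (C0 / 2) < emeasure M (B x0 r \<inter> \<Omega>) / emeasure M (B x0 r)"
    using LI0 unfolding le_Liminf_iff by blast
  then obtain R0 where R0: "\<forall>r\<ge>R0. ennreal (C0 / 2) < emeasure M (B x0 r \<inter> \<Omega>) / emeasure M (B x0 r)"
    unfolding eventually_at_top_linorder by blast
  \<comment> \<open>The lower limit is at least \<open>C\<close>, which guarantees the growth rate \<open>a < C\<close>, but not \<open>C\<close> itself, at all large radii.\<close>
  define a where "a = (1 + C) / 2"
  have a: "1 < a" "a < C" unfolding a_def using C by auto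
  have "ennreal a < ennreal C" using a by (simp add: ennreal_less_iff)
  then have "\<forall>\<^sub>F r in at_top. ennreal a < emeasure M (B x1 (l * r)) / emeasure M (B x1 r)"
    using LI1 unfolding le_Liminf_iff by blast
  then obtain R1 where R1: "\<forall>r\<ge>R1. ennreal a < emeasure M (B x1 (l * r)) / emeasure M (B x1 r)"
    unfolding eventually_at_top_linorder by blast
  have dens: "ennreal (C0 / 2 * V x0 r) \<le> emeasure M (B x0 r \<inter> \<Omega>)" if "R0 \<le> r" "0 < r" for r
  proof -
    have v: "0 < V x0 r" by (rule V_pos[OF x0 that(2)])
    have "ennreal (C0 / 2) \<le> ennreal (1 / V x0 r) * emeasure M (B x0 r \<inter> \<Omega>)"
      using R0[rule_format, OF that(1)] unfolding emeasure_ball[OF x0] divide_ennreal_pos[OF v] by (rule less_imp_le)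
    from mult_left_mono[OF this, of "ennreal (V x0 r)"]
    have "ennreal (V x0 r) * ennreal (C0 / 2) \<le> (ennreal (V x0 r) * ennreal (1 / V x0 r)) * emeasure M (B x0 r \<inter> \<Omega>)"
      by (simp only: mult.assoc zero_le)
    moreover have "ennreal (V x0 r) * ennreal (1 / V x0 r) = 1" using v by (simp add: ennreal_mult[symmetric])
    moreover have "ennreal (V x0 r) * ennreal (C0 / 2) = ennreal (C0 / 2 * V x0 r)"
      using v C0 by (subst ennreal_mult[symmetric]) (auto simp: mult.commute)
    ultimately show ?thesis by simp
  qed
  have grow: "a * V x1 r \<le> V x1 (l * r)" if "R1 \<le> r" "0 < r" for r
  proof -
    have v: "0 < V x1 r" by (rule V_pos[OF x1 that(2)])
    have "ennreal a \<le> ennreal (1 / V x1 r) * ennreal (V x1 (l * r))"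
      using R1[rule_format, OF that(1)] unfolding emeasure_ball[OF x1] divide_ennreal_pos[OF v] by (rule less_imp_le)
    also have "\<dots> = ennreal (1 / V x1 r * V x1 (l * r))" using v by (intro ennreal_mult[symmetric]) auto
    finally have "a \<le> 1 / V x1 r * V x1 (l * r)"
      using v by (subst (asm) ennreal_le_iff) auto
    then show ?thesis using v by (simp add: field_simps)
  qed
  have grow_pow: "a ^ m * V x1 r \<le> V x1 (l ^ m * r)" if "R1 \<le> r" "0 < r" for r m
  proof (induction m)
    case (Suc m)
    have lm: "1 \<le> l ^ m" using l by simp
    have "r \<le> l ^ m * r" using mult_right_mono[OF lm, of r] that by simp
    then have "a * V x1 (l ^ m * r) \<le> V x1 (l * (l ^ m * r))"
      using that \<open>r \<le> l ^ m * r\<close> by (intro grow) linarith+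
    moreover have "a * (a ^ m * V x1 r) \<le> a * V x1 (l ^ m * r)" using Suc a by (intro mult_left_mono) auto
    ultimately show ?case by (simp add: mult.assoc)
  qed simp
  obtain m where m: "4 / C0 < a ^ m" using real_arch_pow[OF a(1)] by blast
  define d where "d = \<rho> x1 x0"
  have d: "0 \<le> d" unfolding d_def by (rule rho_nonneg[OF x1 x0])
  define \<Lambda> where "\<Lambda> = K * (1 + l ^ m * (2 * K))"
  have lm: "1 \<le> l ^ m" using l by simp
  have "1 * 2 \<le> l ^ m * (2 * K)" by (rule mult_mono[OF lm]) (use K1 lm in auto)
  then have lm2: "2 \<le> l ^ m * (2 * K)" by simp
  have "1 + l ^ m * (2 * K) \<le> \<Lambda>" unfolding \<Lambda>_def using mult_right_mono[OF K1, of "1 + l ^ m * (2 * K)"] lm2 by simp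
  then have \<Lambda>: "1 < \<Lambda>" using lm2 by linarith
  define r0 where "r0 = max (max R0 R1) (max d 1)"
  have "ennreal (C0 / 4 * V x0 (\<Lambda> * r)) \<le> emeasure M (\<Omega> \<inter> (B x0 (\<Lambda> * r) - B x0 r))" if r: "r0 \<le> r" for r
  proof -
    have r': "R0 \<le> r" "R1 \<le> r" "d \<le> r" "0 < r" using r unfolding r0_def by auto
    have r\<Lambda>: "r \<le> \<Lambda> * r" using \<Lambda> r' by simp
    have r2K: "r \<le> 2 * K * r" using K1 r' by simp
    have "V x0 r \<le> V x1 (2 * K * r)"
    proof (rule V_mono_ball[OF x0 x1])
      have "B x0 r \<subseteq> B x1 (K * (r + r))" by (rule ball_subset[OF x0 x1]) (use r' d_def in simp)
      then show "B x0 r \<subseteq> B x1 (2 * K * r)" by (simp add: mult_ac flip: mult_2)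
    qed
    then have "4 / C0 * V x0 r \<le> a ^ m * V x1 (2 * K * r)"
      using m a(1) by (intro mult_mono) auto
    also have "\<dots> \<le> V x1 (l ^ m * (2 * K * r))" by (rule grow_pow) (use r' r2K in linarith)+
    also have "\<dots> \<le> V x0 (\<Lambda> * r)"
    proof (rule V_mono_ball[OF x1 x0])
      have "B x1 (l ^ m * (2 * K * r)) \<subseteq> B x0 (K * (r + l ^ m * (2 * K * r)))"
        by (rule ball_subset[OF x1 x0]) (use r' d_def rho_sym[OF x1 x0] in simp)
      moreover have "K * (r + l ^ m * (2 * K * r)) = \<Lambda> * r" unfolding \<Lambda>_def by (simp add: algebra_simps)
      ultimately show "B x1 (l ^ m * (2 * K * r)) \<subseteq> B x0 (\<Lambda> * r)" by simp
    qed
    finally have small: "V x0 r \<le> C0 / 4 * V x0 (\<Lambda> * r)" using C0 by (simp add: field_simps)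
    have "ennreal (C0 / 2 * V x0 (\<Lambda> * r)) \<le> emeasure M (B x0 (\<Lambda> * r) \<inter> \<Omega>)"
      by (rule dens) (use r' r\<Lambda> in linarith)+
    also have "\<dots> \<le> emeasure M (\<Omega> \<inter> (B x0 (\<Lambda> * r) - B x0 r) \<union> B x0 r)"
      by (intro emeasure_mono) auto
    also have "\<dots> \<le> emeasure M (\<Omega> \<inter> (B x0 (\<Lambda> * r) - B x0 r)) + emeasure M (B x0 r)"
      by (intro emeasure_subadditive) auto
    also have "\<dots> \<le> emeasure M (\<Omega> \<inter> (B x0 (\<Lambda> * r) - B x0 r)) + ennreal (C0 / 4 * V x0 (\<Lambda> * r))"
      unfolding emeasure_ball[OF x0] by (intro add_left_mono ennreal_leI small)
    finally have "ennreal (C0 / 4 * V x0 (\<Lambda> * r)) + ennreal (C0 / 4 * V x0 (\<Lambda> * r))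
        \<le> ennreal (C0 / 4 * V x0 (\<Lambda> * r)) + emeasure M (\<Omega> \<inter> (B x0 (\<Lambda> * r) - B x0 r))"
      using C0 by (simp add: add.commute flip: ennreal_plus)
    then show ?thesis by (subst (asm) ennreal_add_left_cancel_le) auto
  qed
  moreover have "0 < r0" unfolding r0_def by simp
  moreover have "0 < C0 / 4" using C0 by simp
  ultimately show ?thesis using x0 \<Lambda> by blast
qed

text \<open>
  The annuli \<open>B(x\<^sub>0,\<Lambda>\<^sup>j\<^sup>+\<^sup>1R') -
  B(x\<^sub>0,\<Lambda>\<^sup>jR')\<close> meet \<open>\<Omega>\<close> in a fixed proportion, and seen
  from a point of \<open>B(x\<^sub>0,R)\<close> they contribute at least a multiple of
  \<open>(\<Lambda>\<^sup>jR')\<^sup>-\<^sup>s\<^sup>q\<close> each. The geometric series is of order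
  \<open>R'\<^sup>-\<^sup>s\<^sup>q/s\<close>, and \<open>R'\<^sup>-\<^sup>s\<^sup>q\<close> is close to
  \<open>1\<close> for small \<open>s\<close>. This is why \<open>c\<close> can be chosen before
  \<open>R\<close>.
\<close>
lemma kernel_mass_lower_bound:
  assumes wrd: "weak_reverse_doubling M \<rho>" and wmd: "weak_measure_density M \<rho> \<Omega>"
    and \<Omega> [measurable]: "\<Omega> \<in> sets M" and q: "0 < q"
  shows "\<exists>x0\<in>space M. \<exists>c>0. \<forall>R. \<exists>R'\<ge>R. \<exists>s1>0.
    (\<forall>x\<in>B x0 R. \<forall>y\<in>space M - B x0 R'. 1 \<le> \<rho> x y) \<and>
    (\<forall>s. 0 < s \<and> s < s1 \<longrightarrow> (\<forall>x\<in>B x0 R.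
      ennreal c \<le> ennreal s * (\<integral>\<^sup>+y\<in>\<Omega> - B x0 R'. ennreal (kern (s * q) x y) \<partial>M)))"
proof -
  obtain x0 \<Lambda> c0 r0 where x0: "x0 \<in> space M" and \<Lambda>: "1 < (\<Lambda>::real)" and c0: "0 < (c0::real)" and r0: "0 < (r0::real)"
    and ann: "\<forall>r\<ge>r0. ennreal (c0 * V x0 (\<Lambda> * r)) \<le> emeasure M (\<Omega> \<inter> (B x0 (\<Lambda> * r) - B x0 r))"
    using annulus_density[OF wrd wmd \<Omega>] by blast
  obtain D where D: "1 \<le> (D::real)"
    "\<forall>x\<in>space M. \<forall>y\<in>space M. \<forall>r>0. \<rho> x y \<le> 2 * K * r \<longrightarrow> V x (2 * K * r) \<le> D * V y r"
    using V_compare[of "2 * K"] by blast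
  have [measurable]: "B x0 r \<in> sets M" for r by (rule ball_sets[OF x0])
  define c where "c = c0 / (2 * D * q * ln \<Lambda>)"
  have ln\<Lambda>: "0 < ln \<Lambda>" using \<Lambda> by simp
  have c: "0 < c" unfolding c_def using c0 D(1) q ln\<Lambda> by simp
  have "\<exists>R'\<ge>R. \<exists>s1>0. (\<forall>x\<in>B x0 R. \<forall>y\<in>space M - B x0 R'. 1 \<le> \<rho> x y) \<and>
    (\<forall>s. 0 < s \<and> s < s1 \<longrightarrow> (\<forall>x\<in>B x0 R.
      ennreal c \<le> ennreal s * (\<integral>\<^sup>+y\<in>\<Omega> - B x0 R'. ennreal (kern (s * q) x y) \<partial>M)))" for R
  proof -
    define R' where "R' = max (max r0 R) (max (K * (R + 1)) 1)"
    have R': "r0 \<le> R'" "R \<le> R'" "K * (R + 1) \<le> R'" "1 \<le> R'" unfolding R'_def by auto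
    define A where "A = 2 * K * (\<Lambda> * R')"
    have "2 \<le> 2 * K" using K1 by simp
    moreover have "1 \<le> \<Lambda> * R'" using mult_mono[of 1 \<Lambda> 1 R'] \<Lambda> R' by simp
    ultimately have A: "2 \<le> A" unfolding A_def using mult_mono[of 2 "2 * K" 1 "\<Lambda> * R'"] by simp
    \<comment> \<open>For \<open>s < s1\<close> the factor \<open>A\<^sup>-\<^sup>s\<^sup>q\<close> is at least \<open>1/2\<close>.\<close>
    define s1 where "s1 = ln 2 / (q * ln A)"
    have lnA: "0 < ln A" using A by simp
    have s1: "0 < s1" unfolding s1_def using q lnA by simp
    have far: "1 \<le> \<rho> x y" if x: "x \<in> B x0 R" and y: "y \<in> space M - B x0 R'" for x y
    proof (rule ccontr)
      assume "\<not> 1 \<le> \<rho> x y"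
      then have "K * (\<rho> x0 x + \<rho> x y) < K * (R + 1)"
        using x K1 by (intro mult_strict_left_mono add_strict_mono) (auto simp: mem_ball)
      moreover have "\<rho> x0 y \<le> K * (\<rho> x0 x + \<rho> x y)" using x y x0 by (intro rho_triangle) (auto simp: mem_ball)
      moreover have "R' \<le> \<rho> x0 y" using y by (auto simp: mem_ball)
      ultimately show False using R' by linarith
    qed
    have "ennreal c \<le> ennreal s * (\<integral>\<^sup>+y\<in>\<Omega> - B x0 R'. ennreal (kern (s * q) x y) \<partial>M)"
      if s: "0 < s" "s < s1" and x: "x \<in> B x0 R" for s x
    proof -
      have xM: "x \<in> space M" and xR: "\<rho> x0 x < R" using x by (auto simp: mem_ball)
      have [measurable]: "kern (s * q) x \<in> borel_measurable M" by (rule kern_measurable[OF xM])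
      define t where "t j = \<Lambda> * (\<Lambda> ^ j * R')" for j :: nat
      define S where "S j = \<Omega> \<inter> (B x0 (t j) - B x0 (\<Lambda> ^ j * R'))" for j
      have S [measurable]: "S j \<in> sets M" for j unfolding S_def by measurable
      have R'j: "R' \<le> \<Lambda> ^ j * R'" for j using \<Lambda> R' by simp
      have t: "R' \<le> t j" for j
      proof -
        have "0 \<le> \<Lambda> ^ j * R'" using \<Lambda> R' by simp
        then have "1 * (\<Lambda> ^ j * R') \<le> \<Lambda> * (\<Lambda> ^ j * R')" using \<Lambda> by (intro mult_right_mono) auto
        then show ?thesis unfolding t_def using R'j[of j] by linarith
      qed
      have t0: "0 < t j" for j using t[of j] R' by linarith
      define w where "w = \<Lambda> powr - (s * q)"
      have w: "0 < w" "w < 1" unfolding w_def using powr_less_mono[of "- (s * q)" 0 \<Lambda>] \<Lambda> s q by auto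
      have tK: "2 * K * t j = A * \<Lambda> ^ j" for j unfolding t_def A_def by (simp add: mult_ac)
      define e where "e = c0 / D * A powr - (s * q)"
      have e: "0 < e" unfolding e_def using c0 D(1) A by simp
      have shell: "ennreal (e * w ^ j) \<le> (\<integral>\<^sup>+y\<in>S j. ennreal (kern (s * q) x y) \<partial>M)" for j
      proof -
        define k where "k = 1 / (D * V x0 (t j) * (2 * K * t j) powr (s * q))"
        have v: "0 < V x0 (t j)" by (rule V_pos[OF x0 t0])
        have k0: "0 \<le> k" unfolding k_def using D(1) v by simp
        have xx0: "\<rho> x x0 \<le> 2 * K * t j"
        proof -
          have "t j \<le> 2 * K * t j" using K1 t0[of j] by simp
          then show ?thesis using xR rho_sym[OF xM x0] t[of j] R' by linarith
        qed
        have kern_ge: "k \<le> kern (s * q) x y" if y: "y \<in> S j" for y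
        proof -
          have yM: "y \<in> space M" and yt: "\<rho> x0 y < t j" and y_out: "y \<notin> B x0 R'"
            using y R'j[of j] by (auto simp: S_def mem_ball)
          have "1 \<le> \<rho> x y" by (rule far[OF x]) (use yM y_out in simp)
          have "\<rho> x y \<le> K * (\<rho> x x0 + \<rho> x0 y)" by (rule rho_triangle[OF xM x0 yM])
          also have "\<dots> \<le> K * (t j + t j)"
            using K1 yt xR rho_sym[OF xM x0] t[of j] R' by (intro mult_left_mono) linarith+
          finally have xy: "\<rho> x y \<le> 2 * K * t j" by (simp add: mult_2[symmetric] mult_ac)
          have "V x (\<rho> x y) \<le> V x (2 * K * t j)" by (rule V_mono[OF xM xy])
          also have "\<dots> \<le> D * V x0 (t j)" by (rule D(2)[rule_format, OF xM x0 t0 xx0])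
          finally have VV: "V x (\<rho> x y) \<le> D * V x0 (t j)" .
          have PP: "\<rho> x y powr (s * q) \<le> (2 * K * t j) powr (s * q)"
            using xy \<open>1 \<le> \<rho> x y\<close> s q by (intro powr_mono2) auto
          have pos: "0 < V x (\<rho> x y) * \<rho> x y powr (s * q)"
            using V_pos[OF xM, of "\<rho> x y"] \<open>1 \<le> \<rho> x y\<close> by simp
          show ?thesis unfolding kern_def k_def
            by (rule frac_le[OF _ _ pos mult_mono[OF VV PP]]) (use D(1) in simp_all)
        qed
        have "e * w ^ j = k * (c0 * V x0 (t j))"
        proof -
          have "w ^ j = (\<Lambda> ^ j) powr - (s * q)"
            unfolding w_def using \<Lambda> by (intro powr_minus_power_swap) simp
          then have "A powr - (s * q) * w ^ j = (2 * K * t j) powr - (s * q)"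
            unfolding tK using A \<Lambda> by (simp add: powr_mult)
          then have "e * w ^ j = c0 / D * (2 * K * t j) powr - (s * q)"
            unfolding e_def by (simp add: mult.assoc)
          also have "\<dots> = k * (c0 * V x0 (t j))"
            unfolding k_def using v D(1) by (simp add: powr_minus_divide)
          finally show ?thesis .
        qed
        also have "ennreal \<dots> = ennreal k * ennreal (c0 * V x0 (t j))"
          using k0 c0 v by (intro ennreal_mult) auto
        also have "\<dots> \<le> ennreal k * emeasure M (S j)"
        proof (rule mult_left_mono)
          have "r0 \<le> \<Lambda> ^ j * R'" using R'j[of j] R'(1) by linarith
          then show "ennreal (c0 * V x0 (t j)) \<le> emeasure M (S j)"
            using ann unfolding S_def t_def by blast
        qed simp
        also have "\<dots> = (\<integral>\<^sup>+y\<in>S j. ennreal k \<partial>M)" by (simp add: nn_integral_cmult_indicator)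
        also have "\<dots> \<le> (\<integral>\<^sup>+y\<in>S j. ennreal (kern (s * q) x y) \<partial>M)"
          by (intro nn_integral_mono) (auto simp: indicator_def intro!: ennreal_leI kern_ge)
        finally show ?thesis .
      qed
      have disj: "disjoint_family S"
      proof -
        have lt: "S i \<inter> S j = {}" if "i < j" for i j
        proof -
          have "\<Lambda> ^ Suc i \<le> \<Lambda> ^ j" using that \<Lambda> by (intro power_increasing) auto
          then have "\<Lambda> ^ Suc i * R' \<le> \<Lambda> ^ j * R'" using R'(4) by (intro mult_right_mono) auto
          then have "t i \<le> \<Lambda> ^ j * R'" unfolding t_def by (simp only: power_Suc mult.assoc)
          then have "B x0 (t i) \<subseteq> B x0 (\<Lambda> ^ j * R')" by (auto simp only: mem_ball intro: order.strict_trans2)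
          then show ?thesis unfolding S_def by blast
        qed
        show ?thesis unfolding disjoint_family_on_def
        proof (intro ballI impI)
          fix i j :: nat assume "i \<noteq> j"
          then show "S i \<inter> S j = {}" using lt[of i j] lt[of j i] by (cases "i < j") auto
        qed
      qed
      have "ennreal (e / (1 - w)) = (\<Sum>j. ennreal (e * w ^ j))"
        by (rule suminf_geometric_ennreal[symmetric]) (use e w in linarith)+
      also have "\<dots> \<le> (\<Sum>j. (\<integral>\<^sup>+y\<in>S j. ennreal (kern (s * q) x y) \<partial>M))"
        by (rule suminf_le[OF shell summableI summableI])
      also have "\<dots> = (\<integral>\<^sup>+y\<in>(\<Union>j. S j). ennreal (kern (s * q) x y) \<partial>M)"
      proof (rule nn_integral_disjoint_family[symmetric, OF _ _ disj])
        show "(\<lambda>y. ennreal (kern (s * q) x y)) \<in> borel_measurable M" by measurable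
        show "S j \<in> sets M" for j by (rule S)
      qed
      also have "\<dots> \<le> (\<integral>\<^sup>+y\<in>\<Omega> - B x0 R'. ennreal (kern (s * q) x y) \<partial>M)"
      proof (rule nn_integral_mono)
        have "B x0 R' \<subseteq> B x0 (\<Lambda> ^ j * R')" for j
          using R'j[of j] by (auto simp only: mem_ball intro: order.strict_trans2)
        then have "S j \<subseteq> \<Omega> - B x0 R'" for j unfolding S_def by blast
        then have "(\<Union>j. S j) \<subseteq> \<Omega> - B x0 R'" by (rule UN_least)
        then show "ennreal (kern (s * q) x y) * indicator (\<Union>j. S j) y \<le> ennreal (kern (s * q) x y) * indicator (\<Omega> - B x0 R') y" for y
          by (cases "y \<in> (\<Union>j. S j)") (simp_all add: subset_iff)
      qed
      finally have I: "ennreal (e / (1 - w)) \<le> (\<integral>\<^sup>+y\<in>\<Omega> - B x0 R'. ennreal (kern (s * q) x y) \<partial>M)" .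
      have "c \<le> s * (e / (1 - w))"
      proof -
        have w1: "1 - w \<le> s * q * ln \<Lambda>"
          unfolding w_def by (rule one_minus_powr_bounds(1)) (use \<Lambda> s q in auto)
        have "s * q * ln A \<le> ln 2"
        proof -
          have "s * (q * ln A) \<le> s1 * (q * ln A)" using s q lnA by (intro mult_right_mono) auto
          also have "\<dots> = ln 2" unfolding s1_def using q lnA by simp
          finally show ?thesis by (simp add: mult.assoc)
        qed
        then have "exp (- ln 2) \<le> exp (- (s * q * ln A))" by simp
        moreover have "exp (- ln 2) = (1 / 2 :: real)" by (simp add: exp_minus inverse_eq_divide)
        moreover have "A powr - (s * q) = exp (- (s * q * ln A))" unfolding powr_def using A by simp
        ultimately have "1 / 2 \<le> A powr - (s * q)" by simp
        then have "c0 / D * (1 / 2) \<le> e" unfolding e_def using c0 D(1) by (intro mult_left_mono) auto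
        then have "c0 / D * (1 / 2) / (s * q * ln \<Lambda>) \<le> e / (1 - w)"
          using w1 w e by (intro frac_le) auto
        then have "s * (c0 / D * (1 / 2) / (s * q * ln \<Lambda>)) \<le> s * (e / (1 - w))"
          using s by (intro mult_left_mono) auto
        moreover have "s * (c0 / D * (1 / 2) / (s * q * ln \<Lambda>)) = c"
          unfolding c_def using s by (simp add: mult_ac)
        ultimately show ?thesis by simp
      qed
      then have "ennreal c \<le> ennreal (s * (e / (1 - w)))" by (rule ennreal_leI)
      also have "\<dots> = ennreal s * ennreal (e / (1 - w))" using s e w by (intro ennreal_mult) auto
      also have "\<dots> \<le> ennreal s * (\<integral>\<^sup>+y\<in>\<Omega> - B x0 R'. ennreal (kern (s * q) x y) \<partial>M)"
        by (intro mult_left_mono I) simp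
      finally show ?thesis .
    qed
    then show ?thesis using R'(2) s1 far by blast
  qed
  then show ?thesis using x0 c by blast
qed

end

section \<open>The far part of the Gagliardo integral\<close>

context ball_quasi_banach_setting
begin

abbreviation far :: "real \<Rightarrow> 'a \<Rightarrow> ('a \<Rightarrow> ennreal) \<Rightarrow> ennreal" where
  "far s x H \<equiv> (\<integral>\<^sup>+y\<in>space M - B x 1. H y * ennreal (kern (s * q) x y) \<partial>M)"

lemma RN_quasi_triangle:
  "\<exists>Q::real\<ge>1. \<forall>u\<in>borel_measurable M. \<forall>v\<in>borel_measurable M. \<forall>a b::real. 0 \<le> a \<longrightarrow> 0 \<le> b \<longrightarrow>
     RN u \<le> ennreal a \<longrightarrow> RN v \<le> ennreal b \<longrightarrow> RN (\<lambda>x. u x + v x) \<le> ennreal (Q * (a + b))"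
proof -
  obtain Q :: real where Q: "1 \<le> Q" and tri:
    "\<And>f g. f \<in> borel_measurable M \<Longrightarrow> g \<in> borel_measurable M \<Longrightarrow>
       N (\<lambda>x. f x + g x) \<le> ennreal Q * (N f + N g)"
    using quasi_norm_triangle[OF N_quasi_banach] by blast
  have "RN (\<lambda>x. u x + v x) \<le> ennreal (Q * (a + b))"
    if [measurable]: "u \<in> borel_measurable M" "v \<in> borel_measurable M" and ab: "0 \<le> a" "0 \<le> b"
      and uv: "RN u \<le> ennreal a" "RN v \<le> ennreal b" for u v :: "'a \<Rightarrow> real" and a b
  proof -
    have "RN (\<lambda>x. u x + v x) = N (\<lambda>x. complex_of_real (u x) + complex_of_real (v x))" by simp
    also have "\<dots> \<le> ennreal Q * (RN u + RN v)" by (rule tri) measurable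
    also have "\<dots> \<le> ennreal Q * (ennreal a + ennreal b)" by (intro mult_left_mono add_mono uv) simp
    also have "\<dots> = ennreal (Q * (a + b))" using Q ab by (subst ennreal_mult) auto
    finally show ?thesis .
  qed
  then show ?thesis using Q by blast
qed

text \<open>
  The weights of the averages have sum \<open>1\<close>, and the average of the constant
  \<open>1\<close> is \<open>1\<close>.
\<close>
lemma far_mass_bound:
  "\<exists>C::real>0. \<forall>s. 0 < s \<and> s < 1 \<longrightarrow> (\<forall>x\<in>space M.
     ennreal s * (\<integral>\<^sup>+y\<in>space M - B x 1. ennreal (kern (s * q) x y) \<partial>M) \<le> ennreal C)"
proof -
  obtain C where C: "0 < (C::real)" "\<forall>s. 0 < s \<and> s < 1 \<longrightarrow> (\<forall>x\<in>space M. \<forall>H\<in>borel_measurable M.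
    ennreal s * far s x H
    \<le> ennreal C * (\<Sum>k. ennreal ((1 - 2 powr - (s * q)) * (2 powr - (s * q)) ^ k) *
        avg x (2 ^ Suc k) H))"
    using far_kernel_le_normalised_averages[OF q_pos] by blast
  have "ennreal s * (\<integral>\<^sup>+y\<in>space M - B x 1. ennreal (kern (s * q) x y) \<partial>M) \<le> ennreal C"
    if s: "0 < s \<and> s < 1" and x: "x \<in> space M" for s x
  proof -
    have avg: "avg x (2 ^ Suc k) (\<lambda>y. 1) = 1" for k :: nat
    proof -
      have v: "0 < V x (2 ^ Suc k)" by (rule V_pos[OF x]) simp
      have "(\<integral>\<^sup>+y\<in>B x (2 ^ Suc k). 1 \<partial>M) = ennreal (V x (2 ^ Suc k))"
        using ball_sets[OF x] emeasure_ball[OF x] by simp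
      then show ?thesis unfolding emeasure_ball[OF x] divide_ennreal_pos[OF v]
        using v by (simp add: ennreal_mult[symmetric])
    qed
    have "(\<lambda>y. 1) \<in> borel_measurable M" by simp
    from C(2)[THEN spec, THEN mp, OF s, THEN bspec, OF x, THEN bspec, OF this]
    have "ennreal s * (\<integral>\<^sup>+y\<in>space M - B x 1. ennreal (kern (s * q) x y) \<partial>M)
      \<le> ennreal C * (\<Sum>k. ennreal ((1 - 2 powr - (s * q)) * (2 powr - (s * q)) ^ k))"
      unfolding avg by (simp only: mult_1 mult_1_right)
    also have "(\<Sum>k. ennreal ((1 - 2 powr - (s * q)) * (2 powr - (s * q)) ^ k)) = 1"
      by (rule normalised_weights) (use s q_pos in simp)
    finally show ?thesis by simp
  qed
  then show ?thesis using C(1) by blast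
qed

lemma far_bound:
  "\<exists>C::real>0. \<forall>s. 0 < s \<and> s < 1 \<longrightarrow> (\<forall>F\<in>fun_space M N.
     \<exists>G::'a \<Rightarrow> real. G \<in> borel_measurable M \<and> (\<forall>x. 0 \<le> G x) \<and> RN G \<le> ennreal C * N F \<and>
       (AE x in M. ennreal s * far s x (mod_powr q F)
          \<le> ennreal (G x powr q)))"
proof -
  obtain C where C: "0 < (C::real)" "\<forall>s. 0 < s \<and> s < 1 \<longrightarrow> (\<forall>x\<in>space M. \<forall>H\<in>borel_measurable M.
    ennreal s * far s x H
    \<le> ennreal C * (\<Sum>k. ennreal ((1 - 2 powr - (s * q)) * (2 powr - (s * q)) ^ k) *
        avg x (2 ^ Suc k) H))"
    using far_kernel_le_normalised_averages[OF q_pos] by blast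
  obtain D where D: "0 < (D::real)" "\<forall>w r. \<forall>F\<in>fun_space M N. (\<forall>k::nat. 0 < r k) \<longrightarrow> (\<Sum>k. w k) \<le> (1::ennreal) \<longrightarrow>
     (\<exists>G::'a \<Rightarrow> real. G \<in> borel_measurable M \<and> (\<forall>x. 0 \<le> G x) \<and> RN G \<le> ennreal D * N F \<and>
        (AE x in M. (\<Sum>k. w k * avg x (r k) (mod_powr q F)) \<le> ennreal (G x powr q)))"
    using weighted_averages_bound_N by (elim exE conjE)
  define A where "A = C powr (1 / q)"
  have A: "0 < A" unfolding A_def using C(1) by simp
  have "\<exists>G::'a \<Rightarrow> real. G \<in> borel_measurable M \<and> (\<forall>x. 0 \<le> G x) \<and> RN G \<le> ennreal (A * D) * N F \<and>
       (AE x in M. ennreal s * far s x (mod_powr q F)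
          \<le> ennreal (G x powr q))"
    if s: "0 < s \<and> s < 1" and F: "F \<in> fun_space M N" for s F
  proof -
    have [measurable]: "F \<in> borel_measurable M" using F unfolding fun_space_def by blast
    let ?w = "\<lambda>k. ennreal ((1 - 2 powr - (s * q)) * (2 powr - (s * q)) ^ k)"
    have r: "\<forall>k::nat. 0 < (2::real) ^ Suc k" by simp
    have w: "(\<Sum>k. ?w k) \<le> 1" using normalised_weights[of "s * q"] s q_pos by simp
    from D(2)[THEN spec, THEN spec, THEN bspec, OF F, THEN mp, OF r, THEN mp, OF w]
    obtain G0 :: "'a \<Rightarrow> real" where G0 [measurable]: "G0 \<in> borel_measurable M" and G0_0: "\<forall>x. 0 \<le> G0 x" and NG0: "RN G0 \<le> ennreal D * N F"
      and avg: "AE x in M. (\<Sum>k. ?w k * avg x (2 ^ Suc k) (mod_powr q F)) \<le> ennreal (G0 x powr q)"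
      by (elim exE conjE)
    define G where "G x = A * G0 x" for x
    have "G \<in> borel_measurable M" unfolding G_def by measurable
    moreover have "\<forall>x. 0 \<le> G x" unfolding G_def using A G0_0 by simp
    moreover have "RN G \<le> ennreal (A * D) * N F"
    proof -
      have "RN G = ennreal A * RN G0" unfolding G_def by (rule RN_scale[OF G0]) (use A in simp)
      also have "\<dots> \<le> ennreal A * (ennreal D * N F)" by (intro mult_left_mono NG0) simp
      also have "\<dots> = ennreal (A * D) * N F" using A D(1) by (simp add: ennreal_mult mult.assoc)
      finally show ?thesis .
    qed
    moreover have "AE x in M. ennreal s * far s x (mod_powr q F)
          \<le> ennreal (G x powr q)"
      using avg
    proof (rule AE_mp, intro AE_I2 impI)
      fix x assume x: "x \<in> space M" and le: "(\<Sum>k. ?w k * avg x (2 ^ Suc k) (mod_powr q F)) \<le> ennreal (G0 x powr q)"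
      have "(mod_powr q F) \<in> borel_measurable M" by measurable
      from C(2)[THEN spec, THEN mp, OF s, THEN bspec, OF x, THEN bspec, OF this]
      have "ennreal s * far s x (mod_powr q F)
        \<le> ennreal C * ennreal (G0 x powr q)"
        by (rule order_trans) (intro mult_left_mono le zero_le)
      also have "\<dots> = ennreal (G x powr q)"
      proof -
        have "G x powr q = C * G0 x powr q" unfolding G_def A_def
          using C(1) q_pos by (simp add: powr_mult powr_powr)
        then show ?thesis using C(1) by (simp add: ennreal_mult)
      qed
      finally show "ennreal s * far s x (mod_powr q F)
          \<le> ennreal (G x powr q)" .
    qed
    ultimately show ?thesis by (intro exI[of _ G] conjI)
  qed
  moreover have "0 < A * D" using A D(1) by simp
  ultimately show ?thesis by blast
qed

end

section \<open>The norms on the subset\<close>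

text \<open>
  The right-hand side has \<open>z\<close> isolated, so that an affine upper bound passes to an infimum
  or a lower limit of the values \<open>z\<close>.
\<close>
lemma ennreal_le_affine_iff:
  fixes X Y z :: ennreal
  assumes a: "0 < a" and Y: "Y < top"
  shows "X \<le> ennreal a * z + Y \<longleftrightarrow> ennreal (1 / a) * (X - Y) \<le> z"
proof
  have inv: "ennreal a * (ennreal (1 / a) * t) = t" "ennreal (1 / a) * (ennreal a * t) = t" for t
    using a by (simp_all add: mult.assoc[symmetric] ennreal_mult[symmetric])
  {
    assume "X \<le> ennreal a * z + Y"
    then have "X - Y \<le> ennreal a * z" using Y by (subst ennreal_minus_le_iff) (auto simp: add.commute)
    from mult_left_mono[OF this, of "ennreal (1 / a)"] show "ennreal (1 / a) * (X - Y) \<le> z"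
      unfolding inv by simp
  next
    assume "ennreal (1 / a) * (X - Y) \<le> z"
    from mult_left_mono[OF this, of "ennreal a"] have "X - Y \<le> ennreal a * z" unfolding inv by simp
    then show "X \<le> ennreal a * z + Y" by (subst (asm) ennreal_minus_le_iff) (auto simp: add.commute)
  }
qed

lemma powr_add_le:
  fixes a b q :: real
  assumes "0 \<le> a" "0 \<le> b" "0 < q"
  shows "(a + b) powr q \<le> 2 powr q * (a powr q + b powr q)"
proof -
  have "(a + b) powr q \<le> (2 * max a b) powr q" using assms by (intro powr_mono2) auto
  also have "\<dots> = 2 powr q * max a b powr q" using assms by (simp add: powr_mult)
  also have "max a b powr q \<le> a powr q + b powr q" by (simp add: max_def)
  finally show ?thesis by simp
qed

lemma powr_sum_le:
  fixes a b c q :: real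
  assumes "0 \<le> a" "0 \<le> b" "0 \<le> c" "0 < q"
  shows "a powr q + b powr q + c powr q \<le> 3 * (a + b + c) powr q"
proof -
  have "a powr q \<le> (a + b + c) powr q" "b powr q \<le> (a + b + c) powr q" "c powr q \<le> (a + b + c) powr q"
    using assms by (auto intro!: powr_mono2)
  then show ?thesis by linarith
qed

locale subset_setting = ball_quasi_banach_setting M \<rho> K L N p q
  for M :: "'a measure" and \<rho> :: "'a \<Rightarrow> 'a \<Rightarrow> real" and K L :: real and N :: "'a fun_norm" and p q :: real +
  fixes \<Omega> :: "'a set"
  assumes \<Omega> [measurable]: "\<Omega> \<in> sets M"
begin

abbreviation sem :: "real \<Rightarrow> ('a \<Rightarrow> complex) \<Rightarrow> ennreal" where
  "sem s F \<equiv> sobolev_seminorm M \<rho> N \<Omega> s q F"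

abbreviation gag :: "real \<Rightarrow> ('a \<Rightarrow> complex) \<Rightarrow> 'a \<Rightarrow> ennreal" where
  "gag s F \<equiv> gagliardo M \<rho> \<Omega> s q F"

lemma \<Omega>_space: "x \<in> \<Omega> \<Longrightarrow> x \<in> space M"
  using sets.sets_into_space[OF \<Omega>] by blast

lemma restrict_measurable:
  fixes f :: "'a \<Rightarrow> complex"
  assumes "f \<in> borel_measurable (restrict_space M \<Omega>)"
  shows "(\<lambda>x. f x * indicator \<Omega> x) \<in> borel_measurable M"
proof -
  have "\<Omega> \<inter> space M \<in> sets M" by measurable
  then have "(\<lambda>x. indicator \<Omega> x *\<^sub>R f x) \<in> borel_measurable M"
    using assms borel_measurable_restrict_space_iff by blast
  moreover have "(\<lambda>x. indicator \<Omega> x *\<^sub>R f x) = (\<lambda>x. f x * indicator \<Omega> x)"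
    by (auto simp: indicator_def)
  ultimately show ?thesis by simp
qed

text \<open>
  By the lattice property the extension by zero has the least quasi-norm among all extensions.
\<close>
lemma restr_norm_eq:
  assumes "f \<in> borel_measurable (restrict_space M \<Omega>)"
  shows "restr_norm M N \<Omega> f = N (\<lambda>x. f x * indicator \<Omega> x)"
proof (rule antisym)
  let ?F = "\<lambda>x. f x * indicator \<Omega> x"
  have F: "?F \<in> borel_measurable M" by (rule restrict_measurable[OF assms])
  show "restr_norm M N \<Omega> f \<le> N ?F"
  proof (cases "N ?F = top")
    case False
    then have "?F \<in> fun_space M N" unfolding fun_space_def using F by (simp add: less_top)
    then show ?thesis unfolding restr_norm_def by (intro Inf_lower CollectI exI[of _ ?F]) simp
  qed simp
  show "N ?F \<le> restr_norm M N \<Omega> f" unfolding restr_norm_def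
  proof (rule Inf_greatest)
    fix t assume "t \<in> {N g |g. g \<in> fun_space M N \<and> (AE x in M. x \<in> \<Omega> \<longrightarrow> g x = f x)}"
    then obtain g where t: "t = N g" and g: "g \<in> borel_measurable M" and ae: "AE x in M. x \<in> \<Omega> \<longrightarrow> g x = f x"
      unfolding fun_space_def by blast
    have "AE x in M. cmod (?F x) \<le> cmod (g x)" using ae by eventually_elim (auto simp: indicator_def)
    then show "N ?F \<le> t" unfolding t by (rule quasi_norm_mono[OF N_quasi_banach g F])
  qed
qed

text \<open>
  A measurable function that is finite almost everywhere is its own least majorant, and one that is
  infinite on a set of positive measure has none. Hence the majorants describe the quasi-norm in every
  case, whether or not the function is measurable.
\<close>
lemma restr_norm_enn_eq:
  "restr_norm_enn M N \<Omega> h = Inf {N g |g. g \<in> fun_space M N \<and> (AE x in M. x \<in> \<Omega> \<longrightarrow> h x \<le> ennreal (cmod (g x)))}"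
  (is "_ = Inf ?S")
proof -
  have "restr_norm M N \<Omega> (\<lambda>x. complex_of_real (enn2real (h x))) = Inf ?S"
    if h: "h \<in> borel_measurable (restrict_space M \<Omega>)" and fin: "AE x in M. x \<in> \<Omega> \<longrightarrow> h x < top"
  proof -
    let ?f = "\<lambda>x. complex_of_real (enn2real (h x))"
    have f: "?f \<in> borel_measurable (restrict_space M \<Omega>)" using h by measurable
    let ?F = "\<lambda>x. ?f x * indicator \<Omega> x"
    have F: "?F \<in> borel_measurable M" by (rule restrict_measurable[OF f])
    have "N ?F = Inf ?S"
    proof (rule antisym)
      show "N ?F \<le> Inf ?S"
      proof (rule Inf_greatest)
        fix t assume "t \<in> ?S"
        then obtain g where t: "t = N g" and g: "g \<in> borel_measurable M" and ae: "AE x in M. x \<in> \<Omega> \<longrightarrow> h x \<le> ennreal (cmod (g x))"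
          unfolding fun_space_def by blast
        have "AE x in M. cmod (?F x) \<le> cmod (g x)"
          using ae
        proof eventually_elim
          case (elim x)
          have "enn2real (h x) \<le> cmod (g x)" if "x \<in> \<Omega>"
            using elim that by (intro enn2real_leI) auto
          then show ?case by (auto simp: indicator_def)
        qed
        then show "N ?F \<le> t" unfolding t by (rule quasi_norm_mono[OF N_quasi_banach g F])
      qed
      show "Inf ?S \<le> N ?F"
      proof (cases "N ?F = top")
        case False
        then have "?F \<in> fun_space M N" unfolding fun_space_def using F by (simp add: less_top)
        moreover have "AE x in M. x \<in> \<Omega> \<longrightarrow> h x \<le> ennreal (cmod (?F x))"
          using fin by eventually_elim simp
        ultimately show ?thesis by (intro Inf_lower CollectI exI[of _ ?F] conjI refl)
      qed simp
    qed
    then show ?thesis unfolding restr_norm_eq[OF f] .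
  qed
  moreover have "Inf ?S = top" if "\<not> (AE x in M. x \<in> \<Omega> \<longrightarrow> h x < top)"
  proof -
    have "?S = {}"
    proof (rule equals0I)
      fix t assume "t \<in> ?S"
      then obtain g where "AE x in M. x \<in> \<Omega> \<longrightarrow> h x \<le> ennreal (cmod (g x))" by blast
      then have "AE x in M. x \<in> \<Omega> \<longrightarrow> h x < top"
        by eventually_elim (auto intro: le_less_trans[OF _ ennreal_less_top])
      then show False using that by blast
    qed
    then show "Inf ?S = top" by (simp only: Inf_empty)
  qed
  ultimately show ?thesis unfolding restr_norm_enn_def by presburger
qed

lemma sobolev_seminorm_eq:
  "sobolev_seminorm M \<rho> N \<Omega> s q f =
     Inf {N g |g. g \<in> fun_space M N \<and> (AE x in M. x \<in> \<Omega> \<longrightarrow> gagliardo M \<rho> \<Omega> s q f x \<le> ennreal (cmod (g x)))}"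
  unfolding sobolev_seminorm_def by (rule restr_norm_enn_eq)

lemma sobolev_seminorm_cong:
  assumes "\<And>x. x \<in> \<Omega> \<Longrightarrow> f x = f' x"
  shows "sobolev_seminorm M \<rho> N \<Omega> s q f = sobolev_seminorm M \<rho> N \<Omega> s q f'"
proof -
  have "gagliardo M \<rho> \<Omega> s q f x = gagliardo M \<rho> \<Omega> s q f' x" if "x \<in> \<Omega>" for x
    unfolding gagliardo_def
    by (rule arg_cong[where f = "\<lambda>t. ennpowr t (1 / q)"], rule nn_integral_cong)
       (use that assms in \<open>auto simp: indicator_def\<close>)
  then have "(AE x in M. x \<in> \<Omega> \<longrightarrow> gagliardo M \<rho> \<Omega> s q f x \<le> ennreal (cmod (g x))) \<longleftrightarrow>
      (AE x in M. x \<in> \<Omega> \<longrightarrow> gagliardo M \<rho> \<Omega> s q f' x \<le> ennreal (cmod (g x)))" for g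
    by (intro AE_cong) auto
  then show ?thesis unfolding sobolev_seminorm_eq by simp
qed

lemma sobolev_seminorm_translate:
  "sobolev_seminorm M \<rho> N \<Omega> s q (\<lambda>x. f x + a) = sobolev_seminorm M \<rho> N \<Omega> s q f"
  unfolding sobolev_seminorm_def gagliardo_def add_diff_cancel_right ..

text \<open>
  Unlike in the Gagliardo integral itself, the integrand is measurable in \<open>y\<close>, so that this
  integral is additive.
\<close>
definition energy :: "real \<Rightarrow> ('a \<Rightarrow> complex) \<Rightarrow> 'a \<Rightarrow> ennreal" where
  "energy s F x = (\<integral>\<^sup>+y\<in>\<Omega>. ennreal (cmod (F x - F y) powr q) * ennreal (kern (s * q) x y) \<partial>M)"

lemma gagliardo_energy:
  "\<exists>D::real\<ge>1. \<forall>s. \<forall>F\<in>borel_measurable M. \<forall>x\<in>\<Omega>.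
     ennpowr (energy s F x) (1 / q) \<le> gag s F x \<and>
     gag s F x \<le> ennpowr (ennreal D * energy s F x) (1 / q)"
proof -
  obtain D where D: "1 \<le> (D::real)"
    "\<forall>x\<in>space M. \<forall>y\<in>space M. \<forall>r>0. \<rho> x y \<le> 1 * r \<longrightarrow> V x (1 * r) \<le> D * V y r"
    using V_compare[of 1] by blast
  have "ennpowr (energy s F x) (1 / q) \<le> gag s F x \<and>
     gag s F x \<le> ennpowr (ennreal D * energy s F x) (1 / q)"
    if F [measurable]: "F \<in> borel_measurable M" and x: "x \<in> \<Omega>" for s F x
  proof -
    have xM: "x \<in> space M" by (rule \<Omega>_space[OF x])
    have [measurable]: "kern (s * q) x \<in> borel_measurable M" by (rule kern_measurable[OF xM])
    let ?a = "\<lambda>y. ennreal (cmod (F x - F y) powr q)"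
    let ?k = "\<lambda>y. ennreal (kern (s * q) x y)"
    let ?g = "\<lambda>y. if y = x then 0 else ?a y / (U_fun M \<rho> x y * ennreal (\<rho> x y powr (s * q)))"
    have pw: "?a y * ?k y \<le> ?g y \<and> ?g y \<le> ennreal D * (?a y * ?k y)" if y: "y \<in> space M" for y
    proof (cases "y = x")
      case True
      then show ?thesis using q_pos by simp
    next
      case False
      define t where "t = \<rho> x y"
      have t: "0 < t" unfolding t_def using False rho_nonneg[OF xM y] rho_eq_0_iff[OF xM y] by fastforce
      define m where "m = min (V x t) (V y t)"
      have Vx: "0 < V x t" and Vy: "0 < V y t" using V_pos xM y t by blast+
      have m: "0 < m" "m \<le> V x t" unfolding m_def using Vx Vy by auto
      have "V x t \<le> D * V y t" using D(2)[rule_format, OF xM y t] unfolding t_def by simp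
      moreover have "V x t \<le> D * V x t" using D(1) Vx by simp
      ultimately have mD: "V x t \<le> D * m" unfolding m_def by (simp add: min_def)
      define P where "P = t powr (s * q)"
      have P: "0 < P" unfolding P_def using t by simp
      have U: "U_fun M \<rho> x y * ennreal (\<rho> x y powr (s * q)) = ennreal (m * P)"
      proof -
        have "U_fun M \<rho> x y = ennreal m"
          unfolding U_fun_def emeasure_ball[OF xM] emeasure_ball[OF y] t_def[symmetric] m_def
          by (simp add: min_def)
        then show ?thesis unfolding P_def t_def[symmetric] using m P by (simp add: ennreal_mult)
      qed
      have "0 < m * P" using m P by simp
      then have g: "?g y = ennreal (1 / (m * P)) * ?a y"
        unfolding U using False by (simp only: divide_ennreal_pos if_False)
      have k: "kern (s * q) x y = 1 / (V x t * P)" unfolding kern_def t_def P_def ..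
      have "1 / (V x t * P) \<le> 1 / (m * P)"
        using m P by (intro frac_le mult_right_mono) auto
      moreover have "1 / (m * P) \<le> D * (1 / (V x t * P))"
      proof -
        have "V x t * P \<le> D * m * P" using mD P by (intro mult_right_mono) auto
        then show ?thesis using m P Vx by (simp add: divide_simps mult_ac)
      qed
      ultimately have 1: "kern (s * q) x y \<le> 1 / (m * P)" and 2: "1 / (m * P) \<le> D * kern (s * q) x y"
        unfolding k by auto
      have "?g y \<le> ennreal (D * kern (s * q) x y) * ?a y"
        unfolding g by (intro mult_right_mono ennreal_leI 2) simp
      also have "\<dots> = ennreal D * (?a y * ?k y)"
        using D(1) by (simp add: ennreal_mult mult_ac)
      finally have "?g y \<le> ennreal D * (?a y * ?k y)" .
      moreover have "?a y * ?k y \<le> ?g y"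
        unfolding g mult.commute[of "?a y"] by (intro mult_right_mono ennreal_leI 1) simp
      ultimately show ?thesis by blast
    qed
    let ?I = "\<integral>\<^sup>+y\<in>\<Omega>. ?g y \<partial>M"
    have "energy s F x \<le> ?I" unfolding energy_def
      using pw by (intro nn_integral_mono mult_right_mono) auto
    moreover have "?I \<le> (\<integral>\<^sup>+y. ennreal D * (?a y * ?k y * indicator \<Omega> y) \<partial>M)"
    proof (rule nn_integral_mono)
      fix y assume "y \<in> space M"
      from mult_right_mono[OF conjunct2[OF pw[OF this]], of "indicator \<Omega> y"]
      show "?g y * indicator \<Omega> y \<le> ennreal D * (?a y * ?k y * indicator \<Omega> y)"
        by (simp only: mult.assoc zero_le)
    qed
    moreover have "\<dots> = ennreal D * energy s F x" unfolding energy_def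
      by (intro nn_integral_cmult) measurable
    ultimately show ?thesis unfolding gagliardo_def using q_pos by (simp add: ennpowr_le_iff)
  qed
  then show ?thesis using D(1) by blast
qed

section \<open>The upper estimate\<close>

text \<open>
  At distances below \<open>1\<close> the kernel increases with \<open>s\<close>; at larger distances
  the difference is estimated by its two terms.
\<close>
lemma energy_le:
  assumes x: "x \<in> \<Omega>" and F [measurable]: "F \<in> borel_measurable M" and s: "0 < s" "s < s0"
  shows "energy s F x \<le> energy s0 F x + ennreal (2 powr q) *
    (ennreal (cmod (F x) powr q) * (\<integral>\<^sup>+y\<in>space M - B x 1. ennreal (kern (s * q) x y) \<partial>M)
      + far s x (mod_powr q F))"
proof -
  have xM: "x \<in> space M" by (rule \<Omega>_space[OF x])
  have [measurable]: "B x 1 \<in> sets M" by (rule ball_sets[OF xM])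
  have [measurable]: "kern \<sigma> x \<in> borel_measurable M" for \<sigma> by (rule kern_measurable[OF xM])
  let ?d = "\<lambda>y. ennreal (cmod (F x - F y) powr q)"
  let ?f = "\<lambda>y. indicator (space M - B x 1) y :: ennreal"
  have "energy s F x \<le> (\<integral>\<^sup>+y. ?d y * ennreal (kern (s0 * q) x y) * indicator \<Omega> y + ennreal (2 powr q) *
      (ennreal (cmod (F x) powr q) * (ennreal (kern (s * q) x y) * ?f y)
       + ennreal (cmod (F y) powr q) * ennreal (kern (s * q) x y) * ?f y) \<partial>M)"
    unfolding energy_def
  proof (rule nn_integral_mono)
    fix y assume y: "y \<in> space M"
    show "?d y * ennreal (kern (s * q) x y) * indicator \<Omega> y
      \<le> ?d y * ennreal (kern (s0 * q) x y) * indicator \<Omega> y + ennreal (2 powr q) *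
      (ennreal (cmod (F x) powr q) * (ennreal (kern (s * q) x y) * ?f y)
       + ennreal (cmod (F y) powr q) * ennreal (kern (s * q) x y) * ?f y)"
    proof (cases "\<rho> x y < 1")
      case True
      have "kern (s * q) x y \<le> kern (s0 * q) x y"
      proof (cases "\<rho> x y = 0")
        case True then show ?thesis unfolding kern_def by simp
      next
        case False
        then have r: "0 < \<rho> x y" using rho_nonneg[OF xM y] by simp
        have "\<rho> x y powr (s0 * q) \<le> \<rho> x y powr (s * q)"
          by (rule powr_mono') (use r True s q_pos in auto)
        then show ?thesis unfolding kern_def
          using V_pos[OF xM r] r by (intro frac_le mult_left_mono) auto
      qed
      then have "?d y * ennreal (kern (s * q) x y) * indicator \<Omega> y \<le> ?d y * ennreal (kern (s0 * q) x y) * indicator \<Omega> y"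
        by (intro mult_right_mono mult_left_mono ennreal_leI) simp_all
      then show ?thesis by (rule add_increasing2[OF zero_le])
    next
      case False
      then have f: "?f y = 1" using y by (simp add: mem_ball)
      have "cmod (F x - F y) powr q \<le> (cmod (F x) + cmod (F y)) powr q"
        by (intro powr_mono2 norm_triangle_ineq4) (use q_pos in auto)
      also have "\<dots> \<le> 2 powr q * (cmod (F x) powr q + cmod (F y) powr q)"
        by (rule powr_add_le) (use q_pos in auto)
      finally have "?d y \<le> ennreal (2 powr q * (cmod (F x) powr q + cmod (F y) powr q))" by (rule ennreal_leI)
      also have "\<dots> = ennreal (2 powr q) * (ennreal (cmod (F x) powr q) + ennreal (cmod (F y) powr q))"
        by (subst ennreal_mult) simp_all
      finally have d: "?d y \<le> ennreal (2 powr q) * (ennreal (cmod (F x) powr q) + ennreal (cmod (F y) powr q))" .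
      have "?d y * ennreal (kern (s * q) x y) * indicator \<Omega> y \<le> ?d y * ennreal (kern (s * q) x y) * 1"
        by (intro mult_left_mono) (auto simp: indicator_def)
      also have "\<dots> \<le> ennreal (2 powr q) * (ennreal (cmod (F x) powr q) + ennreal (cmod (F y) powr q)) * ennreal (kern (s * q) x y)"
        unfolding mult_1_right by (intro mult_right_mono d) simp
      also have "\<dots> = ennreal (2 powr q) *
      (ennreal (cmod (F x) powr q) * (ennreal (kern (s * q) x y) * ?f y)
       + ennreal (cmod (F y) powr q) * ennreal (kern (s * q) x y) * ?f y)"
        unfolding f mult_1_right mult.assoc distrib_right ..
      finally show ?thesis by (rule add_increasing[OF zero_le])
    qed
  qed
  also have "\<dots> = energy s0 F x + ennreal (2 powr q) *
    (ennreal (cmod (F x) powr q) * (\<integral>\<^sup>+y\<in>space M - B x 1. ennreal (kern (s * q) x y) \<partial>M)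
      + far s x (mod_powr q F))"
    unfolding energy_def by (simp add: nn_integral_add nn_integral_cmult)
  finally show ?thesis .
qed

lemma energy_le_of_gagliardo_le:
  assumes "ennpowr (energy s F x) (1 / q) \<le> ennreal c" "0 \<le> c"
  shows "energy s F x \<le> ennreal (c powr q)"
proof -
  have "ennpowr (ennreal (c powr q)) (1 / q) = ennreal c"
    using assms(2) q_pos by (simp add: ennpowr_ennreal powr_powr)
  then show ?thesis using assms(1) q_pos ennpowr_le_iff[of "1 / q"] by (metis zero_less_divide_1_iff)
qed

lemma powr_inverse_cancel: "0 \<le> c \<Longrightarrow> (c powr (1 / q)) powr q = c"
  using q_pos by (simp add: powr_powr)

text \<open>
  The function \<open>m\<close> of the proof is a majorant of the Gagliardo function for
  \<open>s\<close>: a combination of the majorant \<open>g\<close> for \<open>s\<^sub>0\<close>, which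
  controls the near part, of \<open>|F|\<close>, and of the function that controls the averages of
  \<open>|F|\<^sup>q\<close>. After multiplication by \<open>s\<^sup>1\<^sup>/\<^sup>q\<close> only the
  term with \<open>g\<close> tends to zero with \<open>s\<close>.
\<close>
lemma seminorm_upper_bound:
  "\<exists>C::real>0. \<forall>F\<in>fun_space M N. \<forall>s0. 0 < s0 \<and> s0 < 1 \<longrightarrow> (\<forall>g\<in>fun_space M N.
     (AE x in M. x \<in> \<Omega> \<longrightarrow> gag s0 F x \<le> ennreal (cmod (g x))) \<longrightarrow>
     (\<forall>s. 0 < s \<and> s < s0 \<longrightarrow> ennreal (s powr (1 / q)) * sem s F
        \<le> ennreal (C * s powr (1 / q)) * N g + ennreal C * N F))"
proof -
  obtain D where D: "1 \<le> (D::real)" and gag: "\<forall>s. \<forall>F\<in>borel_measurable M. \<forall>x\<in>\<Omega>.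
     ennpowr (energy s F x) (1 / q) \<le> gag s F x \<and>
     gag s F x \<le> ennpowr (ennreal D * energy s F x) (1 / q)"
    using gagliardo_energy by (elim exE conjE)
  obtain Q where Q: "1 \<le> (Q::real)" and tri: "\<forall>u\<in>borel_measurable M. \<forall>v\<in>borel_measurable M. \<forall>a b::real. 0 \<le> a \<longrightarrow> 0 \<le> b \<longrightarrow>
     RN u \<le> ennreal a \<longrightarrow> RN v \<le> ennreal b \<longrightarrow> RN (\<lambda>x. u x + v x) \<le> ennreal (Q * (a + b))"
    using RN_quasi_triangle by (elim exE conjE)
  obtain C1 where C1: "0 < (C1::real)" and mass: "\<forall>s. 0 < s \<and> s < 1 \<longrightarrow> (\<forall>x\<in>space M.
     ennreal s * (\<integral>\<^sup>+y\<in>space M - B x 1. ennreal (kern (s * q) x y) \<partial>M) \<le> ennreal C1)"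
    using far_mass_bound by (elim exE conjE)
  obtain C2 where C2: "0 < (C2::real)" and far: "\<forall>s. 0 < s \<and> s < 1 \<longrightarrow> (\<forall>F\<in>fun_space M N.
     \<exists>G::'a \<Rightarrow> real. G \<in> borel_measurable M \<and> (\<forall>x. 0 \<le> G x) \<and> RN G \<le> ennreal C2 * N F \<and>
       (AE x in M. ennreal s * far s x (mod_powr q F)
          \<le> ennreal (G x powr q)))"
    using far_bound by (elim exE conjE)
  define C3 where "C3 = 1 + 2 powr q * (1 + C1)"
  have C3: "1 \<le> C3" "2 powr q * C1 \<le> C3" "2 powr q \<le> C3"
    unfolding C3_def using C1 by (auto simp: distrib_left add_increasing)
  define A where "A = (3 * D * C3) powr (1 / q)"
  have A: "0 < A" and A_powr: "A powr q = 3 * D * C3"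
    unfolding A_def using D C3 by (auto simp: powr_inverse_cancel)
  define C where "C = A * Q * (1 + Q * (1 + C2))"
  have QC: "0 < Q * (1 + C2)" using Q C2 by simp
  have C: "0 < C" "A * Q \<le> C" "A * Q * (Q * (1 + C2)) \<le> C"
  proof -
    have "0 < A * Q" using A Q by simp
    then show "0 < C" unfolding C_def using QC by (intro mult_pos_pos[of "A * Q"]) linarith+
    have "C = A * Q + A * Q * (Q * (1 + C2))"
      using distrib_left[of "A * Q" 1 "Q * (1 + C2)"] unfolding C_def by (simp only: mult_1_right)
    moreover have "0 < A * Q * (Q * (1 + C2))" by (rule mult_pos_pos[OF \<open>0 < A * Q\<close> QC])
    ultimately show "A * Q \<le> C" "A * Q * (Q * (1 + C2)) \<le> C" using \<open>0 < A * Q\<close> by linarith+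
  qed
  have "ennreal (s powr (1 / q)) * sem s F
        \<le> ennreal (C * s powr (1 / q)) * N g + ennreal C * N F"
    if FN: "F \<in> fun_space M N" and s0: "0 < s0 \<and> s0 < 1" and gN: "g \<in> fun_space M N"
      and maj: "AE x in M. x \<in> \<Omega> \<longrightarrow> gag s0 F x \<le> ennreal (cmod (g x))" and s: "0 < s" "s < s0" for F s0 g s
  proof -
    have F [measurable]: "F \<in> borel_measurable M" and g [measurable]: "g \<in> borel_measurable M"
      using FN gN unfolding fun_space_def by blast+
    have s1: "0 < s \<and> s < 1" using s s0 by simp
    from far[THEN spec, THEN mp, OF s1, THEN bspec, OF FN]
    obtain G where G [measurable]: "G \<in> borel_measurable M" and G0: "\<forall>x. 0 \<le> G x" and NG: "RN G \<le> ennreal C2 * N F"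
      and farG: "AE x in M. ennreal s * far s x (mod_powr q F)
          \<le> ennreal (G x powr q)"
      by (elim exE conjE)
    define l where "l = s powr (1 / q)"
    have l: "0 < l" and l_powr: "l powr q = s" unfolding l_def using s by (auto simp: powr_inverse_cancel)
    define T where "T x = l * cmod (g x) + (cmod (F x) + G x)" for x
    have T [measurable]: "T \<in> borel_measurable M" unfolding T_def by measurable
    have T0: "0 \<le> T x" for x unfolding T_def using l G0 by simp
    define m where "m x = (A / l) * T x" for x
    have m [measurable]: "m \<in> borel_measurable M" unfolding m_def by measurable
    have m0: "0 \<le> m x" for x unfolding m_def using A l T0[of x] by simp
    have "AE x in M. x \<in> \<Omega> \<longrightarrow> gag s F x \<le> ennreal (cmod (complex_of_real (m x)))"
      using maj farG
    proof eventually_elim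
      case (elim x)
      show ?case
      proof
        assume xO: "x \<in> \<Omega>"
        have xM: "x \<in> space M" by (rule \<Omega>_space[OF xO])
        have "ennpowr (energy s0 F x) (1 / q) \<le> ennreal (cmod (g x))"
          using gag[rule_format, OF F xO, of s0] elim(1) xO by (blast intro: order_trans)
        then have e0: "energy s0 F x \<le> ennreal (cmod (g x) powr q)"
          by (rule energy_le_of_gagliardo_le) simp
        let ?I = "\<integral>\<^sup>+y\<in>space M - B x 1. ennreal (kern (s * q) x y) \<partial>M"
        let ?J = "far s x (mod_powr q F)"
        have "ennreal s * energy s F x \<le> ennreal s * (energy s0 F x + ennreal (2 powr q) * (ennreal (cmod (F x) powr q) * ?I + ?J))"
          by (intro mult_left_mono energy_le xO F s) simp
        also have "\<dots> = ennreal s * energy s0 F x + ennreal (2 powr q) * (ennreal (cmod (F x) powr q) * (ennreal s * ?I) + ennreal s * ?J)"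
          unfolding distrib_left by (simp only: mult.left_commute)
        also have "\<dots> \<le> ennreal s * ennreal (cmod (g x) powr q) + ennreal (2 powr q) * (ennreal (cmod (F x) powr q) * ennreal C1 + ennreal (G x powr q))"
          by (intro add_mono mult_left_mono e0 mass[rule_format, OF s1 xM] elim(2)) simp_all
        also have "\<dots> = ennreal (s * cmod (g x) powr q + 2 powr q * (cmod (F x) powr q * C1 + G x powr q))"
          using s C1 by (simp add: ennreal_mult)
        also have "\<dots> \<le> ennreal (C3 * (3 * T x powr q))"
        proof (rule ennreal_leI)
          have "s * cmod (g x) powr q = (l * cmod (g x)) powr q" using l by (simp add: powr_mult l_powr)
          also have "\<dots> \<le> C3 * (l * cmod (g x)) powr q" using mult_right_mono[OF C3(1)] by simp
          finally have 1: "s * cmod (g x) powr q \<le> C3 * (l * cmod (g x)) powr q" .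
          have 2: "2 powr q * C1 * cmod (F x) powr q \<le> C3 * cmod (F x) powr q" by (rule mult_right_mono[OF C3(2)]) simp
          have 3: "2 powr q * G x powr q \<le> C3 * G x powr q" by (rule mult_right_mono[OF C3(3)]) simp
          have "s * cmod (g x) powr q + 2 powr q * (cmod (F x) powr q * C1 + G x powr q)
              = s * cmod (g x) powr q + 2 powr q * C1 * cmod (F x) powr q + 2 powr q * G x powr q"
            by (simp add: algebra_simps)
          also have "\<dots> \<le> C3 * ((l * cmod (g x)) powr q + cmod (F x) powr q + G x powr q)"
            using 1 2 3 by (simp add: distrib_left)
          also have "\<dots> \<le> C3 * (3 * T x powr q)"
            using C3(1) powr_sum_le[of "l * cmod (g x)" "cmod (F x)" "G x" q] l G0 q_pos unfolding T_def
            by (intro mult_left_mono) (auto simp: add.assoc)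
          finally show "s * cmod (g x) powr q + 2 powr q * (cmod (F x) powr q * C1 + G x powr q) \<le> C3 * (3 * T x powr q)" .
        qed
        finally have le: "ennreal s * energy s F x \<le> ennreal (C3 * (3 * T x powr q))" .
        have "ennreal D * energy s F x = ennreal (D / s) * (ennreal s * energy s F x)"
          using s D by (simp add: mult.assoc[symmetric] ennreal_mult[symmetric])
        also have "\<dots> \<le> ennreal (D / s) * ennreal (C3 * (3 * T x powr q))" by (intro mult_left_mono le) simp
        also have "\<dots> = ennreal (D / s * (C3 * (3 * T x powr q)))"
          using s D C3 by (intro ennreal_mult[symmetric]) auto
        also have "D / s * (C3 * (3 * T x powr q)) = m x powr q"
        proof -
          have "m x powr q = A powr q / l powr q * T x powr q"
            unfolding m_def using A l T0[of x] by (simp add: powr_mult powr_divide)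
          then show ?thesis unfolding A_powr l_powr by simp
        qed
        finally have "ennpowr (ennreal D * energy s F x) (1 / q) \<le> ennpowr (ennreal (m x powr q)) (1 / q)"
          using q_pos by (simp add: ennpowr_le_iff)
        also have "\<dots> = ennreal (m x)" using m0 q_pos by (simp add: ennpowr_ennreal powr_powr)
        finally show "gag s F x \<le> ennreal (cmod (complex_of_real (m x)))" using gag[rule_format, OF F xO, of s] m0[of x] by (auto intro: order_trans)
      qed
    qed
    moreover obtain n where n: "0 \<le> n" "N g = ennreal n" using gN unfolding fun_space_def by (cases "N g") auto
    moreover obtain f where f: "0 \<le> f" "N F = ennreal f" using FN unfolding fun_space_def by (cases "N F") auto
    have RT: "RN T \<le> ennreal (Q * (l * n + Q * (f + C2 * f)))"
    proof -
      have gn: "RN (\<lambda>x. l * cmod (g x)) \<le> ennreal (l * n)"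
        using RN_scale[of "\<lambda>x. cmod (g x)" l] RN_cmod[OF g] n l by (simp add: ennreal_mult)
      have ff: "RN (\<lambda>x. cmod (F x)) \<le> ennreal f" using RN_cmod[OF F] f by simp
      have gf: "RN G \<le> ennreal (C2 * f)" using NG f C2 by (simp add: ennreal_mult)
      have "RN (\<lambda>x. cmod (F x) + G x) \<le> ennreal (Q * (f + C2 * f))"
        by (rule tri[rule_format, OF _ G _ _ ff gf]) (use f C2 in auto)
      then show ?thesis unfolding T_def
        by (intro tri[rule_format, OF _ _ _ _ gn]) (use l n f Q C2 in auto)
    qed
    have Rm: "RN m \<le> ennreal (A / l * (Q * (l * n + Q * (f + C2 * f))))"
    proof -
      have "RN m = ennreal (A / l) * RN T" unfolding m_def by (rule RN_scale[OF T]) (use A l in simp)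
      also have "\<dots> \<le> ennreal (A / l) * ennreal (Q * (l * n + Q * (f + C2 * f)))" by (intro mult_left_mono RT) simp
      also have "\<dots> = ennreal (A / l * (Q * (l * n + Q * (f + C2 * f))))"
        using A l Q n f C2 by (intro ennreal_mult[symmetric]) auto
      finally show ?thesis .
    qed
    then have "(\<lambda>x. complex_of_real (m x)) \<in> fun_space M N"
      unfolding fun_space_def by (auto intro: le_less_trans)
    ultimately have "sem s F \<le> RN m"
      unfolding sobolev_seminorm_eq by (intro Inf_lower) blast
    also note Rm
    finally have "ennreal l * sem s F \<le> ennreal l * ennreal (A / l * (Q * (l * n + Q * (f + C2 * f))))"
      by (intro mult_left_mono) auto
    also have "\<dots> = ennreal (l * (A / l * (Q * (l * n + Q * (f + C2 * f)))))"
      using A l Q n f C2 by (intro ennreal_mult[symmetric]) auto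
    also have "l * (A / l * (Q * (l * n + Q * (f + C2 * f)))) = A * Q * (l * n) + A * Q * (Q * (1 + C2)) * f"
      using l by (simp add: algebra_simps)
    also have "ennreal \<dots> \<le> ennreal (C * (l * n) + C * f)"
      using C l n f by (intro ennreal_leI add_mono mult_right_mono) auto
    also have "\<dots> = ennreal (C * l) * N g + ennreal C * N F"
      unfolding n f using C l n f by (simp add: ennreal_mult mult.assoc)
    finally show ?thesis unfolding l_def .
  qed
  then show ?thesis using C(1) by blast
qed

abbreviation nsem :: "real \<Rightarrow> ('a \<Rightarrow> complex) \<Rightarrow> ennreal" where
  "nsem s F \<equiv> ennreal (s powr (1 / q)) * sem s F"

lemma Limsup_seminorm_le:
  "\<exists>C::real>0. \<forall>F\<in>borel_measurable M. \<forall>s0. 0 < s0 \<and> s0 < 1 \<and> sem s0 F < top \<longrightarrow>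
     Limsup (at_right 0) (\<lambda>s. nsem s F) \<le> ennreal C * N F"
proof -
  obtain C where C: "0 < (C::real)" and bound: "\<forall>F\<in>fun_space M N. \<forall>s0. 0 < s0 \<and> s0 < 1 \<longrightarrow> (\<forall>g\<in>fun_space M N.
     (AE x in M. x \<in> \<Omega> \<longrightarrow> gag s0 F x \<le> ennreal (cmod (g x))) \<longrightarrow>
     (\<forall>s. 0 < s \<and> s < s0 \<longrightarrow> nsem s F
        \<le> ennreal (C * s powr (1 / q)) * N g + ennreal C * N F))"
    using seminorm_upper_bound by (elim exE conjE)
  have "Limsup (at_right 0) (\<lambda>s. nsem s F) \<le> ennreal C * N F"
    if F: "F \<in> borel_measurable M" and s0: "0 < s0" "s0 < 1" and fin: "sem s0 F < top" for F s0
  proof (cases "N F = top")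
    case True
    then show ?thesis using C by (simp add: ennreal_mult_top)
  next
    case False
    then have FN: "F \<in> fun_space M N" unfolding fun_space_def using F by (simp add: less_top)
    obtain g where gN: "g \<in> fun_space M N"
      and maj: "AE x in M. x \<in> \<Omega> \<longrightarrow> gag s0 F x \<le> ennreal (cmod (g x))"
      using fin unfolding sobolev_seminorm_eq Inf_less_iff by blast
    obtain n where n: "0 \<le> n" "N g = ennreal n" using gN unfolding fun_space_def by (cases "N g") auto
    have "((\<lambda>s::real. s powr (1 / q)) \<longlongrightarrow> 0) (at_right 0)"
      by (rule tendsto_zero_powrI[OF tendsto_ident_at tendsto_const])
         (use q_pos in \<open>auto simp: eventually_at_right_less eventually_at_filter\<close>)
    then have lim: "((\<lambda>s. C * n * s powr (1 / q)) \<longlongrightarrow> 0) (at_right 0)"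
      by (rule tendsto_mult_right_zero)
    show ?thesis
    proof (rule ennreal_le_epsilon)
      fix e :: real assume e: "0 < e"
      have "\<forall>\<^sub>F s in at_right 0. C * n * s powr (1 / q) < e"
        using lim e by (rule order_tendstoD)
      moreover have "\<forall>\<^sub>F s in at_right 0. s \<in> {0<..<s0}" by (rule eventually_at_right_real[OF s0(1)])
      ultimately have "\<forall>\<^sub>F s in at_right 0. nsem s F \<le> ennreal C * N F + ennreal e"
      proof eventually_elim
        case (elim s)
        have "nsem s F
            \<le> ennreal (C * s powr (1 / q)) * N g + ennreal C * N F"
          by (rule bound[rule_format, OF FN _ gN maj[rule_format]]) (use s0 elim in auto)
        also have "ennreal (C * s powr (1 / q)) * N g = ennreal (C * n * s powr (1 / q))"
          unfolding n using C n by (subst ennreal_mult[symmetric]) (auto simp: mult_ac)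
        also have "\<dots> \<le> ennreal e" using elim(1) by (intro ennreal_leI) simp
        finally show ?case by (simp add: add.commute)
      qed
      then show "Limsup (at_right 0) (\<lambda>s. nsem s F) \<le> ennreal C * N F + ennreal e"
        by (rule Limsup_bounded)
    qed
  qed
  then show ?thesis using C by blast
qed

section \<open>The lower estimate\<close>

text \<open>
  The counterpart of the splitting in \<open>energy_le\<close>, with the roles of \<open>F(x)\<close>
  and \<open>F(x) - F(y)\<close> interchanged.
\<close>
lemma energy_ge:
  assumes x: "x \<in> \<Omega>" and F [measurable]: "F \<in> borel_measurable M" and E [measurable]: "E \<in> sets M"
    and E_sub: "E \<subseteq> \<Omega>" and E_far: "\<And>y. y \<in> E \<Longrightarrow> 1 \<le> \<rho> x y"
  shows "ennreal (cmod (F x) powr q) * (\<integral>\<^sup>+y\<in>E. ennreal (kern (s * q) x y) \<partial>M)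
    \<le> ennreal (2 powr q) * (energy s F x + far s x (\<lambda>y. ennreal (cmod (F y * indicator E y) powr q)))"
proof -
  have xM: "x \<in> space M" by (rule \<Omega>_space[OF x])
  have [measurable]: "kern (s * q) x \<in> borel_measurable M" by (rule kern_measurable[OF xM])
  have [measurable]: "B x 1 \<in> sets M" by (rule ball_sets[OF xM])
  let ?a = "ennreal (cmod (F x) powr q)"
  let ?k = "\<lambda>y. ennreal (kern (s * q) x y)"
  let ?T = "\<lambda>y. F y * indicator E y"
  let ?rhs = "\<lambda>y. ennreal (2 powr q) * (ennreal (cmod (F x - F y) powr q) * ?k y * indicator \<Omega> y
      + ennreal (cmod (?T y) powr q) * ?k y * indicator (space M - B x 1) y)"
  have "?a * (\<integral>\<^sup>+y\<in>E. ?k y \<partial>M) = (\<integral>\<^sup>+y. ?a * (?k y * indicator E y) \<partial>M)"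
    by (rule nn_integral_cmult[symmetric]) measurable
  also have "\<dots> \<le> (\<integral>\<^sup>+y. ?rhs y \<partial>M)"
  proof (rule nn_integral_mono)
    fix y assume y: "y \<in> space M"
    show "?a * (?k y * indicator E y) \<le> ?rhs y"
    proof (cases "y \<in> E")
      case True
      have y1: "y \<in> space M - B x 1" using E_far[OF True] y by (simp add: mem_ball)
      have yO: "y \<in> \<Omega>" using True E_sub by blast
      have Ty: "?T y = F y" using True by simp
      have "cmod (F x) powr q \<le> (cmod (F x - F y) + cmod (F y)) powr q"
        using norm_triangle_sub[of "F x" "F y"] q_pos by (intro powr_mono2) (auto simp: add.commute)
      also have "\<dots> \<le> 2 powr q * (cmod (F x - F y) powr q + cmod (F y) powr q)"
        by (rule powr_add_le) (use q_pos in auto)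
      finally have "?a \<le> ennreal (2 powr q * (cmod (F x - F y) powr q + cmod (F y) powr q))" by (rule ennreal_leI)
      also have "\<dots> = ennreal (2 powr q) * (ennreal (cmod (F x - F y) powr q) + ennreal (cmod (F y) powr q))"
        by (subst ennreal_mult) simp_all
      finally have "?a * ?k y \<le> ennreal (2 powr q) * (ennreal (cmod (F x - F y) powr q) + ennreal (cmod (F y) powr q)) * ?k y"
        by (rule mult_right_mono) simp
      then show ?thesis using True y1 yO unfolding Ty by (simp add: mult.assoc distrib_right)
    qed simp
  qed
  also have "\<dots> = ennreal (2 powr q) * (energy s F x + far s x (mod_powr q ?T))"
    unfolding energy_def by (simp add: nn_integral_add nn_integral_cmult)
  finally show ?thesis .
qed

text \<open>
  The tails \<open>F 1\<^bsub>\<Omega> - B(x\<^sub>0,R)\<^esub>\<close> have to be small in norm,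
  because they enter the estimate on \<open>B(x\<^sub>0,R)\<close> through their averages. This is the
  common feature of functions with bounded support and of an absolutely continuous quasi-norm.
\<close>
lemma Liminf_seminorm_ge:
  assumes wrd: "weak_reverse_doubling M \<rho>" and wmd: "weak_measure_density M \<rho> \<Omega>"
  shows "\<exists>C::real>0. \<forall>F\<in>borel_measurable M.
     (\<forall>x0\<in>space M. \<forall>e::real>0. \<exists>R. N (\<lambda>x. F x * indicator (\<Omega> - B x0 R) x) < ennreal e) \<longrightarrow>
     N (\<lambda>x. F x * indicator \<Omega> x) \<le> ennreal C * Liminf (at_right 0) (\<lambda>s. nsem s F)"
proof -
  obtain D where D: "1 \<le> (D::real)" and gag: "\<forall>s. \<forall>F\<in>borel_measurable M. \<forall>x\<in>\<Omega>.
     ennpowr (energy s F x) (1 / q) \<le> gag s F x \<and>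
     gag s F x \<le> ennpowr (ennreal D * energy s F x) (1 / q)"
    using gagliardo_energy by (elim exE conjE)
  obtain Q where Q: "1 \<le> (Q::real)" and tri: "\<forall>u\<in>borel_measurable M. \<forall>v\<in>borel_measurable M. \<forall>a b::real. 0 \<le> a \<longrightarrow> 0 \<le> b \<longrightarrow>
     RN u \<le> ennreal a \<longrightarrow> RN v \<le> ennreal b \<longrightarrow> RN (\<lambda>x. u x + v x) \<le> ennreal (Q * (a + b))"
    using RN_quasi_triangle by (elim exE conjE)
  obtain C2 where C2: "0 < (C2::real)" and far: "\<forall>s. 0 < s \<and> s < 1 \<longrightarrow> (\<forall>F\<in>fun_space M N.
     \<exists>G::'a \<Rightarrow> real. G \<in> borel_measurable M \<and> (\<forall>x. 0 \<le> G x) \<and> RN G \<le> ennreal C2 * N F \<and>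
       (AE x in M. ennreal s * far s x (mod_powr q F)
          \<le> ennreal (G x powr q)))"
    using far_bound by (elim exE conjE)
  obtain x0 c where x0: "x0 \<in> space M" and c: "0 < (c::real)" and mass: "\<forall>R. \<exists>R'\<ge>R. \<exists>s1>0.
    (\<forall>x\<in>B x0 R. \<forall>y\<in>space M - B x0 R'. 1 \<le> \<rho> x y) \<and>
    (\<forall>s. 0 < s \<and> s < s1 \<longrightarrow> (\<forall>x\<in>B x0 R.
      ennreal c \<le> ennreal s * (\<integral>\<^sup>+y\<in>\<Omega> - B x0 R'. ennreal (kern (s * q) x y) \<partial>M)))"
    using kernel_mass_lower_bound[OF wrd wmd \<Omega> q_pos] by (elim bexE exE conjE)
  have [measurable]: "B x0 r \<in> sets M" for r by (rule ball_sets[OF x0])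
  define A where "A = (3 * 2 powr q / c) powr (1 / q)"
  have A: "0 < A" and A_powr: "A powr q = 3 * 2 powr q / c"
    unfolding A_def using c by (auto simp: powr_inverse_cancel)
  define C where "C = Q * (A * Q * (1 + C2)) + Q"
  have C: "0 < C" "Q * (A * Q) \<le> C" "Q * (A * Q * C2 + 1) \<le> C"
    unfolding C_def using Q A C2 by (auto simp: distrib_left add_pos_pos)
  have per_s: "N (\<lambda>x. F x * indicator \<Omega> x) \<le> ennreal C * (nsem s F) + ennreal (C * e)"
    if F [measurable]: "F \<in> borel_measurable M" and e: "0 < (e::real)"
      and tail: "N (\<lambda>x. F x * indicator (\<Omega> - B x0 R) x) < ennreal e" and RR: "R \<le> R'"
      and sep: "\<forall>x\<in>B x0 R. \<forall>y\<in>space M - B x0 R'. 1 \<le> \<rho> x y"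
      and s: "0 < s \<and> s < 1" and m: "\<forall>x\<in>B x0 R.
      ennreal c \<le> ennreal s * (\<integral>\<^sup>+y\<in>\<Omega> - B x0 R'. ennreal (kern (s * q) x y) \<partial>M)" for F e R R' s
  proof -
    define l where "l = s powr (1 / q)"
    have l: "0 < l" and l_powr: "l powr q = s" unfolding l_def using s by (auto simp: powr_inverse_cancel)
    define T where "T y = F y * indicator (\<Omega> - B x0 R') y" for y
    have T [measurable]: "T \<in> borel_measurable M" unfolding T_def by measurable
    have "B x0 R \<subseteq> B x0 R'" using RR by (auto simp: mem_ball)
    then have "N T \<le> N (\<lambda>x. F x * indicator (\<Omega> - B x0 R) x)"
      by (intro quasi_norm_mono[OF N_quasi_banach]) (auto simp: T_def indicator_def)
    then have NT: "N T \<le> ennreal e" using tail by simp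
    then have TN: "T \<in> fun_space M N" unfolding fun_space_def by (auto intro: le_less_trans)
    from far[THEN spec, THEN mp, OF s, THEN bspec, OF TN]
    obtain G where G [measurable]: "G \<in> borel_measurable M" and G0: "\<forall>x. 0 \<le> G x" and NG: "RN G \<le> ennreal C2 * N T"
      and farG: "AE x in M. ennreal s * far s x (mod_powr q T)
          \<le> ennreal (G x powr q)"
      by (elim exE conjE)
    have NGe: "RN G \<le> ennreal (C2 * e)"
    proof -
      note NG
      also have "ennreal C2 * N T \<le> ennreal C2 * ennreal e" by (intro mult_left_mono NT) simp
      also have "\<dots> = ennreal (C2 * e)" using C2 e by (simp add: ennreal_mult)
      finally show ?thesis .
    qed
    have key: "N (\<lambda>x. F x * indicator \<Omega> x) \<le> ennreal (C * l) * N g + ennreal (C * e)"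
      if gN: "g \<in> fun_space M N" and maj: "AE x in M. x \<in> \<Omega> \<longrightarrow> gag s F x \<le> ennreal (cmod (g x))" for g
    proof -
      have g [measurable]: "g \<in> borel_measurable M" using gN unfolding fun_space_def by blast
      define W where "W x = l * cmod (g x) + G x" for x
      have W [measurable]: "W \<in> borel_measurable M" unfolding W_def by measurable
      have W0: "0 \<le> W x" for x unfolding W_def using l G0 by simp
      have "AE x in M. \<bar>cmod (F x) * indicator (\<Omega> \<inter> B x0 R) x\<bar> \<le> \<bar>A * W x\<bar>"
        using maj farG
      proof eventually_elim
        case (elim x)
        show ?case
        proof (cases "x \<in> \<Omega> \<inter> B x0 R")
          case True
          then have x: "x \<in> \<Omega>" and xR: "x \<in> B x0 R" by auto
          have xM: "x \<in> space M" by (rule \<Omega>_space[OF x])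
          let ?a = "ennreal (cmod (F x) powr q)"
          let ?k = "\<lambda>y. ennreal (kern (s * q) x y)"
          let ?J = "far s x (mod_powr q T)"
          have "ennpowr (energy s F x) (1 / q) \<le> ennreal (cmod (g x))"
            using gag[rule_format, OF F x, of s] elim(1) x by (blast intro: order_trans)
          then have e1: "energy s F x \<le> ennreal (cmod (g x) powr q)"
            by (rule energy_le_of_gagliardo_le) simp
          have I: "?a * (\<integral>\<^sup>+y\<in>\<Omega> - B x0 R'. ?k y \<partial>M) \<le> ennreal (2 powr q) * (energy s F x + ?J)"
            unfolding T_def by (rule energy_ge[OF x F]) (use sep xR \<Omega>_space in auto)
          have "ennreal (cmod (F x) powr q * c) = ?a * ennreal c" using c by (intro ennreal_mult) auto
          also have "\<dots> \<le> ?a * (ennreal s * (\<integral>\<^sup>+y\<in>\<Omega> - B x0 R'. ?k y \<partial>M))"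
            by (rule mult_left_mono[OF m[rule_format, OF xR]]) simp
          also have "\<dots> = ennreal s * (?a * (\<integral>\<^sup>+y\<in>\<Omega> - B x0 R'. ?k y \<partial>M))" by (rule mult.left_commute)
          also have "\<dots> \<le> ennreal s * (ennreal (2 powr q) * (energy s F x + ?J))" by (intro mult_left_mono I) simp
          also have "\<dots> = ennreal (2 powr q) * (ennreal s * energy s F x + ennreal s * ?J)"
            unfolding mult.left_commute[of "ennreal s" "ennreal (2 powr q)"] distrib_left ..
          also have "\<dots> \<le> ennreal (2 powr q) * (ennreal s * ennreal (cmod (g x) powr q) + ennreal (G x powr q))"
            by (intro mult_left_mono add_mono e1 elim(2)) simp_all
          also have "\<dots> = ennreal (2 powr q * (s * cmod (g x) powr q + G x powr q))"
            using s by (simp add: ennreal_mult)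
          finally have "cmod (F x) powr q * c \<le> 2 powr q * (s * cmod (g x) powr q + G x powr q)"
            using s by (subst (asm) ennreal_le_iff) auto
          also have "s * cmod (g x) powr q = (l * cmod (g x)) powr q" using l by (simp add: powr_mult l_powr)
          also have "2 powr q * ((l * cmod (g x)) powr q + G x powr q) \<le> 2 powr q * (3 * W x powr q)"
            using powr_sum_le[of "l * cmod (g x)" 0 "G x" q] l G0 q_pos unfolding W_def
            by (intro mult_left_mono) auto
          finally have "cmod (F x) powr q \<le> A powr q * W x powr q"
            unfolding A_powr using c by (simp add: pos_le_divide_eq mult_ac)
          also have "\<dots> = (A * W x) powr q" using A W0[of x] by (simp add: powr_mult)
          finally have le: "cmod (F x) powr q \<le> (A * W x) powr q" .
          have "cmod (F x) \<le> A * W x"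
          proof (rule ccontr)
            assume "\<not> cmod (F x) \<le> A * W x"
            then have "(A * W x) powr q < cmod (F x) powr q"
              using q_pos A W0[of x] by (intro powr_less_mono2) auto
            then show False using le by simp
          qed
          then show ?thesis using True by simp
        qed simp
      qed
      then have "RN (\<lambda>x. cmod (F x) * indicator (\<Omega> \<inter> B x0 R) x) \<le> RN (\<lambda>x. A * W x)"
        by (intro RN_mono) measurable
      moreover obtain n where n: "0 \<le> n" "N g = ennreal n" using gN unfolding fun_space_def by (cases "N g") auto
      have RW: "RN W \<le> ennreal (Q * (l * n + C2 * e))"
      proof -
        have gn: "RN (\<lambda>x. l * cmod (g x)) \<le> ennreal (l * n)"
          using RN_scale[of "\<lambda>x. cmod (g x)" l] RN_cmod[OF g] n l by (simp add: ennreal_mult)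
        show ?thesis unfolding W_def
          by (rule tri[rule_format, OF _ G _ _ gn NGe]) (use l n C2 e in auto)
      qed
      moreover have "RN (\<lambda>x. A * W x) \<le> ennreal (A * (Q * (l * n + C2 * e)))"
      proof -
        have "RN (\<lambda>x. A * W x) = ennreal A * RN W" by (rule RN_scale[OF W]) (use A in simp)
        also have "\<dots> \<le> ennreal A * ennreal (Q * (l * n + C2 * e))" by (intro mult_left_mono RW) simp
        also have "\<dots> = ennreal (A * (Q * (l * n + C2 * e)))"
          using A l Q n e C2 by (intro ennreal_mult[symmetric]) auto
        finally show ?thesis .
      qed
      ultimately have inner: "RN (\<lambda>x. cmod (F x) * indicator (\<Omega> \<inter> B x0 R) x) \<le> ennreal (A * (Q * (l * n + C2 * e)))"
        by (blast intro: order_trans)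
      have outer: "RN (\<lambda>x. cmod (F x) * indicator (\<Omega> - B x0 R) x) \<le> ennreal e"
      proof -
        have "RN (\<lambda>x. cmod (F x) * indicator (\<Omega> - B x0 R) x) = N (\<lambda>x. F x * indicator (\<Omega> - B x0 R) x)"
          by (rule quasi_norm_cong_cmod[OF N_quasi_banach]) (auto simp: indicator_def norm_mult)
        then show ?thesis using tail by simp
      qed
      have "N (\<lambda>x. F x * indicator \<Omega> x)
          = RN (\<lambda>x. cmod (F x) * indicator (\<Omega> \<inter> B x0 R) x + cmod (F x) * indicator (\<Omega> - B x0 R) x)"
        by (rule quasi_norm_cong_cmod[OF N_quasi_banach]) (auto simp: indicator_def norm_mult)
      also have "\<dots> \<le> ennreal (Q * (A * (Q * (l * n + C2 * e)) + e))"
        by (rule tri[rule_format, OF _ _ _ _ inner outer]) (use A Q l n C2 e in auto)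
      also have "Q * (A * (Q * (l * n + C2 * e)) + e) = Q * (A * Q) * (l * n) + Q * (A * Q * C2 + 1) * e"
        by (simp add: algebra_simps)
      also have "ennreal \<dots> \<le> ennreal (C * (l * n) + C * e)"
        using C l n e by (intro ennreal_leI add_mono mult_right_mono) auto
      also have "\<dots> = ennreal (C * l) * N g + ennreal (C * e)"
        unfolding n using C l n e by (simp add: ennreal_mult mult.assoc)
      finally show ?thesis .
    qed
    have Cl: "0 < C * l" using C(1) l by simp
    have "N (\<lambda>x. F x * indicator \<Omega> x) \<le> ennreal (C * l) * sem s F + ennreal (C * e)"
      unfolding sobolev_seminorm_eq ennreal_le_affine_iff[OF Cl ennreal_less_top]
    proof (rule Inf_greatest)
      fix t assume "t \<in> {N g |g. g \<in> fun_space M N \<and> (AE x in M. x \<in> \<Omega> \<longrightarrow> gag s F x \<le> ennreal (cmod (g x)))}"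
      then obtain g where t: "t = N g" and g: "g \<in> fun_space M N"
        "AE x in M. x \<in> \<Omega> \<longrightarrow> gag s F x \<le> ennreal (cmod (g x))" by blast
      show "ennreal (1 / (C * l)) * (N (\<lambda>x. F x * indicator \<Omega> x) - ennreal (C * e)) \<le> t"
        unfolding t by (rule ennreal_le_affine_iff[OF Cl ennreal_less_top, THEN iffD1, OF key[OF g]])
    qed
    also have "ennreal (C * l) = ennreal C * ennreal l" using C(1) l by (intro ennreal_mult) auto
    finally show ?thesis unfolding l_def by (simp only: mult.assoc)
  qed
  have "N (\<lambda>x. F x * indicator \<Omega> x) \<le> ennreal C * Liminf (at_right 0) (\<lambda>s. nsem s F)"
    if F: "F \<in> borel_measurable M"
      and tails: "\<forall>x0\<in>space M. \<forall>e::real>0. \<exists>R. N (\<lambda>x. F x * indicator (\<Omega> - B x0 R) x) < ennreal e" for F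
  proof (rule ennreal_le_epsilon)
    fix d :: real assume d: "0 < d"
    define e where "e = d / C"
    have e: "0 < e" unfolding e_def using d C(1) by simp
    obtain R where tail: "N (\<lambda>x. F x * indicator (\<Omega> - B x0 R) x) < ennreal e" using tails x0 e by blast
    from mass[THEN spec, of R]
    obtain R' s1 where RR: "R \<le> R'" and s1: "0 < s1" and sep: "\<forall>x\<in>B x0 R. \<forall>y\<in>space M - B x0 R'. 1 \<le> \<rho> x y"
      and m: "\<forall>s. 0 < s \<and> s < s1 \<longrightarrow> (\<forall>x\<in>B x0 R.
      ennreal c \<le> ennreal s * (\<integral>\<^sup>+y\<in>\<Omega> - B x0 R'. ennreal (kern (s * q) x y) \<partial>M))"
      by (elim exE conjE)
    have "0 < min s1 1" using s1 by simp
    then have "\<forall>\<^sub>F s in at_right 0. s \<in> {0<..<min s1 1}" by (rule eventually_at_right_real)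
    then have "\<forall>\<^sub>F s in at_right 0. ennreal (1 / C) * (N (\<lambda>x. F x * indicator \<Omega> x) - ennreal (C * e))
        \<le> nsem s F"
    proof eventually_elim
      case (elim s)
      then have "0 < s \<and> s < 1" "0 < s \<and> s < s1" by auto
      from per_s[OF F e tail RR sep this(1) m[THEN spec, THEN mp, OF this(2)]]
      show ?case by (rule ennreal_le_affine_iff[OF C(1) ennreal_less_top, THEN iffD1])
    qed
    then have "ennreal (1 / C) * (N (\<lambda>x. F x * indicator \<Omega> x) - ennreal (C * e))
        \<le> Liminf (at_right 0) (\<lambda>s. nsem s F)"
      by (rule Liminf_bounded)
    then have "N (\<lambda>x. F x * indicator \<Omega> x) \<le> ennreal C * Liminf (at_right 0) (\<lambda>s. nsem s F) + ennreal (C * e)"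
      by (rule ennreal_le_affine_iff[OF C(1) ennreal_less_top, THEN iffD2])
    moreover have "C * e = d" unfolding e_def using C(1) by simp
    ultimately show "N (\<lambda>x. F x * indicator \<Omega> x) \<le> ennreal C * Liminf (at_right 0) (\<lambda>s. nsem s F) + ennreal d"
      by simp
  qed
  then show ?thesis using C(1) by blast
qed

end

theorem theorem1p11:
  fixes M :: "'a measure" and \<rho> :: "'a \<Rightarrow> 'a \<Rightarrow> real"
    and N :: "('a \<Rightarrow> complex) \<Rightarrow> ennreal" and \<Omega> :: "'a set" and p q :: real
  assumes "0 < q" and "q \<le> p"
    and "homogeneous_type M \<rho>" and "weak_reverse_doubling M \<rho>"
    and "ball_quasi_banach M \<rho> N"
    and "\<Omega> \<in> sets M" and "weak_measure_density M \<rho> \<Omega>"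
    and "ball_banach M \<rho> (power_norm N (1 / p))"
    and "maximal_bounded_on_assoc M \<rho> (power_norm N (1 / p))"
  shows "\<exists>C C'::real. C > 0 \<and> C' > 0 \<and>
    (\<forall>\<beta>>0. \<forall>f \<in> holder_bs_on M \<rho> \<Omega> \<beta> \<inter> (\<Union>s\<in>{0<..<1}. sobolev_space M \<rho> N \<Omega> s q).
       ennreal C * restr_norm M N \<Omega> f
         \<le> Liminf (at_right 0) (\<lambda>s. ennreal (s powr (1 / q)) * sobolev_seminorm M \<rho> N \<Omega> s q f) \<and>
       Liminf (at_right 0) (\<lambda>s. ennreal (s powr (1 / q)) * sobolev_seminorm M \<rho> N \<Omega> s q f)
         \<le> Limsup (at_right 0) (\<lambda>s. ennreal (s powr (1 / q)) * sobolev_seminorm M \<rho> N \<Omega> s q f) \<and>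
       Limsup (at_right 0) (\<lambda>s. ennreal (s powr (1 / q)) * sobolev_seminorm M \<rho> N \<Omega> s q f)
         \<le> ennreal C' * restr_norm M N \<Omega> f) \<and>
    (abs_continuous_norm M N \<longrightarrow>
     (\<forall>f \<in> quot_space M N \<Omega> \<inter> (\<Union>s\<in>{0<..<1}. sobolev_space M \<rho> N \<Omega> s q).
       ennreal C * quot_norm M N \<Omega> f
         \<le> Liminf (at_right 0) (\<lambda>s. ennreal (s powr (1 / q)) * sobolev_seminorm M \<rho> N \<Omega> s q f) \<and>
       Liminf (at_right 0) (\<lambda>s. ennreal (s powr (1 / q)) * sobolev_seminorm M \<rho> N \<Omega> s q f)
         \<le> Limsup (at_right 0) (\<lambda>s. ennreal (s powr (1 / q)) * sobolev_seminorm M \<rho> N \<Omega> s q f) \<and>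
       Limsup (at_right 0) (\<lambda>s. ennreal (s powr (1 / q)) * sobolev_seminorm M \<rho> N \<Omega> s q f)
         \<le> ennreal C' * quot_norm M N \<Omega> f))"
proof -
  obtain K L where "homogeneous_space M \<rho> K L"
    using homogeneous_type_imp_homogeneous_space[OF assms(3)] by blast
  then interpret homogeneous_space M \<rho> K L .
  interpret subset_setting M \<rho> K L N p q \<Omega>
    by unfold_locales (fact assms)+
  let ?S = "\<lambda>f s. ennreal (s powr (1 / q)) * sobolev_seminorm M \<rho> N \<Omega> s q f"
  obtain C1 where C1: "0 < (C1::real)" and upper: "\<forall>F\<in>borel_measurable M. \<forall>s0. 0 < s0 \<and> s0 < 1 \<and> sobolev_seminorm M \<rho> N \<Omega> s0 q F < top \<longrightarrow>
     Limsup (at_right 0) (?S F) \<le> ennreal C1 * N F"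
    using Limsup_seminorm_le by (elim exE conjE)
  obtain C2 where C2: "0 < (C2::real)" and lower: "\<forall>F\<in>borel_measurable M.
     (\<forall>x0\<in>space M. \<forall>e::real>0. \<exists>R. N (\<lambda>x. F x * indicator (\<Omega> - B x0 R) x) < ennreal e) \<longrightarrow>
     N (\<lambda>x. F x * indicator \<Omega> x) \<le> ennreal C2 * Liminf (at_right 0) (?S F)"
    using Liminf_seminorm_ge[OF assms(4,7)] by (elim exE conjE)
  have zero_top: "0 < (top::ennreal)" by simp
  define C where "C = 1 / C2"
  have C: "0 < C" unfolding C_def using C2 by simp
  let ?bounds = "\<lambda>n f. ennreal C * n M N \<Omega> f \<le> Liminf (at_right 0) (?S f) \<and>
    Liminf (at_right 0) (?S f) \<le> Limsup (at_right 0) (?S f) \<and>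
    Limsup (at_right 0) (?S f) \<le> ennreal C1 * n M N \<Omega> f"
  have C_mult: "ennreal C * X \<le> Y" if "X \<le> ennreal C2 * Y" for X Y
  proof -
    have "ennreal C * X \<le> ennreal C * (ennreal C2 * Y)" by (intro mult_left_mono that) simp
    also have "\<dots> = Y" unfolding C_def using C2 by (simp add: mult.assoc[symmetric] ennreal_mult[symmetric])
    finally show ?thesis .
  qed
  have mid: "Liminf (at_right 0) (?S f) \<le> Limsup (at_right 0) (?S f)" for f
    by (rule Liminf_le_Limsup) simp
  have upper': "Limsup (at_right 0) (?S f) \<le> ennreal C1 * restr_norm M N \<Omega> f"
    if f: "f \<in> borel_measurable (restrict_space M \<Omega>)" and s0: "0 < s0" "s0 < 1" and fin: "sobolev_seminorm M \<rho> N \<Omega> s0 q f < top" for f s0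
  proof -
    let ?F = "\<lambda>x. f x * indicator \<Omega> x"
    have eq: "sobolev_seminorm M \<rho> N \<Omega> s q ?F = sobolev_seminorm M \<rho> N \<Omega> s q f" for s
      by (rule sobolev_seminorm_cong) simp
    have "sobolev_seminorm M \<rho> N \<Omega> s0 q ?F < top" using fin unfolding eq .
    with s0 have "0 < s0 \<and> s0 < 1 \<and> sobolev_seminorm M \<rho> N \<Omega> s0 q ?F < top" by blast
    from upper[THEN bspec, OF restrict_measurable[OF f], THEN spec, THEN mp, OF this]
    show ?thesis unfolding eq restr_norm_eq[OF f] .
  qed
  have lower': "ennreal C * restr_norm M N \<Omega> f \<le> Liminf (at_right 0) (?S f)"
    if f: "f \<in> borel_measurable (restrict_space M \<Omega>)"
      and tails: "\<And>x0 e. x0 \<in> space M \<Longrightarrow> 0 < (e::real) \<Longrightarrow>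
        \<exists>R. N (\<lambda>x. f x * indicator \<Omega> x * indicator (\<Omega> - B x0 R) x) < ennreal e" for f
  proof (rule C_mult)
    let ?F = "\<lambda>x. f x * indicator \<Omega> x"
    have eq: "sobolev_seminorm M \<rho> N \<Omega> s q ?F = sobolev_seminorm M \<rho> N \<Omega> s q f" for s
      by (rule sobolev_seminorm_cong) simp
    have FF: "?F x * indicator \<Omega> x = ?F x" for x by (simp add: indicator_def)
    from tails have "\<forall>x0\<in>space M. \<forall>e::real>0. \<exists>R. N (\<lambda>x. ?F x * indicator (\<Omega> - B x0 R) x) < ennreal e"
      by blast
    from lower[THEN bspec, OF restrict_measurable[OF f], THEN mp, OF this]
    show "restr_norm M N \<Omega> f \<le> ennreal C2 * Liminf (at_right 0) (?S f)"
      unfolding eq FF restr_norm_eq[OF f] .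
  qed
  have part1: "?bounds restr_norm f"
    if fH: "f \<in> holder_bs_on M \<rho> \<Omega> \<beta>" and fS: "f \<in> (\<Union>s\<in>{0<..<1}. sobolev_space M \<rho> N \<Omega> s q)" for \<beta> f
  proof -
    obtain s0 where s0: "0 < s0" "s0 < 1" and fin: "sobolev_seminorm M \<rho> N \<Omega> s0 q f < top"
      and f: "f \<in> borel_measurable (restrict_space M \<Omega>)"
      using fS unfolding sobolev_space_def by auto
    obtain g where g: "g \<in> holder_bs M \<rho> \<beta>" and gf: "\<forall>x\<in>\<Omega>. g x = f x"
      using fH unfolding holder_bs_on_def by blast
    obtain z r where z: "z \<in> space M" and supp: "{y \<in> space M. g y \<noteq> 0} \<subseteq> B z r"
      using g unfolding holder_bs_def by blast
    have "\<exists>R. N (\<lambda>x. f x * indicator \<Omega> x * indicator (\<Omega> - B x0 R) x) < ennreal e"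
      if x0: "x0 \<in> space M" and e: "0 < (e::real)" for x0 e
    proof (intro exI)
      let ?R = "K * (\<rho> x0 z + r)"
      have "B z r \<subseteq> B x0 ?R" by (rule ball_subset[OF z x0]) simp
      then have zero: "f x = 0" if x: "x \<in> \<Omega> - B x0 ?R" for x
      proof -
        have "x \<notin> B z r" using x \<open>B z r \<subseteq> B x0 ?R\<close> by blast
        then have "g x = 0" using supp \<Omega>_space[of x] x by blast
        then show ?thesis using gf x by auto
      qed
      have "f x * indicator \<Omega> x * indicator (\<Omega> - B x0 ?R) x = 0" for x
      proof (cases "x \<in> \<Omega> - B x0 ?R")
        case True
        then show ?thesis by (simp only: zero mult_zero_left)
      next
        case False
        then have "indicator (\<Omega> - B x0 ?R) x = (0::complex)" by (rule indicator_simps(2))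
        then show ?thesis by (simp only: mult_zero_right)
      qed
      then have "N (\<lambda>x. f x * indicator \<Omega> x * indicator (\<Omega> - B x0 ?R) x) = N (\<lambda>x. 0)" by presburger
      also have "\<dots> = 0" using quasi_norm_zero_iff[OF N_quasi_banach, of "\<lambda>x. 0"] by simp
      also have "\<dots> < ennreal e" using e by simp
      finally show "N (\<lambda>x. f x * indicator \<Omega> x * indicator (\<Omega> - B x0 ?R) x) < ennreal e" .
    qed
    from lower'[OF f this] upper'[OF f s0 fin] mid show ?thesis by blast
  qed
  have part2: "?bounds quot_norm f"
    if ac: "abs_continuous_norm M N" and fQ: "f \<in> quot_space M N \<Omega>"
      and fS: "f \<in> (\<Union>s\<in>{0<..<1}. sobolev_space M \<rho> N \<Omega> s q)" for f
  proof -
    obtain s0 where s0: "0 < s0" "s0 < 1" and fin: "sobolev_seminorm M \<rho> N \<Omega> s0 q f < top"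
      and f: "f \<in> borel_measurable (restrict_space M \<Omega>)"
      using fS unfolding sobolev_space_def by auto
    define h where "h a x = f x + complex_of_real a" for a x
    have h: "h a \<in> borel_measurable (restrict_space M \<Omega>)" for a unfolding h_def using f by measurable
    have quot: "quot_norm M N \<Omega> f = (INF a. restr_norm M N \<Omega> (h a))" unfolding quot_norm_def h_def ..
    have h_eq: "sobolev_seminorm M \<rho> N \<Omega> s q (h a) = sobolev_seminorm M \<rho> N \<Omega> s q f" for s a
      unfolding h_def by (rule sobolev_seminorm_translate)
    have "quot_norm M N \<Omega> f < top" using fQ unfolding quot_space_def by blast
    then obtain a where a: "restr_norm M N \<Omega> (h a) < top" unfolding quot INF_less_iff by blast
    let ?F = "\<lambda>x. h a x * indicator \<Omega> x"
    have F: "?F \<in> fun_space M N"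
      using restrict_measurable[OF h] a unfolding restr_norm_eq[OF h] fun_space_def by blast
    have "\<exists>R. N (\<lambda>x. ?F x * indicator (\<Omega> - B x0 R) x) < ennreal e"
      if x0: "x0 \<in> space M" and e: "0 < (e::real)" for x0 e
    proof -
      define E where "E j = \<Omega> - B x0 (real (Suc j))" for j
      have E: "E j \<in> sets M" for j unfolding E_def using ball_sets[OF x0] by simp
      have "(\<lambda>j. indicator (E j) x :: real) \<longlonglongrightarrow> 0" if x: "x \<in> space M" for x
      proof (rule tendsto_eventually)
        obtain n where n: "x \<in> B x0 (real (Suc n))" using x space_eq_Union_balls[OF x0] by blast
        have "indicator (E j) x = (0::real)" if nj: "n \<le> j" for j
        proof -
          have "\<rho> x0 x < real (Suc n)" using n by (simp only: mem_ball)
          also have "\<dots> \<le> real (Suc j)" using nj by simp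
          finally have "x \<in> B x0 (real (Suc j))" using x by (simp only: mem_ball)
          then have "x \<notin> E j" unfolding E_def by blast
          then show ?thesis by (rule indicator_simps(2))
        qed
        then show "\<forall>\<^sub>F j in sequentially. indicator (E j) x = (0::real)"
          unfolding eventually_sequentially by (intro exI[of _ n]) blast
      qed
      then have "(\<forall>j. E j \<in> sets M) \<and> (AE x in M. (\<lambda>j. indicator (E j) x :: real) \<longlonglongrightarrow> 0)"
        by (intro conjI allI E AE_I2)
      from ac[unfolded abs_continuous_norm_def, THEN bspec, OF F, THEN spec, THEN mp, OF this]
      have "\<forall>\<^sub>F j in sequentially. N (\<lambda>x. ?F x * indicator (E j) x) < ennreal e"
        by (rule order_tendstoD) (use e in simp)
      then obtain j where "N (\<lambda>x. ?F x * indicator (E j) x) < ennreal e"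
        using eventually_happens'[OF sequentially_bot] by blast
      then show ?thesis unfolding E_def by (rule exI)
    qed
    from lower'[OF h this] have "ennreal C * restr_norm M N \<Omega> (h a) \<le> Liminf (at_right 0) (?S f)"
      unfolding h_eq by blast
    moreover have "ennreal C * quot_norm M N \<Omega> f \<le> ennreal C * restr_norm M N \<Omega> (h a)"
      unfolding quot by (intro mult_left_mono INF_lower) auto
    ultimately have "ennreal C * quot_norm M N \<Omega> f \<le> Liminf (at_right 0) (?S f)" by (rule order_trans[rotated])
    moreover have "Limsup (at_right 0) (?S f) \<le> ennreal C1 * quot_norm M N \<Omega> f + 0"
      unfolding ennreal_le_affine_iff[OF C1 zero_top] quot
    proof (rule INF_greatest)
      fix b
      have "sobolev_seminorm M \<rho> N \<Omega> s0 q (h b) < top" using fin unfolding h_eq .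
      from upper'[OF h s0 this] have "Limsup (at_right 0) (?S f) \<le> ennreal C1 * restr_norm M N \<Omega> (h b) + 0"
        unfolding h_eq by simp
      then show "ennreal (1 / C1) * (Limsup (at_right 0) (?S f) - 0) \<le> restr_norm M N \<Omega> (h b)"
        by (rule ennreal_le_affine_iff[OF C1 zero_top, THEN iffD1])
    qed
    ultimately show ?thesis using mid[of f] by simp
  qed
  show ?thesis
  proof (rule exI[of _ C], rule exI[of _ C1], intro conjI C C1)
    show "\<forall>\<beta>>0. \<forall>f\<in>holder_bs_on M \<rho> \<Omega> \<beta> \<inter> (\<Union>s\<in>{0<..<1}. sobolev_space M \<rho> N \<Omega> s q).
      ?bounds restr_norm f"
      by (intro allI impI ballI) (elim IntE, rule part1)
    show "abs_continuous_norm M N \<longrightarrow>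
      (\<forall>f\<in>quot_space M N \<Omega> \<inter> (\<Union>s\<in>{0<..<1}. sobolev_space M \<rho> N \<Omega> s q).
      ?bounds quot_norm f)"
      by (intro impI ballI) (elim IntE, rule part2)
  qed
qed

end
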